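(* Let $H$ be a real Hilbert space and let $A$ be a self-adjoint linear operator on $H$ with dense domain $D(A)$. Let $(u_0,u_1)\in D(A)\times D(A^{1/2})$, let $p\in[0,1]$, and let $m:[0,+\infty)\to(0,+\infty)$ be a locally Lipschitz continuous function. Assume that $$\mu:=\inf\{m(\sigma):\sigma\ge 0\}>0,\qquad \nu:=\inf\{\langle Au,u\rangle: u\in D(A),\ |u|=1\}>0 .$$ Let $u$, $\varepsilon_0$, $u_\varepsilon$, $r_\varepsilon$, $\rho_\varepsilon$ (for $\varepsilon\in(0,\varepsilon_0)$) be as defined in the context, and set $$\Gamma_{r,\varepsilon}(t):=|\rho_\varepsilon(t)|^2+|A^{1/2}\rho_\varepsilon(t)|^2+\varepsilon|r_\varepsilon'(t)|^2,$$ $$\Gamma_{c,\varepsilon}(t):=|\rho_\varepsilon(t)|^2+|A^{1/2}\rho_\varepsilon(t)|^2+|A\rho_\varepsilon(t)|^2+|r_\varepsilon'(t)|^2+\varepsilon|A^{1/2}r_\varepsilon'(t)|^2.$$ (1) If in addition $(u_0,u_1)\in D(A^{3/2})\times D(A^{1/2})$, then the following decay-error estimates hold. - If $p=0$: for every $\beta<2\mu\nu$ there exist $\varepsilon_1\in(0,\varepsilon_0]$ and $C$ such that $\Gamma_{r,\varepsilon}(t)\le C\varepsilon^2e^{-\beta t}$ for all $t\ge 0$ and all $\varepsilon\in(0,\varepsilon_1)$. - If $p\in(0,1)$: for every $\beta>0$ there exist $\varepsilon_1\in(0,\varepsilon_0]$ and $C$ such that $\Gamma_{r,\varepsilon}(t)\le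 C\varepsilon^2e^{-\beta(1+t)^{1-p}}$ for all $t\ge 0$ and all $\varepsilon\in(0,\varepsilon_1)$. - If $p=1$: for every $\beta>0$ there exist $\varepsilon_1\in(0,\varepsilon_0]$ and $C$ such that $\Gamma_{r,\varepsilon}(t)\le \dfrac{C\varepsilon^2}{(1+t)^\beta}$ for all $t\ge 0$ and all $\varepsilon\in(0,\varepsilon_1)$. (2) If in addition $(u_0,u_1)\in D(A^2)\times D(A)$, then the same decay-error estimates (in each of the three cases for $p$, with the same quantifiers) hold with $\Gamma_{c,\varepsilon}(t)$ instead of $\Gamma_{r,\varepsilon}(t)$. (The constants $C$ and $\varepsilon_1$ may depend on $\beta$; $C$ does not depend on $\varepsilon$ or $t$.)
   Context: $|x|$ and $\langle x,y\rangle$ denote the norm and scalar product of $H$. The operator $A$ may be unbounded; its powers $A^\alpha$ ($\alpha\ge 0$) are defined by the spectral theorem on domains $D(A^\alpha)$, endowed with the graph norm. Parabolic solution: $u\in C^1([0,+\infty);H)\cap C^0([0,+\infty);D(A))$ is the unique global solution of $$\frac{1}{(1+t)^p}u'(t)+m\left(|A^{1/2}u(t)|^2\right)Au(t)=0\quad(t\ge 0),\qquad u(0)=u_0.$$ Hyperbolic solution: $\varepsilon_0>0$ is such that for every $\varepsilon\in(0,\varepsilon_0)$ the problem $$\varepsilon u_\varepsilon''(t)+\frac{1}{(1+t)^p}u_\varepsilon'(t)+m\left(|A^{1/2}u_\varepsilon(t)|^2\right)Au_\varepsilon(t)=0\quad(t\ge 0),\qquad u_\varepsilon(0)=u_0,\quad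 u_\varepsilon'(0)=u_1,$$ has a unique global solution $u_\varepsilon\in C^2([0,+\infty);H)\cap C^1([0,+\infty);D(A^{1/2}))\cap C^0([0,+\infty);D(A))$ (such an $\varepsilon_0$ exists). Corrector: $\theta_\varepsilon:[0,+\infty)\to H$ is the solution of $$\varepsilon\theta_\varepsilon''(t)+\frac{1}{(1+t)^p}\theta_\varepsilon'(t)=0\quad(t\ge 0),\qquad \theta_\varepsilon(0)=0,\qquad \theta_\varepsilon'(0)=u_1+m\left(|A^{1/2}u_0|^2\right)Au_0 .$$ Remainders: $r_\varepsilon$ and $\rho_\varepsilon$ are defined by $u_\varepsilon(t)=u(t)+\theta_\varepsilon(t)+r_\varepsilon(t)=u(t)+\rho_\varepsilon(t)$ for all $t\ge 0$. *)

theory Defs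
  imports "HOL-Analysis.Analysis"
begin

section \<open>Self-adjoint operators and their powers\<close>

text \<open>An unbounded operator is a pair of a domain \<open>D\<close> and a function \<open>A\<close>, whose values outside
  \<open>D\<close> are irrelevant.\<close>

definition linear_operator :: "'h::real_inner set \<Rightarrow> ('h \<Rightarrow> 'h) \<Rightarrow> bool" where
  "linear_operator D A \<longleftrightarrow> subspace D \<and>
     (\<forall>x\<in>D. \<forall>y\<in>D. A (x + y) = A x + A y) \<and> (\<forall>x\<in>D. \<forall>c. A (c *\<^sub>R x) = c *\<^sub>R A x)"

definition operator_graph :: "'h set \<Rightarrow> ('h \<Rightarrow> 'h) \<Rightarrow> ('h \<times> 'h) set" where
  "operator_graph D A = {(x, A x) | x. x \<in> D}"

definition adjoint_graph :: "'h::real_inner set \<Rightarrow> ('h \<Rightarrow> 'h) \<Rightarrow> ('h \<times> 'h) set" where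
  "adjoint_graph D A = {(y, z). \<forall>x\<in>D. inner (A x) y = inner x z}"

definition self_adjoint :: "'h::real_inner set \<Rightarrow> ('h \<Rightarrow> 'h) \<Rightarrow> bool" where
  "self_adjoint D A \<longleftrightarrow> linear_operator D A \<and> closure D = UNIV \<and>
     adjoint_graph D A = operator_graph D A"

definition projection_valued_measure :: "(real set \<Rightarrow> 'h::real_inner \<Rightarrow> 'h) \<Rightarrow> bool" where
  "projection_valued_measure E \<longleftrightarrow>
     (\<forall>S\<in>sets borel. bounded_linear (E S) \<and>
        (\<forall>x. E S (E S x) = E S x) \<and> (\<forall>x y. inner (E S x) y = inner x (E S y))) \<and>
     (\<forall>x. E {} x = 0) \<and> (\<forall>x. E UNIV x = x) \<and>
     (\<forall>S\<in>sets borel. \<forall>T\<in>sets borel. \<forall>x. E (S \<inter> T) x = E S (E T x)) \<and>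
     (\<forall>F :: nat \<Rightarrow> real set. range F \<subseteq> sets borel \<longrightarrow> disjoint_family F \<longrightarrow>
        (\<forall>x. (\<lambda>n. E (F n) x) sums E (\<Union>n. F n) x))"

definition spectral_dist :: "(real set \<Rightarrow> 'h::real_inner \<Rightarrow> 'h) \<Rightarrow> 'h \<Rightarrow> real measure" where
  "spectral_dist E x = measure_of UNIV (sets borel) (\<lambda>S. ennreal (inner (E S x) x))"

definition spectral_integral_dom ::
    "(real set \<Rightarrow> 'h::real_inner \<Rightarrow> 'h) \<Rightarrow> (real \<Rightarrow> real) \<Rightarrow> 'h set" where
  "spectral_integral_dom E f = {x. (\<integral>\<^sup>+ l. ennreal ((f l)\<^sup>2) \<partial>spectral_dist E x) < \<infinity>}"

text \<open>The integral of \<open>f\<close> against the signed measure \<open>S \<mapsto> \<langle>E(S)x, z\<rangle>\<close>, by polarization.  For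
  \<open>x, z\<close> in the domain above, \<open>f\<close> is square integrable, hence integrable, against both finite
  measures.\<close>

definition spectral_form ::
    "(real set \<Rightarrow> 'h::real_inner \<Rightarrow> 'h) \<Rightarrow> (real \<Rightarrow> real) \<Rightarrow> 'h \<Rightarrow> 'h \<Rightarrow> real" where
  "spectral_form E f x z =
     ((LINT l|spectral_dist E (x + z). f l) - (LINT l|spectral_dist E (x - z). f l)) / 4"

text \<open>The vector \<open>\<integral> f dE x\<close>; it is unique because the domain of \<open>\<integral> f dE\<close> is dense.\<close>

definition spectral_integral ::
    "(real set \<Rightarrow> 'h::real_inner \<Rightarrow> 'h) \<Rightarrow> (real \<Rightarrow> real) \<Rightarrow> 'h \<Rightarrow> 'h" where
  "spectral_integral E f x =
     (THE y. \<forall>z\<in>spectral_integral_dom E f. inner y z = spectral_form E f x z)"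

definition is_spectral_measure ::
    "'h::real_inner set \<Rightarrow> ('h \<Rightarrow> 'h) \<Rightarrow> (real set \<Rightarrow> 'h \<Rightarrow> 'h) \<Rightarrow> bool" where
  "is_spectral_measure D A E \<longleftrightarrow> projection_valued_measure E \<and>
     D = spectral_integral_dom E (\<lambda>l. l) \<and> (\<forall>x\<in>D. A x = spectral_integral E (\<lambda>l. l) x)"

definition spectral_measure ::
    "'h::real_inner set \<Rightarrow> ('h \<Rightarrow> 'h) \<Rightarrow> (real set \<Rightarrow> 'h \<Rightarrow> 'h)" where
  "spectral_measure D A = (SOME E. is_spectral_measure D A E)"

text \<open>The power \<open>A\<^sup>\<alpha> = \<integral> \<lambda>\<^sup>\<alpha> dE(\<lambda>)\<close> (\<open>\<alpha> > 0\<close>) of a nonnegative self-adjoint operator.  The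
  spectral measure is then concentrated on \<open>[0, \<infinity>)\<close>, so the values of \<open>powr\<close> at negative
  arguments play no role.  By the spectral theorem every self-adjoint operator has a (unique)
  spectral measure; an operator without one is given powers with empty domain.\<close>

definition power_dom :: "'h::real_inner set \<Rightarrow> ('h \<Rightarrow> 'h) \<Rightarrow> real \<Rightarrow> 'h set" where
  "power_dom D A \<alpha> = {x. is_spectral_measure D A (spectral_measure D A) \<and>
     x \<in> spectral_integral_dom (spectral_measure D A) (\<lambda>l. l powr \<alpha>)}"

definition power_op :: "'h::real_inner set \<Rightarrow> ('h \<Rightarrow> 'h) \<Rightarrow> real \<Rightarrow> 'h \<Rightarrow> 'h" where
  "power_op D A \<alpha> = spectral_integral (spectral_measure D A) (\<lambda>l. l powr \<alpha>)"


section \<open>Functions of class \<open>C\<^sup>k\<close> on the half-line\<close>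

text \<open>Derivatives are taken within \<open>[0, \<infinity>)\<close>, hence one-sided at \<open>0\<close>, and depend only on the values
  of the function on \<open>[0, \<infinity>)\<close>.\<close>

definition dt :: "(real \<Rightarrow> 'h::real_normed_vector) \<Rightarrow> real \<Rightarrow> 'h" where
  "dt u t = vector_derivative u (at t within {0..})"

definition C1_half_line :: "(real \<Rightarrow> 'h::real_normed_vector) \<Rightarrow> bool" where
  "C1_half_line u \<longleftrightarrow>
     (\<forall>t\<ge>0. (u has_vector_derivative dt u t) (at t within {0..})) \<and> continuous_on {0..} (dt u)"

definition C2_half_line :: "(real \<Rightarrow> 'h::real_normed_vector) \<Rightarrow> bool" where
  "C2_half_line u \<longleftrightarrow> C1_half_line u \<and> C1_half_line (dt u)"

text \<open>Continuity and continuous differentiability with values in the domain \<open>D\<close> of an operator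
  \<open>B\<close>, with respect to the graph norm.\<close>

definition C0_graph ::
    "'h set \<Rightarrow> ('h \<Rightarrow> 'h) \<Rightarrow> (real \<Rightarrow> 'h::real_normed_vector) \<Rightarrow> bool" where
  "C0_graph D B u \<longleftrightarrow> (\<forall>t\<ge>0. u t \<in> D) \<and>
     continuous_on {0..} u \<and> continuous_on {0..} (\<lambda>t. B (u t))"

definition C1_graph ::
    "'h set \<Rightarrow> ('h \<Rightarrow> 'h) \<Rightarrow> (real \<Rightarrow> 'h::real_normed_vector) \<Rightarrow> bool" where
  "C1_graph D B u \<longleftrightarrow> C0_graph D B u \<and> C0_graph D B (dt u) \<and>
     (\<forall>t\<ge>0. (u has_vector_derivative dt u t) (at t within {0..}) \<and>
            ((\<lambda>s. B (u s)) has_vector_derivative B (dt u t)) (at t within {0..}))"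


section \<open>The Cauchy problems\<close>

definition unique_solution :: "((real \<Rightarrow> 'h) \<Rightarrow> bool) \<Rightarrow> (real \<Rightarrow> 'h) \<Rightarrow> bool" where
  "unique_solution P u \<longleftrightarrow> P u \<and> (\<forall>v. P v \<longrightarrow> (\<forall>t\<ge>0. v t = u t))"

definition kirchhoff_term ::
    "'h::real_inner set \<Rightarrow> ('h \<Rightarrow> 'h) \<Rightarrow> (real \<Rightarrow> real) \<Rightarrow> 'h \<Rightarrow> 'h" where
  "kirchhoff_term D A m x = m ((norm (power_op D A (1/2) x))\<^sup>2) *\<^sub>R A x"

definition parabolic_solution ::
    "'h::real_inner set \<Rightarrow> ('h \<Rightarrow> 'h) \<Rightarrow> (real \<Rightarrow> real) \<Rightarrow> real \<Rightarrow> 'h \<Rightarrow> (real \<Rightarrow> 'h) \<Rightarrow> bool" where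
  "parabolic_solution D A m p u0 u \<longleftrightarrow>
     C1_half_line u \<and> C0_graph D A u \<and>
     (\<forall>t\<ge>0. (1 / (1 + t) powr p) *\<^sub>R dt u t + kirchhoff_term D A m (u t) = 0) \<and>
     u 0 = u0"

definition hyperbolic_solution ::
    "'h::real_inner set \<Rightarrow> ('h \<Rightarrow> 'h) \<Rightarrow> (real \<Rightarrow> real) \<Rightarrow> real \<Rightarrow> 'h \<Rightarrow> 'h \<Rightarrow> real \<Rightarrow>
     (real \<Rightarrow> 'h) \<Rightarrow> bool" where
  "hyperbolic_solution D A m p u0 u1 \<epsilon> u \<longleftrightarrow>
     C2_half_line u \<and> C1_graph (power_dom D A (1/2)) (power_op D A (1/2)) u \<and> C0_graph D A u \<and>
     (\<forall>t\<ge>0. \<epsilon> *\<^sub>R dt (dt u) t + (1 / (1 + t) powr p) *\<^sub>R dt u t + kirchhoff_term D A m (u t) = 0) \<and>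
     u 0 = u0 \<and> dt u 0 = u1"

definition corrector_solution ::
    "'h::real_inner set \<Rightarrow> ('h \<Rightarrow> 'h) \<Rightarrow> (real \<Rightarrow> real) \<Rightarrow> real \<Rightarrow> 'h \<Rightarrow> 'h \<Rightarrow> real \<Rightarrow>
     (real \<Rightarrow> 'h) \<Rightarrow> bool" where
  "corrector_solution D A m p u0 u1 \<epsilon> \<theta> \<longleftrightarrow>
     C2_half_line \<theta> \<and>
     (\<forall>t\<ge>0. \<epsilon> *\<^sub>R dt (dt \<theta>) t + (1 / (1 + t) powr p) *\<^sub>R dt \<theta> t = 0) \<and>
     \<theta> 0 = 0 \<and> dt \<theta> 0 = u1 + kirchhoff_term D A m u0"


section \<open>Decay-error estimates\<close>

definition Gamma_r ::
    "'h::real_inner set \<Rightarrow> ('h \<Rightarrow> 'h) \<Rightarrow> real \<Rightarrow> (real \<Rightarrow> 'h) \<Rightarrow> (real \<Rightarrow> 'h) \<Rightarrow> real \<Rightarrow> real" where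
  "Gamma_r D A \<epsilon> \<rho> r t =
     (norm (\<rho> t))\<^sup>2 + (norm (power_op D A (1/2) (\<rho> t)))\<^sup>2 + \<epsilon> * (norm (dt r t))\<^sup>2"

definition Gamma_c ::
    "'h::real_inner set \<Rightarrow> ('h \<Rightarrow> 'h) \<Rightarrow> real \<Rightarrow> (real \<Rightarrow> 'h) \<Rightarrow> (real \<Rightarrow> 'h) \<Rightarrow> real \<Rightarrow> real" where
  "Gamma_c D A \<epsilon> \<rho> r t =
     (norm (\<rho> t))\<^sup>2 + (norm (power_op D A (1/2) (\<rho> t)))\<^sup>2 + (norm (A (\<rho> t)))\<^sup>2 +
     (norm (dt r t))\<^sup>2 + \<epsilon> * (norm (power_op D A (1/2) (dt r t)))\<^sup>2"

definition error_bound :: "real \<Rightarrow> (real \<Rightarrow> real \<Rightarrow> real) \<Rightarrow> (real \<Rightarrow> real) \<Rightarrow> bool" where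
  "error_bound \<epsilon>0 \<Gamma> g \<longleftrightarrow> (\<exists>\<epsilon>1 C. 0 < \<epsilon>1 \<and> \<epsilon>1 \<le> \<epsilon>0 \<and>
     (\<forall>t\<ge>0. \<forall>\<epsilon>\<in>{0<..<\<epsilon>1}. \<Gamma> \<epsilon> t \<le> C * \<epsilon>\<^sup>2 * g t))"

definition decay_error_estimates ::
    "real \<Rightarrow> ereal \<Rightarrow> ereal \<Rightarrow> real \<Rightarrow> (real \<Rightarrow> real \<Rightarrow> real) \<Rightarrow> bool" where
  "decay_error_estimates p \<mu> \<nu> \<epsilon>0 \<Gamma> \<longleftrightarrow>
     (p = 0 \<longrightarrow> (\<forall>\<beta>. ereal \<beta> < 2 * \<mu> * \<nu> \<longrightarrow> error_bound \<epsilon>0 \<Gamma> (\<lambda>t. exp (- \<beta> * t)))) \<and>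
     (0 < p \<and> p < 1 \<longrightarrow>
        (\<forall>\<beta>>0. error_bound \<epsilon>0 \<Gamma> (\<lambda>t. exp (- \<beta> * (1 + t) powr (1 - p))))) \<and>
     (p = 1 \<longrightarrow> (\<forall>\<beta>>0. error_bound \<epsilon>0 \<Gamma> (\<lambda>t. 1 / (1 + t) powr \<beta>)))"

end

theory Submission
  imports Defs
begin

text \<open>The data \<open>u1 \<in> D(A\<^sup>1\<^sup>/\<^sup>2)\<close> already provide a spectral measure \<open>E\<close> of \<open>A\<close>, so that all operators can be
  replaced by the bounded ones \<open>B\<^sub>n = A\<^sup>1\<^sup>/\<^sup>2 P\<^sub>n\<close>, \<open>P\<^sub>n = E([\<nu>, n])\<close>; every estimate is proved for the truncations,
  uniformly in \<open>n\<close>, and then passes to the limit.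

  With \<open>b(t) = (1 + t)\<^sup>-\<^sup>p\<close>, \<open>G = \<integral> b\<close> and \<open>y = \<rho>\<close>, \<open>v = r'\<close>, \<open>y' = v + \<theta>'\<close>, the basic functional is
  \<open>\<kappa> b (b |y|\<^sup>2 + 2 \<epsilon> \<langle>y, v\<rangle>) + \<epsilon> |v|\<^sup>2 / c\<^sub>\<epsilon> + |A\<^sup>1\<^sup>/\<^sup>2 y|\<^sup>2\<close>, where \<open>c\<^sub>\<epsilon> = m(|A\<^sup>1\<^sup>/\<^sup>2 u\<^sub>\<epsilon>|\<^sup>2)\<close>.  For small \<open>\<epsilon>\<close> it decays at any
  rate \<open>a\<close> with \<open>a \<le> \<beta> b\<close> and \<open>a b < 2 \<mu> \<nu>\<close>; since \<open>b \<rightarrow> 0\<close> for \<open>p > 0\<close>, the second condition then only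
  matters for bounded \<open>t\<close>, which explains the different ranges of \<open>\<beta>\<close>.  Applied to \<open>u\<^sub>\<epsilon>\<close> itself, one level up, the
  same functional gives, by a bootstrap argument, the bound on \<open>c\<^sub>\<epsilon>'\<close> on which it relies.  The term \<open>\<epsilon> u''\<close> is absorbed by the
  dissipation of the parabolic flow, the integrable corrector \<open>\<theta>'\<close> by a bounded factor of the weight, and the
  nonlinear term, which involves the full remainder, by a second continuation argument.

  As \<open>m\<close> is only locally Lipschitz, neither \<open>c\<^sub>\<epsilon>\<close> nor \<open>u'\<close> need be differentiable: derivatives are replaced by
  one-sided derivatives up to a Lipschitz error.\<close>

section \<open>One-sided derivatives up to a Lipschitz error\<close>

text \<open>For p > 0 the dissipation carries the factor b, which tends to 0, so every perturbation
  has to be of order b or integrable in time. The bound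
  \<open>1 \<le> c0 * W t * (damping p t)\<^sup>2\<close> turns a weighted bound on the norm of A
  applied to the hyperbolic solution into a bound of order b; hence its coefficient varies with
  speed of order b, and a small \<epsilon> makes this harmless. The gap \<omega> in a b \<le> 2
  \<mu> \<nu> - \<omega> leaves the parabolic flow an additional decay exp (- \<omega> t), which
  pays for powers of 1 / b \<le> 1 + t. The assumption p \<le> 1 enters through |b'| \<le> b^2 and
  exp G \<ge> 1 + t. In the functional, the division of |v|^2 by the coefficient makes the mixed
  terms of A^(1/2) y and A^(1/2) v cancel, and the combination b |y|^2 + 2 \<epsilon> <y, v> makes 2
  b <y, v> cancel. The choice \<kappa> \<omega> = (\<beta> + 2) \<nu> leaves the dissipation 2 b
  |A^(1/2) y|^2 after the growth of the weight has been paid for. Removing the factor \<epsilon> in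
  front of |r'|^2 costs a factor b^2. For p > 0 this loss is recovered at the end by running the
  argument with a larger \<beta>.\<close>

definition approx_deriv :: "(real \<Rightarrow> 'a::real_normed_vector) \<Rightarrow> 'a \<Rightarrow> real \<Rightarrow> real \<Rightarrow> bool" where
  "approx_deriv f d V t \<longleftrightarrow>
     (\<forall>e>0. \<forall>\<^sub>F s in at_right t. norm (f s - f t - (s - t) *\<^sub>R d) \<le> (V + e) * (s - t))"

definition dini_le :: "(real \<Rightarrow> real) \<Rightarrow> real \<Rightarrow> real \<Rightarrow> bool" where
  "dini_le f d t \<longleftrightarrow> (\<forall>e>0. \<forall>\<^sub>F s in at_right t. f s - f t \<le> (d + e) * (s - t))"

lemma eventually_at_right_near: "a > 0 \<Longrightarrow> \<forall>\<^sub>F s in at_right t. t < s \<and> s < t + (a::real)"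
  unfolding eventually_at_right_field by (rule exI[of _ "t + a"]) auto

lemma approx_deriv_vector:
  assumes "(f has_vector_derivative d) (at_right t)"
  shows "approx_deriv f d 0 t"
  unfolding approx_deriv_def
proof (intro allI impI)
  fix e :: real assume e: "e > 0"
  have "((\<lambda>s. norm ((f s - f t) - (s - t) *\<^sub>R d) / norm (s - t)) \<longlongrightarrow> 0) (at_right t)"
    using assms by (simp add: has_vector_derivative_def has_derivative_iff_norm)
  then have "\<forall>\<^sub>F s in at_right t. norm ((f s - f t) - (s - t) *\<^sub>R d) / norm (s - t) < e"
    using e by (rule order_tendstoD)
  then show "\<forall>\<^sub>F s in at_right t. norm (f s - f t - (s - t) *\<^sub>R d) \<le> (0 + e) * (s - t)"
    using eventually_at_right_near[OF zero_less_one, of t]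
    by eventually_elim (auto simp: divide_simps split: if_splits)
qed

lemma approx_deriv_mono:
  assumes "approx_deriv f d V t" "V + norm (d - d') \<le> V'"
  shows "approx_deriv f d' V' t"
  unfolding approx_deriv_def
proof (intro allI impI)
  fix e :: real assume e: "e > 0"
  show "\<forall>\<^sub>F s in at_right t. norm (f s - f t - (s - t) *\<^sub>R d') \<le> (V' + e) * (s - t)"
    using assms(1)[unfolded approx_deriv_def, rule_format, OF e] eventually_at_right_near[OF zero_less_one, of t]
  proof eventually_elim
    case (elim s)
    have "f s - f t - (s - t) *\<^sub>R d' = (f s - f t - (s - t) *\<^sub>R d) + (s - t) *\<^sub>R (d - d')"
      by (simp add: scaleR_diff_right)
    then have "norm (f s - f t - (s - t) *\<^sub>R d') \<le>
        norm (f s - f t - (s - t) *\<^sub>R d) + norm ((s - t) *\<^sub>R (d - d'))"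
      by (simp only: norm_triangle_ineq)
    also have "\<dots> \<le> (V + e) * (s - t) + (s - t) * norm (d - d')"
      using elim by simp
    also have "\<dots> = (V + norm (d - d') + e) * (s - t)"
      by (simp add: algebra_simps)
    also have "\<dots> \<le> (V' + e) * (s - t)"
      using elim assms(2) by (intro mult_right_mono) auto
    finally show ?case .
  qed
qed

lemma approx_deriv_add:
  assumes "approx_deriv f d V t" "approx_deriv g d' V' t"
  shows "approx_deriv (\<lambda>s. f s + g s) (d + d') (V + V') t"
  unfolding approx_deriv_def
proof (intro allI impI)
  fix e :: real assume "e > 0"
  then have e: "e / 2 > 0" by simp
  show "\<forall>\<^sub>F s in at_right t.
      norm (f s + g s - (f t + g t) - (s - t) *\<^sub>R (d + d')) \<le> (V + V' + e) * (s - t)"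
    using assms(1)[unfolded approx_deriv_def, rule_format, OF e]
      assms(2)[unfolded approx_deriv_def, rule_format, OF e]
  proof eventually_elim
    case (elim s)
    have "norm (f s + g s - (f t + g t) - (s - t) *\<^sub>R (d + d')) =
        norm ((f s - f t - (s - t) *\<^sub>R d) + (g s - g t - (s - t) *\<^sub>R d'))"
      by (simp add: scaleR_add_right algebra_simps)
    also have "\<dots> \<le> (V + e / 2) * (s - t) + (V' + e / 2) * (s - t)"
      using elim by (intro norm_triangle_le add_mono)
    finally show ?case by (simp add: algebra_simps)
  qed
qed

text \<open>The product of the two increments is of second order in s - t, so only the two mixed
  terms contribute to the error. Constant 1 in the bound on \<open>pr\<close> keeps operator norms
  out of the error constants.\<close>

lemma approx_deriv_bilinear:
  assumes bil: "bounded_bilinear pr" and le: "\<And>x y. norm (pr x y) \<le> norm x * norm y"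
    and f: "approx_deriv f d V t" and g: "approx_deriv g d' V' t"
  shows "approx_deriv (\<lambda>s. pr (f s) (g s)) (pr (f t) d' + pr d (g t))
           (norm (f t) * V' + V * norm (g t)) t"
  unfolding approx_deriv_def
proof (intro allI impI)
  interpret bounded_bilinear pr by fact
  fix e :: real assume e: "e > 0"
  define M where "M = norm (f t) + norm (g t) + 1"
  have M: "M > 0" "norm (f t) + norm (g t) \<le> M" by (auto simp: M_def intro: add_nonneg_pos)
  \<comment> \<open>The choice of \<open>e1\<close> and the restriction s - t < e / (2 K) each cost
    at most e / 2: the first in the mixed terms, the second in the product of the
    increments.\<close>
  define e1 where "e1 = e / (2 * M)"
  have e1: "e1 > 0" using e M by (simp add: e1_def)
  define K where "K = (\<bar>V\<bar> + e1 + norm d) * (\<bar>V'\<bar> + e1 + norm d') + 1"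
  have K: "K > 0" using e1 unfolding K_def by (intro add_nonneg_pos mult_nonneg_nonneg) auto
  have dK: "e / (2 * K) > 0" using e K by simp
  show "\<forall>\<^sub>F s in at_right t. norm (pr (f s) (g s) - pr (f t) (g t) - (s - t) *\<^sub>R (pr (f t) d' + pr d (g t)))
      \<le> (norm (f t) * V' + V * norm (g t) + e) * (s - t)"
    using f[unfolded approx_deriv_def, rule_format, OF e1]
      g[unfolded approx_deriv_def, rule_format, OF e1] eventually_at_right_near[OF dK, of t]
  proof eventually_elim
    case (elim s)
    define h where "h = s - t"
    have h: "0 < h" "h < e / (2 * K)" using elim by (auto simp: h_def)
    define F where "F = f s - f t - h *\<^sub>R d"
    define G where "G = g s - g t - h *\<^sub>R d'"
    have F: "norm F \<le> (V + e1) * h" and G: "norm G \<le> (V' + e1) * h"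
      using elim by (auto simp: F_def G_def h_def)
    have dF: "norm (F + h *\<^sub>R d) \<le> (\<bar>V\<bar> + e1 + norm d) * h"
    proof -
      have "norm (F + h *\<^sub>R d) \<le> norm F + norm (h *\<^sub>R d)" by (rule norm_triangle_ineq)
      also have "\<dots> \<le> (\<bar>V\<bar> + e1) * h + h * norm d"
        using F h mult_right_mono[of "V + e1" "\<bar>V\<bar> + e1" h] by (auto intro: order_trans)
      finally show ?thesis by (simp add: algebra_simps)
    qed
    have dG: "norm (G + h *\<^sub>R d') \<le> (\<bar>V'\<bar> + e1 + norm d') * h"
    proof -
      have "norm (G + h *\<^sub>R d') \<le> norm G + norm (h *\<^sub>R d')" by (rule norm_triangle_ineq)
      also have "\<dots> \<le> (\<bar>V'\<bar> + e1) * h + h * norm d'"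
        using G h mult_right_mono[of "V' + e1" "\<bar>V'\<bar> + e1" h] by (auto intro: order_trans)
      finally show ?thesis by (simp add: algebra_simps)
    qed
    have fs: "f s = f t + (F + h *\<^sub>R d)" and gs: "g s = g t + (G + h *\<^sub>R d')"
      by (auto simp: F_def G_def)
    have "pr (f s) (g s) - pr (f t) (g t) - h *\<^sub>R (pr (f t) d' + pr d (g t)) =
       pr (f t) G + pr F (g t) + pr (F + h *\<^sub>R d) (G + h *\<^sub>R d')"
      unfolding fs gs
      by (simp add: add_left add_right scaleR_left scaleR_right scaleR_add_right algebra_simps)
    then have "norm (pr (f s) (g s) - pr (f t) (g t) - h *\<^sub>R (pr (f t) d' + pr d (g t))) \<le>
       norm (pr (f t) G) + norm (pr F (g t)) + norm (pr (F + h *\<^sub>R d) (G + h *\<^sub>R d'))"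
      by (metis norm_triangle_mono norm_triangle_ineq order_refl)
    also have "\<dots> \<le> norm (f t) * ((V' + e1) * h) + ((V + e1) * h) * norm (g t) +
       ((\<bar>V\<bar> + e1 + norm d) * h) * ((\<bar>V'\<bar> + e1 + norm d') * h)"
    proof (intro add_mono)
      show "norm (pr (f t) G) \<le> norm (f t) * ((V' + e1) * h)"
        by (rule order_trans[OF le]) (intro mult_left_mono G, simp)
      show "norm (pr F (g t)) \<le> ((V + e1) * h) * norm (g t)"
        by (rule order_trans[OF le]) (intro mult_right_mono F, simp)
      show "norm (pr (F + h *\<^sub>R d) (G + h *\<^sub>R d')) \<le>
        ((\<bar>V\<bar> + e1 + norm d) * h) * ((\<bar>V'\<bar> + e1 + norm d') * h)"
        by (rule order_trans[OF le]) (intro mult_mono dF dG mult_nonneg_nonneg, use e1 h in auto)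
    qed
    also have "\<dots> = (norm (f t) * V' + V * norm (g t) + (norm (f t) + norm (g t)) * e1 + (K - 1) * h) * h"
      by (simp add: K_def algebra_simps)
    also have "\<dots> \<le> (norm (f t) * V' + V * norm (g t) + e) * h"
    proof (intro mult_right_mono)
      have "(norm (f t) + norm (g t)) * e1 \<le> M * e1" using M e1 by (intro mult_right_mono) auto
      also have "\<dots> = e / 2" using M by (simp add: e1_def)
      finally have 1: "(norm (f t) + norm (g t)) * e1 \<le> e / 2" .
      have "(K - 1) * h \<le> K * h" using h by simp
      also have "\<dots> \<le> K * (e / (2 * K))" using h K by (intro mult_left_mono) auto
      also have "\<dots> = e / 2" using K by simp
      finally show "norm (f t) * V' + V * norm (g t) + (norm (f t) + norm (g t)) * e1 + (K - 1) * h
          \<le> norm (f t) * V' + V * norm (g t) + e" using 1 by simp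
    qed (use h in simp)
    finally show ?case by (simp add: h_def)
  qed
qed

lemma approx_deriv_inner:
  assumes "approx_deriv f d V t" "approx_deriv g d' V' t"
  shows "approx_deriv (\<lambda>s. inner (f s) (g s)) (inner (f t) d' + inner d (g t))
           (norm (f t) * V' + V * norm (g t)) t"
  by (rule approx_deriv_bilinear[OF bounded_bilinear_inner _ assms])
     (simp add: Cauchy_Schwarz_ineq2)

lemma approx_deriv_mult:
  fixes f g :: "real \<Rightarrow> real"
  assumes "approx_deriv f d V t" "approx_deriv g d' V' t"
  shows "approx_deriv (\<lambda>s. f s * g s) (f t * d' + d * g t) (\<bar>f t\<bar> * V' + V * \<bar>g t\<bar>) t"
  using approx_deriv_bilinear[OF bounded_bilinear_mult _ assms] by (simp add: abs_mult)

lemma approx_deriv_scaleR: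
  assumes "approx_deriv f d V t" "approx_deriv g d' V' t"
  shows "approx_deriv (\<lambda>s. f s *\<^sub>R g s) (f t *\<^sub>R d' + d *\<^sub>R g t) (\<bar>f t\<bar> * V' + V * norm (g t)) t"
  using approx_deriv_bilinear[OF bounded_bilinear_scaleR _ assms] by simp

lemma approx_deriv_const: "approx_deriv (\<lambda>s. c) 0 0 t"
  by (rule approx_deriv_vector) (auto intro!: derivative_eq_intros)

lemma approx_deriv_cmult:
  fixes f :: "real \<Rightarrow> real"
  assumes "approx_deriv f d V t"
  shows "approx_deriv (\<lambda>s. c * f s) (c * d) (\<bar>c\<bar> * V) t"
  using approx_deriv_mult[OF approx_deriv_const assms, of c] by simp

text \<open>The Lipschitz bound itself gives continuity of c from the right at t, so 1 / (c s * c t)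
  is close to 1 / (c t)^2.\<close>

lemma approx_deriv_inverse:
  assumes c: "approx_deriv c 0 V t" and lb: "\<And>s. s \<ge> t \<Longrightarrow> c s > 0" and V: "V \<ge> 0"
  shows "approx_deriv (\<lambda>s. 1 / c s) 0 (V / (c t)\<^sup>2) t"
  unfolding approx_deriv_def
proof (intro allI impI)
  fix e :: real assume e: "e > 0"
  define k where "k = c t"
  have k: "k > 0" using lb by (simp add: k_def)
  define q where "q = e * k\<^sup>2 / (2 * (V + e * k\<^sup>2 + 1))"
  have pos: "V + e * k\<^sup>2 + 1 > 0" using V e by (simp add: add_nonneg_pos)
  have q: "q > 0" using pos e k by (simp add: q_def)
  define e1 where "e1 = e * k\<^sup>2 / 4"
  have e1: "e1 > 0" using e k by (simp add: e1_def)
  have c': "(c \<longlongrightarrow> k) (at_right t)"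
  proof (rule tendstoI)
    fix d :: real assume d: "d > 0"
    then have "d / (V + 1) > 0" using V by simp
    from c[unfolded approx_deriv_def, rule_format, OF zero_less_one]
      eventually_at_right_near[OF this, of t]
    show "\<forall>\<^sub>F x in at_right t. dist (c x) k < d"
    proof eventually_elim
      case (elim s)
      then have "dist (c s) k \<le> (V + 1) * (s - t)" by (simp add: k_def dist_norm)
      also have "\<dots> < (V + 1) * (d / (V + 1))" using elim V by (intro mult_strict_left_mono) auto
      finally show ?case using V by simp
    qed
  qed
  have "((\<lambda>s. (V + e1) / (c s * k)) \<longlongrightarrow> (V + e1) / (k * k)) (at_right t)"
    using k by (intro tendsto_intros c') auto
  moreover have "(V + e1) / (k * k) < V / k\<^sup>2 + e"
    using k e by (simp add: e1_def field_simps power2_eq_square)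
  ultimately have "\<forall>\<^sub>F s in at_right t. (V + e1) / (c s * k) < V / k\<^sup>2 + e"
    by (rule order_tendstoD(2))
  with c[unfolded approx_deriv_def, rule_format, OF e1] eventually_at_right_near[OF zero_less_one, of t]
  show "\<forall>\<^sub>F s in at_right t. norm (1 / c s - 1 / c t - (s - t) *\<^sub>R 0) \<le> (V / (c t)\<^sup>2 + e) * (s - t)"
  proof eventually_elim
    case (elim s)
    have cs: "c s > 0" using lb elim by auto
    have "1 / c s - 1 / k = (k - c s) / (c s * k)" using cs k by (simp add: field_simps)
    then have "norm (1 / c s - 1 / k) = \<bar>c s - k\<bar> / (c s * k)"
      using cs k by (simp add: abs_minus_commute abs_mult)
    also have "\<dots> \<le> ((V + e1) * (s - t)) / (c s * k)"
      using elim cs k by (intro divide_right_mono) (auto simp: k_def)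
    also have "\<dots> = (V + e1) / (c s * k) * (s - t)" by simp
    also have "\<dots> \<le> (V / k\<^sup>2 + e) * (s - t)" using elim by (intro mult_right_mono) auto
    finally show ?case by (simp add: k_def)
  qed
qed

text \<open>Since m need not be differentiable, the derivative is declared to be 0 and the whole
  variation of the composition goes into the error.\<close>

lemma approx_deriv_lipschitz_comp:
  assumes m: "L-lipschitz_on S m" and f: "approx_deriv f d 0 t" and S: "\<And>s. s \<ge> t \<Longrightarrow> f s \<in> S"
  shows "approx_deriv (\<lambda>s. m (f s :: real) :: real) 0 (L * \<bar>d\<bar>) t"
  unfolding approx_deriv_def
proof (intro allI impI)
  fix e :: real assume e: "e > 0"
  have L: "L \<ge> 0" using m by (rule lipschitz_on_nonneg)
  have e1: "e / (L + 1) > 0" using e L by simp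
  show "\<forall>\<^sub>F s in at_right t. norm (m (f s) - m (f t) - (s - t) *\<^sub>R 0) \<le> (L * \<bar>d\<bar> + e) * (s - t)"
    using f[unfolded approx_deriv_def, rule_format, OF e1] eventually_at_right_near[OF zero_less_one, of t]
  proof eventually_elim
    case (elim s)
    have "norm (m (f s) - m (f t)) \<le> L * norm (f s - f t)"
      using lipschitz_onD[OF m, of "f s" "f t"] S[of s] S[of t] elim by (auto simp: dist_norm)
    also have "norm (f s - f t) \<le> (\<bar>d\<bar> + e / (L + 1)) * (s - t)"
    proof -
      have "norm (f s - f t) \<le> norm (f s - f t - (s - t) *\<^sub>R d) + norm ((s - t) *\<^sub>R d)"
        by (metis norm_triangle_ineq diff_add_cancel)
      also have "\<dots> \<le> e / (L + 1) * (s - t) + (s - t) * \<bar>d\<bar>"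
        using elim by (intro add_mono) (auto simp: abs_mult)
      finally show ?thesis by (simp add: algebra_simps)
    qed
    finally have "norm (m (f s) - m (f t)) \<le> L * ((\<bar>d\<bar> + e / (L + 1)) * (s - t))"
      using L by (simp add: mult_left_mono)
    also have "\<dots> = (L * \<bar>d\<bar> + L * (e / (L + 1))) * (s - t)" by (simp add: algebra_simps)
    also have "L * (e / (L + 1)) \<le> e" using L e by (simp add: field_simps)
    then have "(L * \<bar>d\<bar> + L * (e / (L + 1))) * (s - t) \<le> (L * \<bar>d\<bar> + e) * (s - t)"
      using elim by (intro mult_right_mono) auto
    finally show ?case by simp
  qed
qed

lemma approx_deriv_bounded_linear:
  assumes h: "bounded_linear h" and f: "approx_deriv f d 0 t"
  shows "approx_deriv (\<lambda>s. h (f s)) (h d) 0 t"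
  unfolding approx_deriv_def
proof (intro allI impI)
  interpret bounded_linear h by fact
  obtain K where K: "K > 0" "\<And>x. norm (h x) \<le> norm x * K" using pos_bounded by blast
  fix e :: real assume e: "e > 0"
  then have "e / K > 0" using K by simp
  from f[unfolded approx_deriv_def, rule_format, OF this]
  show "\<forall>\<^sub>F s in at_right t. norm (h (f s) - h (f t) - (s - t) *\<^sub>R h d) \<le> (0 + e) * (s - t)"
  proof eventually_elim
    case (elim s)
    have "norm (h (f s) - h (f t) - (s - t) *\<^sub>R h d) \<le> norm (f s - f t - (s - t) *\<^sub>R d) * K"
      using K(2)[of "f s - f t - (s - t) *\<^sub>R d"] by (simp add: diff scaleR)
    also have "\<dots> \<le> (0 + e / K) * (s - t) * K" using elim K by (intro mult_right_mono) auto
    finally show ?case using K by simp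
  qed
qed

lemma approx_deriv_cong:
  assumes "approx_deriv g d V t" "\<And>s. s \<ge> t \<Longrightarrow> f s = g s"
  shows "approx_deriv f d V t"
  unfolding approx_deriv_def
proof (intro allI impI)
  fix e :: real assume "e > 0"
  from assms(1)[unfolded approx_deriv_def, rule_format, OF this] eventually_at_right_near[OF zero_less_one, of t]
  show "\<forall>\<^sub>F s in at_right t. norm (f s - f t - (s - t) *\<^sub>R d) \<le> (V + e) * (s - t)"
    by eventually_elim (use assms(2) in auto)
qed

section \<open>Upper right Dini derivatives, comparison and continuation\<close>

lemma dini_le_approx:
  assumes "approx_deriv f d V t" "d + V \<le> D"
  shows "dini_le f D t"
  unfolding dini_le_def
proof (intro allI impI)
  fix e :: real assume e: "e > 0"
  show "\<forall>\<^sub>F s in at_right t. f s - f t \<le> (D + e) * (s - t)"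
    using assms(1)[unfolded approx_deriv_def, rule_format, OF e] eventually_at_right_near[OF zero_less_one, of t]
  proof eventually_elim
    case (elim s)
    then have "f s - f t \<le> (s - t) * d + (V + e) * (s - t)" by auto
    also have "\<dots> = (d + V + e) * (s - t)" by (simp add: algebra_simps)
    also have "\<dots> \<le> (D + e) * (s - t)" using elim assms(2) by (intro mult_right_mono) auto
    finally show ?case .
  qed
qed

lemma dini_le_add:
  assumes "dini_le f d t" "dini_le g d' t"
  shows "dini_le (\<lambda>s. f s + g s) (d + d') t"
  unfolding dini_le_def
proof (intro allI impI)
  fix e :: real assume "e > 0"
  then have e: "e / 2 > 0" by simp
  show "\<forall>\<^sub>F s in at_right t. f s + g s - (f t + g t) \<le> (d + d' + e) * (s - t)"
    using assms(1)[unfolded dini_le_def, rule_format, OF e]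
      assms(2)[unfolded dini_le_def, rule_format, OF e]
  proof eventually_elim
    case (elim s)
    then have "f s + g s - (f t + g t) \<le> (d + e / 2) * (s - t) + (d' + e / 2) * (s - t)" by simp
    also have "\<dots> = (d + d' + e) * (s - t)" by (simp add: field_simps)
    finally show ?case .
  qed
qed

lemma dini_le_mono: "dini_le f d t \<Longrightarrow> d \<le> d' \<Longrightarrow> dini_le f d' t"
  unfolding dini_le_def
proof (intro allI impI)
  fix e :: real assume *: "\<forall>e>0. \<forall>\<^sub>F s in at_right t. f s - f t \<le> (d + e) * (s - t)" "d \<le> d'" "e > 0"
  from *(1)[rule_format, OF *(3)] eventually_at_right_near[OF zero_less_one, of t]
  show "\<forall>\<^sub>F s in at_right t. f s - f t \<le> (d' + e) * (s - t)"
  proof eventually_elim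
    case (elim s)
    then have "(d + e) * (s - t) \<le> (d' + e) * (s - t)" using * by (intro mult_right_mono) auto
    then show ?case using elim by linarith
  qed
qed

lemma dini_le_deriv: "(f has_real_derivative d) (at_right t) \<Longrightarrow> dini_le f d t"
  by (rule dini_le_approx[OF approx_deriv_vector])
     (auto simp: has_real_derivative_iff_has_vector_derivative)

text \<open>Otherwise the last time at which f t - e t \<le> f 0 would be smaller than T, and the
  Dini bound at that time carries the inequality a little further.\<close>

lemma dini_le_nonincreasing:
  assumes cont: "continuous_on {0..} f" and T: "T \<ge> 0"
    and dini: "\<And>t. 0 \<le> t \<Longrightarrow> t < T \<Longrightarrow> dini_le f 0 t"
  shows "f T \<le> f 0"
proof -
  have "f T \<le> f 0 + e * T" if e: "e > 0" for e
  proof (rule ccontr)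
    assume neg: "\<not> f T \<le> f 0 + e * T"
    define S where "S = {t \<in> {0..T}. f t - e * t \<le> f 0}"
    have "continuous_on {0..T} (\<lambda>t. f t - e * t)"
      by (intro continuous_intros continuous_on_subset[OF cont]) auto
    then have "closed S"
      unfolding S_def by (intro continuous_on_closed_Collect_le continuous_on_const) auto
    moreover have S0: "0 \<in> S" using T by (simp add: S_def)
    moreover have bdd: "bdd_above S" by (auto simp: S_def intro!: bdd_aboveI[of _ T])
    ultimately have SS: "Sup S \<in> S" by (intro closed_contains_Sup) auto
    define s0 where "s0 = Sup S"
    have s0: "0 \<le> s0" "s0 \<le> T" "f s0 - e * s0 \<le> f 0" using SS by (auto simp: S_def s0_def)
    have "s0 \<noteq> T" using s0 neg by auto
    then have lt: "s0 < T" using s0 by simp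
    then have lt': "0 < T - s0" by simp
    have "\<forall>\<^sub>F s in at_right s0. False"
      using dini[OF s0(1) lt, unfolded dini_le_def, rule_format, OF e]
        eventually_at_right_near[OF lt', of s0]
    proof eventually_elim
      fix s assume *: "f s - f s0 \<le> (0 + e) * (s - s0)" "s0 < s \<and> s < s0 + (T - s0)"
      have "f s - e * s \<le> f 0" using * s0 by (simp add: algebra_simps)
      then have "s \<in> S" using * s0 by (auto simp: S_def)
      then have "s \<le> s0" unfolding s0_def using bdd by (rule cSup_upper)
      then show False using * by simp
    qed
    then show False by (simp add: trivial_limit_at_right_real)
  qed note * = this
  show ?thesis
  proof (rule field_le_epsilon)
    fix e :: real assume "e > 0"
    then have "f T \<le> f 0 + e / (T + 1) * T" using T by (intro *) auto
    also have "e / (T + 1) * T \<le> e" using T \<open>e > 0\<close> by (simp add: field_simps)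
    finally show "f T \<le> f 0 + e" by simp
  qed
qed

lemma dini_le_integrate:
  assumes cont: "continuous_on {0..} f" and T: "T \<ge> 0"
    and dini: "\<And>t. 0 \<le> t \<Longrightarrow> t < T \<Longrightarrow> dini_le f (g' t) t"
    and g: "\<And>t. 0 \<le> t \<Longrightarrow> (g has_real_derivative g' t) (at t within {0..})"
  shows "f T - f 0 \<le> g T - g 0"
proof -
  have "(\<lambda>t. f t + - g t) T \<le> (\<lambda>t. f t + - g t) 0"
  proof (rule dini_le_nonincreasing[OF _ T])
    have "continuous_on {0..} g"
      unfolding continuous_on_eq_continuous_within using g
      by (meson DERIV_continuous atLeast_iff)
    then show "continuous_on {0..} (\<lambda>t. f t + - g t)" by (intro continuous_intros cont)
    fix t assume t: "0 \<le> t" "t < T"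
    have "((\<lambda>t. - g t) has_real_derivative - g' t) (at_right t)"
      by (rule DERIV_subset[OF DERIV_minus[OF g[OF t(1)]]]) (use t in auto)
    from dini_le_add[OF dini[OF t] dini_le_deriv[OF this]]
    show "dini_le (\<lambda>t. f t + - g t) 0 t" by simp
  qed
  then show ?thesis by simp
qed

text \<open>A failure would have a first time, before which X \<le> Y holds, and \<open>step\<close>
  gives the strict inequality at that very time. For T = 0 the hypothesis of \<open>step\<close> is
  void, so \<open>step\<close> also contains the initial condition.\<close>

lemma continuation:
  assumes X: "continuous_on {0..} X" and Y: "continuous_on {0..} Y"
    and step: "\<And>T::real. T \<ge> 0 \<Longrightarrow> (\<And>t. 0 \<le> t \<Longrightarrow> t < T \<Longrightarrow> X t \<le> Y t) \<Longrightarrow> X T < (Y T :: real)"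
    and t: "t \<ge> 0"
  shows "X t < Y t"
proof (rule ccontr)
  assume neg: "\<not> X t < Y t"
  define S where "S = {s \<in> {0..t}. Y s \<le> X s}"
  have "closed S" unfolding S_def
    by (intro continuous_on_closed_Collect_le continuous_on_subset[OF X] continuous_on_subset[OF Y]) auto
  moreover have "t \<in> S" using neg t by (simp add: S_def)
  moreover have bdd: "bdd_below S" by (auto simp: S_def intro!: bdd_belowI[of _ 0])
  ultimately have S: "Inf S \<in> S" by (intro closed_contains_Inf) auto
  have "X (Inf S) < Y (Inf S)"
  proof (rule step)
    show "0 \<le> Inf S" using S by (simp add: S_def)
    fix s assume s: "0 \<le> s" "s < Inf S"
    show "X s \<le> Y s"
    proof (rule ccontr)
      assume "\<not> X s \<le> Y s"
      then have "s \<in> S" using s S by (auto simp: S_def)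
      then have "Inf S \<le> s" using bdd by (rule cInf_lower)
      then show False using s by simp
    qed
  qed
  then show False using S by (simp add: S_def)
qed

lemma has_vector_derivative_right:
  "(f has_vector_derivative d) (at t within {0..}) \<Longrightarrow> 0 \<le> t \<Longrightarrow> (f has_vector_derivative d) (at_right t)"
  by (erule has_vector_derivative_within_subset) auto

lemma has_real_derivative_right:
  "(f has_real_derivative d) (at t within {0..}) \<Longrightarrow> 0 \<le> t \<Longrightarrow> (f has_real_derivative d) (at_right t)"
  by (erule DERIV_subset) auto

lemma has_vector_derivative_slope:
  assumes "(f has_vector_derivative d) (at t within S)"
  shows "((\<lambda>s. (1 / (s - t)) *\<^sub>R (f s - f t)) \<longlongrightarrow> d) (at t within S)"
proof (rule LIM_zero_cancel, rule tendsto_norm_zero_cancel, rule Lim_transform_eventually)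
  show "((\<lambda>s. norm ((f s - f t) - (s - t) *\<^sub>R d) / norm (s - t)) \<longlongrightarrow> 0) (at t within S)"
    using assms by (simp add: has_vector_derivative_def has_derivative_iff_norm)
  show "\<forall>\<^sub>F s in at t within S. norm ((f s - f t) - (s - t) *\<^sub>R d) / norm (s - t) =
      norm ((1 / (s - t)) *\<^sub>R (f s - f t) - d)"
    unfolding eventually_at_filter
  proof (rule always_eventually, intro allI impI)
    fix s assume s: "s \<noteq> t"
    have "(1 / (s - t)) *\<^sub>R (f s - f t) - d = (1 / (s - t)) *\<^sub>R ((f s - f t) - (s - t) *\<^sub>R d)"
      using s by (simp add: scaleR_diff_right)
    then show "norm ((f s - f t) - (s - t) *\<^sub>R d) / norm (s - t) = norm ((1 / (s - t)) *\<^sub>R (f s - f t) - d)"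
      by simp
  qed
qed

lemma locally_lipschitz_imp_lipschitz:
  fixes m :: "real \<Rightarrow> real"
  assumes "\<And>s. 0 \<le> s \<Longrightarrow> \<exists>d>0. \<exists>L. L-lipschitz_on (cball s d \<inter> {0..}) m"
  shows "\<exists>L. L-lipschitz_on {0..R} m"
proof -
  have "local_lipschitz {0::real} {0..R} (\<lambda>_. m)"
    unfolding local_lipschitz_def
  proof (intro ballI)
    fix x t :: real assume "x \<in> {0..R}" "t \<in> {0}"
    then obtain d L where "d > 0" "L-lipschitz_on (cball x d \<inter> {0..}) m" using assms[of x] by auto
    moreover have "cball x d \<inter> {0..R} \<subseteq> cball x d \<inter> {0..}" by auto
    ultimately show "\<exists>u>0. \<exists>L. \<forall>t\<in>cball t u \<inter> {0}. L-lipschitz_on (cball x u \<inter> {0..R}) m"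
      using lipschitz_on_subset by blast
  qed
  then obtain L where "\<And>t::real. t \<in> {0} \<Longrightarrow> L-lipschitz_on {0..R} m"
    by (rule local_lipschitz_compact_implies_lipschitz) auto
  then show ?thesis by blast
qed

lemma power_le_exp:
  assumes "c > 0"
  shows "\<exists>C>0. \<forall>t\<ge>0. (1 + t) ^ k \<le> C * exp (c * t :: real)"
proof -
  \<comment> \<open>Dividing by k + 1 instead of k keeps the quotient defined for k = 0 and still
    gives k d \<le> c.\<close>
  define d where "d = c / (real k + 1)"
  have d: "d > 0" using assms by (simp add: d_def)
  define K where "K = 1 + 1 / d"
  have K: "K \<ge> 1" using d by (simp add: K_def)
  have le: "1 + t \<le> K * exp (d * t)" if "t \<ge> 0" for t
  proof -
    have "1 + t = 1 + (1 / d) * (d * t)" using d by simp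
    also have "\<dots> \<le> exp (d * t) + (1 / d) * exp (d * t)"
      using exp_ge_add_one_self[of "d * t"] d that
      by (intro add_mono mult_left_mono) (auto simp: add_increasing intro: order_trans[OF _ exp_ge_add_one_self])
    finally show ?thesis by (simp add: K_def algebra_simps)
  qed
  have "(1 + t) ^ k \<le> K ^ k * exp (c * t)" if "t \<ge> 0" for t
  proof -
    have "(1 + t) ^ k \<le> (K * exp (d * t)) ^ k" using le[OF that] that by (intro power_mono) auto
    also have "\<dots> = K ^ k * exp (real k * (d * t))" by (simp add: power_mult_distrib exp_of_nat_mult)
    also have "real k * (d * t) \<le> c * t"
      using that assms by (auto simp: d_def divide_simps algebra_simps)
    finally show ?thesis using K by simp
  qed
  moreover have "K ^ k > 0" using K by simp
  ultimately show ?thesis by blast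
qed

section \<open>The energy inequality\<close>

lemma two_mult_le_weighted:
  fixes x y k :: real
  assumes "k > 0"
  shows "2 * x * y \<le> k * x\<^sup>2 + y\<^sup>2 / k"
proof -
  have "0 \<le> (k * x - y)\<^sup>2 / k" using assms by simp
  also have "\<dots> = k * x\<^sup>2 + y\<^sup>2 / k - 2 * x * y"
    using assms by (simp add: power2_eq_square field_simps)
  finally show ?thesis by simp
qed

text \<open>One number for the four smallness conditions of \<open>energy_smallness_parts\<close>:
  absorption of mixed terms into |S y|^2, absorption into |v|^2, coercivity of the energy, and decay
  of the corrector against the weight.\<close>

definition energy_smallness :: "real \<Rightarrow> real \<Rightarrow> real \<Rightarrow> real \<Rightarrow> real \<Rightarrow> real" where
  "energy_smallness \<kappa> \<mu> \<nu> \<Lambda> \<beta> =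
     \<kappa> * (1 + \<beta>) / \<nu> + 4 * \<Lambda> * (4 * \<kappa> + \<beta> * \<kappa> + \<beta> / \<mu>) + 2 * (\<beta> + 2)"

text \<open>The sum of the four Young constants \<open>c1\<close>, \<open>c2\<close>,
  \<open>c3\<close>, \<open>c4\<close> in the proof of \<open>energy_algebra\<close>.\<close>

definition forcing_const :: "real \<Rightarrow> real \<Rightarrow> real \<Rightarrow> real \<Rightarrow> real" where
  "forcing_const \<kappa> \<mu> \<nu> \<Lambda> = 2 / \<mu> + 4 * \<kappa>\<^sup>2 / \<nu> + (1 + \<kappa> / \<nu>)\<^sup>2 + 4 * \<Lambda> * \<kappa>\<^sup>2 / \<nu>"

lemma energy_smallness_parts:
  assumes pos: "\<mu> > 0" "\<nu> > 0" "\<Lambda> > 0" "\<kappa> > 0" "\<beta> \<ge> 0" "\<epsilon> > 0"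
    and small: "\<epsilon> * energy_smallness \<kappa> \<mu> \<nu> \<Lambda> \<beta> \<le> 1"
  shows "\<epsilon> * (\<kappa> * (1 + \<beta>) / \<nu>) \<le> 1"
    and "\<epsilon> * (4 * \<Lambda> * (3 * \<kappa> + \<beta> * \<kappa> + \<beta> / \<mu>)) \<le> 1"
    and "\<epsilon> * (4 * \<Lambda> * \<kappa>) \<le> 1"
    and "\<epsilon> * (2 * (\<beta> + 2)) \<le> 1"
proof -
  have nonneg: "0 \<le> \<kappa> * (1 + \<beta>) / \<nu>" "0 \<le> \<Lambda> * \<kappa>" "0 \<le> \<Lambda> * (\<beta> * \<kappa>)" "0 \<le> \<Lambda> * (\<beta> / \<mu>)"
    using pos by auto
  have *: "\<epsilon> * x \<le> 1" if "x \<le> energy_smallness \<kappa> \<mu> \<nu> \<Lambda> \<beta>" for x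
    using that small pos by (meson less_imp_le mult_left_mono order_trans)
  show "\<epsilon> * (\<kappa> * (1 + \<beta>) / \<nu>) \<le> 1" "\<epsilon> * (4 * \<Lambda> * (3 * \<kappa> + \<beta> * \<kappa> + \<beta> / \<mu>)) \<le> 1"
    "\<epsilon> * (4 * \<Lambda> * \<kappa>) \<le> 1" "\<epsilon> * (2 * (\<beta> + 2)) \<le> 1"
    by (rule *, use nonneg pos in \<open>simp add: energy_smallness_def distrib_left\<close>)+
qed

text \<open>The scalar core of \<open>energy_dini\<close>. The variables y, v, s, z, f, \<zeta> are
  the norms of y, v, S y, z, the force and S z; V and \<gamma> are the Lipschitz errors of v and c,
  and \<eta> is the corrector rate. The products y z and s \<zeta> are charged to
  \<open>\<eta> * s\<^sup>2\<close> and not to the dissipation, because the corrector is not small: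
  only its integral is.\<close>

lemma energy_algebra:
  fixes b c y v s z f V \<zeta> \<eta> a \<kappa> \<mu> \<nu> \<Lambda> \<epsilon> \<gamma> \<beta> \<omega> :: real
  assumes b: "0 < b" "b \<le> 1" and c: "0 < \<mu>" "\<mu> \<le> c" "c \<le> \<Lambda>"
    and pos: "\<nu> > 0" "\<kappa> > 0" "\<beta> \<ge> 0" "\<omega> > 0" "\<epsilon> > 0" "\<eta> > 0"
    and \<kappa>: "\<kappa> * \<omega> = (\<beta> + 2) * \<nu>"
    and a: "0 \<le> a" "a \<le> \<beta> * b" "a * b \<le> 2 * \<mu> * \<nu> - \<omega>"
    and small: "\<epsilon> * energy_smallness \<kappa> \<mu> \<nu> \<Lambda> \<beta> \<le> 1"
    and \<gamma>: "\<epsilon> * \<gamma> \<le> b * c / 4"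
    and nonneg: "0 \<le> y" "0 \<le> v" "0 \<le> s" "0 \<le> z" "0 \<le> f" "0 \<le> V" "0 \<le> \<zeta>"
    and ys: "\<nu> * y\<^sup>2 \<le> s\<^sup>2" and z\<zeta>: "\<nu> * z\<^sup>2 \<le> \<zeta>\<^sup>2"
  shows "\<kappa> * b * (2 * b * (y * z) + 2 * \<epsilon> * v\<^sup>2 + 2 * \<epsilon> * (z * v) - 2 * c * s\<^sup>2 + 2 * (y * f) + 2 * \<epsilon> * (y * V))
      + 2 * \<kappa> * \<epsilon> * b\<^sup>2 * (y * v) - 2 * b / c * v\<^sup>2 + 2 / c * (v * f) + 2 * \<epsilon> / c * (v * V)
      + \<epsilon> * \<gamma> * v\<^sup>2 / c\<^sup>2 + 2 * (s * \<zeta>)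
      + a * (\<kappa> * b\<^sup>2 * y\<^sup>2 + 2 * \<kappa> * \<epsilon> * b * (y * v) + \<epsilon> * v\<^sup>2 / c + s\<^sup>2)
    \<le> \<eta> * s\<^sup>2 + forcing_const \<kappa> \<mu> \<nu> \<Lambda> * (f\<^sup>2 / b + \<epsilon>\<^sup>2 * V\<^sup>2 / b + \<zeta>\<^sup>2 / \<eta> + \<epsilon>\<^sup>2 * \<zeta>\<^sup>2)"
proof -
  have \<Lambda>: "\<Lambda> > 0" and c0: "c > 0" using c by auto
  note small' = energy_smallness_parts[OF c(1) pos(1) \<Lambda> pos(2,3,5) small]
  have y2: "y\<^sup>2 \<le> s\<^sup>2 / \<nu>" and z2: "z\<^sup>2 \<le> \<zeta>\<^sup>2 / \<nu>"
    using ys z\<zeta> pos by (auto simp: field_simps)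
  have bb: "b\<^sup>2 \<le> b" using b by (simp add: power2_eq_square mult_left_le)
  have binv: "b \<le> 1 / b" using b mult_le_one[of b b] by (simp add: field_simps)
  have yv: "2 * (y * v) \<le> y\<^sup>2 + v\<^sup>2" using two_mult_le_weighted[of 1 y v] by simp
  have yvb: "2 * (b * (y * v)) \<le> s\<^sup>2 / \<nu> + v\<^sup>2"
  proof -
    have "2 * (b * (y * v)) \<le> 2 * (y * v)" using b nonneg by (simp add: mult_left_le_one_le)
    then show ?thesis using yv y2 by linarith
  qed
  \<comment> \<open>Coercivity bounds a b y^2 by (2 \<mu> - \<omega> / \<nu>) s^2, just below the
    dissipation 2 \<mu> s^2; the difference, multiplied by \<kappa>, is the gain.\<close>
  have T1: "a * (\<kappa> * b\<^sup>2 * y\<^sup>2) \<le> \<kappa> * b * ((2 * \<mu> - \<omega> / \<nu>) * s\<^sup>2)"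
  proof -
    have "a * (\<kappa> * b\<^sup>2 * y\<^sup>2) = \<kappa> * b * ((a * b) * y\<^sup>2)" by (simp add: power2_eq_square)
    also have "(a * b) * y\<^sup>2 \<le> (2 * \<mu> * \<nu> - \<omega>) * (s\<^sup>2 / \<nu>)"
    proof (intro mult_mono y2)
      have "0 \<le> a * b" using a b by simp
      then show "0 \<le> 2 * \<mu> * \<nu> - \<omega>" using a(3) by linarith
    qed (use a in auto)
    also have "\<dots> = (2 * \<mu> - \<omega> / \<nu>) * s\<^sup>2" using pos by (simp add: field_simps)
    finally show ?thesis using pos b by (simp add: mult_left_mono)
  qed
  have T2: "a * s\<^sup>2 \<le> \<beta> * b * s\<^sup>2" using a by (intro mult_right_mono) auto
  have T3: "a * (\<epsilon> * v\<^sup>2 / c) \<le> b * (\<epsilon> * (\<beta> / \<mu>)) * v\<^sup>2"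
  proof -
    have "a * (\<epsilon> * v\<^sup>2 / c) \<le> (\<beta> * b) * (\<epsilon> * v\<^sup>2 / \<mu>)"
      using a c pos b by (intro mult_mono divide_left_mono) auto
    then show ?thesis by (simp add: algebra_simps)
  qed
  have T4: "a * (2 * \<kappa> * \<epsilon> * b * (y * v)) \<le> b * (\<epsilon> * (\<kappa> * \<beta> / \<nu>)) * s\<^sup>2 + b * (\<epsilon> * (\<beta> * \<kappa>)) * v\<^sup>2"
  proof -
    have "a * (2 * \<kappa> * \<epsilon> * b * (y * v)) = a * (\<kappa> * \<epsilon> * (2 * (b * (y * v))))" by (simp add: algebra_simps)
    also have "\<dots> \<le> (\<beta> * b) * (\<kappa> * \<epsilon> * (s\<^sup>2 / \<nu> + v\<^sup>2))"
      using yvb a pos b nonneg by (intro mult_mono mult_nonneg_nonneg) auto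
    finally show ?thesis by (simp add: algebra_simps)
  qed
  have T5: "2 * \<kappa> * \<epsilon> * b\<^sup>2 * (y * v) \<le> b * (\<epsilon> * (\<kappa> / \<nu>)) * s\<^sup>2 + b * (\<epsilon> * \<kappa>) * v\<^sup>2"
  proof -
    have "2 * \<kappa> * \<epsilon> * b\<^sup>2 * (y * v) = \<kappa> * \<epsilon> * b * (2 * (b * (y * v)))"
      by (simp add: algebra_simps power2_eq_square)
    also have "\<dots> \<le> \<kappa> * \<epsilon> * b * (s\<^sup>2 / \<nu> + v\<^sup>2)"
      using yvb pos b by (intro mult_left_mono mult_nonneg_nonneg) auto
    finally show ?thesis by (simp add: algebra_simps)
  qed
  have T6: "- (2 * \<kappa> * b * c * s\<^sup>2) \<le> - (2 * \<kappa> * b * \<mu> * s\<^sup>2)"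
    using c pos b by (auto intro!: mult_mono)
  have yz: "y * z \<le> s * \<zeta> / \<nu>"
  proof -
    have "(\<nu> * (y * z))\<^sup>2 = (\<nu> * y\<^sup>2) * (\<nu> * z\<^sup>2)" by (simp add: power2_eq_square algebra_simps)
    also have "\<dots> \<le> s\<^sup>2 * \<zeta>\<^sup>2" using ys z\<zeta> pos by (intro mult_mono) auto
    also have "\<dots> = (s * \<zeta>)\<^sup>2" by (simp add: power_mult_distrib)
    finally have "\<nu> * (y * z) \<le> s * \<zeta>" by (rule power2_le_imp_le) (use nonneg in simp)
    then show ?thesis using pos by (simp add: field_simps)
  qed
  have T7: "\<kappa> * b * (2 * b * (y * z)) + 2 * (s * \<zeta>) \<le> \<eta> * s\<^sup>2 + (1 + \<kappa> / \<nu>)\<^sup>2 * (\<zeta>\<^sup>2 / \<eta>)"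
  proof -
    have "\<kappa> * b * (2 * b * (y * z)) = 2 * \<kappa> * (b\<^sup>2 * (y * z))" by (simp add: power2_eq_square)
    also have "\<dots> \<le> 2 * \<kappa> * (s * \<zeta> / \<nu>)"
    proof (intro mult_left_mono)
      have "b\<^sup>2 * (y * z) \<le> 1 * (y * z)" using bb b nonneg by (intro mult_right_mono) auto
      then show "b\<^sup>2 * (y * z) \<le> s * \<zeta> / \<nu>" using yz by simp
    qed (use pos in auto)
    finally have "\<kappa> * b * (2 * b * (y * z)) + 2 * (s * \<zeta>) \<le> 2 * s * ((1 + \<kappa> / \<nu>) * \<zeta>)"
      using pos by (simp add: field_simps)
    also have "\<dots> \<le> \<eta> * s\<^sup>2 + ((1 + \<kappa> / \<nu>) * \<zeta>)\<^sup>2 / \<eta>"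
      using pos by (intro two_mult_le_weighted) auto
    finally show ?thesis by (simp add: power_mult_distrib)
  qed
  have T8: "\<kappa> * b * (2 * \<epsilon> * (z * v)) \<le> b * (1 / (4 * c)) * v\<^sup>2 + 4 * \<Lambda> * \<kappa>\<^sup>2 / \<nu> * (\<epsilon>\<^sup>2 * \<zeta>\<^sup>2)"
  proof -
    have "2 * v * (\<kappa> * \<epsilon> * z) \<le> 1 / (4 * c) * v\<^sup>2 + (\<kappa> * \<epsilon> * z)\<^sup>2 / (1 / (4 * c))"
      using c0 by (intro two_mult_le_weighted) auto
    then have "b * (2 * v * (\<kappa> * \<epsilon> * z)) \<le> b * (1 / (4 * c) * v\<^sup>2 + 4 * c * (\<kappa> * \<epsilon> * z)\<^sup>2)"
      using b by (intro mult_left_mono) (auto simp: algebra_simps)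
    also have "\<dots> = b * (1 / (4 * c)) * v\<^sup>2 + b * (4 * c * (\<kappa>\<^sup>2 * \<epsilon>\<^sup>2 * z\<^sup>2))"
      by (simp add: algebra_simps power_mult_distrib)
    also have "b * (4 * c * (\<kappa>\<^sup>2 * \<epsilon>\<^sup>2 * z\<^sup>2)) \<le> 1 * (4 * \<Lambda> * (\<kappa>\<^sup>2 * \<epsilon>\<^sup>2 * (\<zeta>\<^sup>2 / \<nu>)))"
      using b c0 c z2 by (intro mult_mono) (auto intro!: mult_nonneg_nonneg)
    finally show ?thesis by (simp add: algebra_simps)
  qed
  have yx: "\<kappa> * b * (2 * (y * x)) \<le> b * (s\<^sup>2 / 4) + 4 * \<kappa>\<^sup>2 / \<nu> * (x\<^sup>2 / b)" for x
  proof -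
    have "2 * y * (\<kappa> * x) \<le> \<nu> / 4 * y\<^sup>2 + (\<kappa> * x)\<^sup>2 / (\<nu> / 4)"
      using pos by (intro two_mult_le_weighted) auto
    also have "\<dots> \<le> s\<^sup>2 / 4 + 4 * \<kappa>\<^sup>2 / \<nu> * x\<^sup>2" using ys by (simp add: power_mult_distrib)
    finally have "b * (2 * y * (\<kappa> * x)) \<le> b * (s\<^sup>2 / 4 + 4 * \<kappa>\<^sup>2 / \<nu> * x\<^sup>2)"
      using b by (intro mult_left_mono) auto
    also have "\<dots> = b * (s\<^sup>2 / 4) + b * (4 * \<kappa>\<^sup>2 / \<nu> * x\<^sup>2)" by (simp add: algebra_simps)
    also have "b * (4 * \<kappa>\<^sup>2 / \<nu> * x\<^sup>2) \<le> (1 / b) * (4 * \<kappa>\<^sup>2 / \<nu> * x\<^sup>2)"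
      using binv pos by (intro mult_right_mono) auto
    finally show ?thesis by (simp add: algebra_simps)
  qed
  have vx: "2 / c * (v * x) \<le> b * (1 / (2 * c)) * v\<^sup>2 + 2 / \<mu> * (x\<^sup>2 / b)" for x
  proof -
    have "2 * v * x \<le> b / 2 * v\<^sup>2 + x\<^sup>2 / (b / 2)" using b by (intro two_mult_le_weighted) auto
    then have "1 / c * (2 * v * x) \<le> 1 / c * (b / 2 * v\<^sup>2 + 2 * (x\<^sup>2 / b))"
      using c0 by (intro mult_left_mono) (auto simp: algebra_simps)
    also have "\<dots> = b * (1 / (2 * c)) * v\<^sup>2 + 2 / c * (x\<^sup>2 / b)" by (simp add: algebra_simps)
    also have "2 / c * (x\<^sup>2 / b) \<le> 2 / \<mu> * (x\<^sup>2 / b)"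
      using c b by (intro mult_right_mono divide_left_mono) auto
    finally show ?thesis by (simp add: algebra_simps)
  qed
  note T9 = yx[of f] and T10 = yx[of "\<epsilon> * V"] and T11 = vx[of f] and T12 = vx[of "\<epsilon> * V"]
  have T13: "\<epsilon> * \<gamma> * v\<^sup>2 / c\<^sup>2 \<le> b * (1 / (4 * c)) * v\<^sup>2"
  proof -
    have "\<epsilon> * \<gamma> * (v\<^sup>2 / c\<^sup>2) \<le> b * c / 4 * (v\<^sup>2 / c\<^sup>2)" using \<gamma> by (intro mult_right_mono) auto
    also have "\<dots> = b * (1 / (4 * c)) * v\<^sup>2" using c0 by (simp add: field_simps power2_eq_square)
    finally show ?thesis by simp
  qed
  \<comment> \<open>Budget for b s^2: of the gain \<kappa> \<omega> / \<nu> = \<beta> + 2, the part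
    \<beta> pays for a s^2, the part 1 for the terms with \<epsilon>, and 1/2 for the forces f and
    V.\<close>
  have S: "b * (\<kappa> * (2 * \<mu> - \<omega> / \<nu>) + \<beta> + \<epsilon> * (\<kappa> * \<beta> / \<nu>) + \<epsilon> * (\<kappa> / \<nu>) - 2 * \<kappa> * \<mu> + 1 / 2) * s\<^sup>2 \<le> 0"
  proof -
    have "\<kappa> * (\<omega> / \<nu>) = \<beta> + 2" using \<kappa> pos by (simp add: field_simps)
    moreover have "\<epsilon> * (\<kappa> * \<beta> / \<nu>) + \<epsilon> * (\<kappa> / \<nu>) \<le> 1" using small'(1) by (simp add: field_simps add_divide_distrib)
    ultimately have "\<kappa> * (2 * \<mu> - \<omega> / \<nu>) + \<beta> + \<epsilon> * (\<kappa> * \<beta> / \<nu>) + \<epsilon> * (\<kappa> / \<nu>) - 2 * \<kappa> * \<mu> + 1 / 2 \<le> 0"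
      unfolding right_diff_distrib by linarith
    then show ?thesis using b by (intro mult_nonpos_nonneg mult_nonneg_nonpos) auto
  qed
  \<comment> \<open>Budget for b v^2 / c: of the available 2, the parts 1/4, 1/2, 1/2, 1/4 go to z,
    f, V and \<gamma>, and at most 1/4 to the remaining terms with \<epsilon>.\<close>
  have Vv: "b * (\<epsilon> * (\<beta> / \<mu>) + \<epsilon> * (\<beta> * \<kappa>) + \<epsilon> * \<kappa> + 2 * (\<epsilon> * \<kappa>) + 1 / (4 * c) + 1 / (2 * c) + 1 / (2 * c) + 1 / (4 * c) - 2 / c) * v\<^sup>2 \<le> 0"
  proof -
    define X where "X = \<epsilon> * (3 * \<kappa> + \<beta> * \<kappa> + \<beta> / \<mu>)"
    have "4 * \<Lambda> * X \<le> 1" using small'(2) by (simp add: X_def algebra_simps)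
    moreover have "0 \<le> X" using pos c by (auto simp: X_def)
    then have "4 * c * X \<le> 4 * \<Lambda> * X" using c by (intro mult_right_mono) auto
    ultimately have "X \<le> 1 / (4 * c)" using c0 by (simp add: field_simps)
    also have "\<dots> \<le> 2 / c - 1 / (4 * c) - 1 / (2 * c) - 1 / (2 * c) - 1 / (4 * c)"
      using c0 by (simp add: field_simps)
    finally have "\<epsilon> * (\<beta> / \<mu>) + \<epsilon> * (\<beta> * \<kappa>) + \<epsilon> * \<kappa> + 2 * (\<epsilon> * \<kappa>) + 1 / (4 * c) + 1 / (2 * c) + 1 / (2 * c) + 1 / (4 * c) - 2 / c \<le> 0"
      by (simp add: X_def algebra_simps)
    then show ?thesis using b by (intro mult_nonpos_nonneg mult_nonneg_nonpos) auto
  qed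
  let ?F = "forcing_const \<kappa> \<mu> \<nu> \<Lambda>"
  define c1 c2 c3 c4 where "c1 = 2 / \<mu>" and "c2 = 4 * \<kappa>\<^sup>2 / \<nu>" and "c3 = (1 + \<kappa> / \<nu>)\<^sup>2"
    and "c4 = 4 * \<Lambda> * \<kappa>\<^sup>2 / \<nu>"
  have cs: "0 \<le> c1" "0 \<le> c2" "0 \<le> c3" "0 \<le> c4" using pos c \<Lambda> by (auto simp: c1_def c2_def c3_def c4_def)
  have F: "?F = c1 + c2 + c3 + c4" by (simp add: forcing_const_def c1_def c2_def c3_def c4_def)
  have force: "c1 * X1 + c2 * X1 + c1 * X2 + c2 * X2 + c3 * X3 + c4 * X4 \<le> ?F * (X1 + X2 + X3 + X4)"
    if "0 \<le> X1" "0 \<le> X2" "0 \<le> X3" "0 \<le> X4" for X1 X2 X3 X4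
  proof -
    have "(c1 + c2) * X1 \<le> ?F * X1" "(c1 + c2) * X2 \<le> ?F * X2" "c3 * X3 \<le> ?F * X3" "c4 * X4 \<le> ?F * X4"
      using that cs by (auto simp: F intro!: mult_right_mono)
    then show ?thesis by (simp add: algebra_simps)
  qed
  have X: "0 \<le> f\<^sup>2 / b" "0 \<le> \<epsilon>\<^sup>2 * V\<^sup>2 / b" "0 \<le> \<zeta>\<^sup>2 / \<eta>" "0 \<le> \<epsilon>\<^sup>2 * \<zeta>\<^sup>2" using b pos by auto
  note force' = force[OF X]
  have "\<kappa> * b * (2 * b * (y * z) + 2 * \<epsilon> * v\<^sup>2 + 2 * \<epsilon> * (z * v) - 2 * c * s\<^sup>2 + 2 * (y * f) + 2 * \<epsilon> * (y * V))
      = \<kappa> * b * (2 * b * (y * z)) + b * (2 * (\<epsilon> * \<kappa>)) * v\<^sup>2 + \<kappa> * b * (2 * \<epsilon> * (z * v)) - 2 * \<kappa> * b * c * s\<^sup>2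
        + \<kappa> * b * (2 * (y * f)) + \<kappa> * b * (2 * (y * (\<epsilon> * V)))"
    by (simp add: algebra_simps)
  moreover have "2 * \<epsilon> / c * (v * V) = 2 / c * (v * (\<epsilon> * V))" by simp
  moreover have "a * (\<kappa> * b\<^sup>2 * y\<^sup>2 + 2 * \<kappa> * \<epsilon> * b * (y * v) + \<epsilon> * v\<^sup>2 / c + s\<^sup>2) =
     a * (\<kappa> * b\<^sup>2 * y\<^sup>2) + a * (2 * \<kappa> * \<epsilon> * b * (y * v)) + a * (\<epsilon> * v\<^sup>2 / c) + a * s\<^sup>2"
    by (simp add: distrib_left)
  moreover have "b * (\<kappa> * (2 * \<mu> - \<omega> / \<nu>) + \<beta> + \<epsilon> * (\<kappa> * \<beta> / \<nu>) + \<epsilon> * (\<kappa> / \<nu>) - 2 * \<kappa> * \<mu> + 1 / 2) * s\<^sup>2 =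
      \<kappa> * b * ((2 * \<mu> - \<omega> / \<nu>) * s\<^sup>2) + \<beta> * b * s\<^sup>2 + b * (\<epsilon> * (\<kappa> * \<beta> / \<nu>)) * s\<^sup>2 + b * (\<epsilon> * (\<kappa> / \<nu>)) * s\<^sup>2
      - 2 * \<kappa> * b * \<mu> * s\<^sup>2 + b * (s\<^sup>2 / 4) + b * (s\<^sup>2 / 4)"
    by (simp add: algebra_simps)
  moreover have "b * (\<epsilon> * (\<beta> / \<mu>) + \<epsilon> * (\<beta> * \<kappa>) + \<epsilon> * \<kappa> + 2 * (\<epsilon> * \<kappa>) + 1 / (4 * c) + 1 / (2 * c) + 1 / (2 * c) + 1 / (4 * c) - 2 / c) * v\<^sup>2
     = b * (\<epsilon> * (\<beta> / \<mu>)) * v\<^sup>2 + b * (\<epsilon> * (\<beta> * \<kappa>)) * v\<^sup>2 + b * (\<epsilon> * \<kappa>) * v\<^sup>2 + b * (2 * (\<epsilon> * \<kappa>)) * v\<^sup>2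
       + b * (1 / (4 * c)) * v\<^sup>2 + b * (1 / (2 * c)) * v\<^sup>2 + b * (1 / (2 * c)) * v\<^sup>2 + b * (1 / (4 * c)) * v\<^sup>2 - 2 * b / c * v\<^sup>2"
    by (simp add: algebra_simps)
  moreover have "c1 * (f\<^sup>2 / b) = 2 / \<mu> * (f\<^sup>2 / b)" "c2 * (f\<^sup>2 / b) = 4 * \<kappa>\<^sup>2 / \<nu> * (f\<^sup>2 / b)"
    "c1 * (\<epsilon>\<^sup>2 * V\<^sup>2 / b) = 2 / \<mu> * ((\<epsilon> * V)\<^sup>2 / b)" "c2 * (\<epsilon>\<^sup>2 * V\<^sup>2 / b) = 4 * \<kappa>\<^sup>2 / \<nu> * ((\<epsilon> * V)\<^sup>2 / b)"
    "c3 * (\<zeta>\<^sup>2 / \<eta>) = (1 + \<kappa> / \<nu>)\<^sup>2 * (\<zeta>\<^sup>2 / \<eta>)" "c4 * (\<epsilon>\<^sup>2 * \<zeta>\<^sup>2) = 4 * \<Lambda> * \<kappa>\<^sup>2 / \<nu> * (\<epsilon>\<^sup>2 * \<zeta>\<^sup>2)"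
    by (auto simp: c1_def c2_def c3_def c4_def power_mult_distrib)
  ultimately show ?thesis
    using T1 T2 T3 T4 T5 T6 T7 T8 T9 T10 T11 T12 T13 S Vv force' by linarith
qed

section \<open>The damping coefficient and its primitive\<close>

definition damping :: "real \<Rightarrow> real \<Rightarrow> real" where
  "damping p t = 1 / (1 + t) powr p"

definition damping_int :: "real \<Rightarrow> real \<Rightarrow> real" where
  "damping_int p t = (if p = 1 then ln (1 + t) else ((1 + t) powr (1 - p) - 1) / (1 - p))"

lemma damping_powr: "damping p t = (1 + t) powr (- p)"
  by (simp add: damping_def powr_minus_divide)

lemma has_real_derivative_shifted_powr:
  assumes "t \<ge> 0"
  shows "((\<lambda>t. (1 + t) powr r) has_real_derivative r * (1 + t) powr (r - 1)) (at t within S)"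
proof -
  have "((\<lambda>t. (1 + t) powr r) has_real_derivative (r * (1 + t) powr (r - 1)) * (0 + 1)) (at t within S)"
    by (rule DERIV_chain2[OF has_real_derivative_powr]) (use assms in \<open>auto intro!: derivative_eq_intros\<close>)
  then show ?thesis by simp
qed

lemma damping_deriv:
  assumes "t \<ge> 0"
  shows "(damping p has_real_derivative - (p / (1 + t)) * damping p t) (at t within S)"
proof -
  have "(1 + t) powr (- p - 1) = (1 + t) powr (- p) / (1 + t)"
    using assms by (simp add: powr_diff)
  then show ?thesis
    using has_real_derivative_shifted_powr[OF assms, of "- p" S] by (simp add: damping_powr[abs_def])
qed

lemma damping_int_0 [simp]: "damping_int p 0 = 0"
  by (simp add: damping_int_def)

lemma damping_int_deriv:
  assumes "t \<ge> 0"
  shows "(damping_int p has_real_derivative damping p t) (at t within S)"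
proof (cases "p = 1")
  case True
  have "((\<lambda>t. ln (1 + t)) has_real_derivative damping p t) (at t within S)"
    using assms True by (auto intro!: derivative_eq_intros simp: damping_def)
  then show ?thesis using True by (simp add: damping_int_def[abs_def])
next
  case False
  have "((\<lambda>t. ((1 + t) powr (1 - p) - 1) / (1 - p)) has_real_derivative damping p t) (at t within S)"
    using assms False
    by (auto intro!: derivative_eq_intros has_real_derivative_shifted_powr simp: damping_powr)
  then show ?thesis using False by (simp add: damping_int_def[abs_def])
qed

lemma damping_int_cont: "continuous_on {0..} (damping_int p)"
  unfolding continuous_on_eq_continuous_within
  using damping_int_deriv by (meson DERIV_continuous atLeast_iff)

lemma damping_bounds:
  assumes "0 \<le> p" "p \<le> 1" "0 \<le> t"
  shows "0 < damping p t" "damping p t \<le> 1" "1 / (1 + t) \<le> damping p t" "1 / damping p t \<le> 1 + t"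
proof -
  have *: "1 \<le> (1 + t) powr p" "(1 + t) powr p \<le> (1 + t) powr 1"
    using assms by (auto intro!: ge_one_powr_ge_zero simp del: powr_one powr_one') (rule powr_mono, auto)
  then have **: "(1 + t) powr p \<le> 1 + t" using assms by simp
  show "0 < damping p t" using assms by (simp add: damping_def)
  show "damping p t \<le> 1" using * by (simp add: damping_def)
  show "1 / (1 + t) \<le> damping p t" unfolding damping_def
    using ** * assms by (intro divide_left_mono) auto
  show "1 / damping p t \<le> 1 + t" using ** by (simp add: damping_def)
qed

text \<open>G dominates ln (1 + t), because b dominates 1 / (1 + t).\<close>

lemma exp_damping_int:
  assumes "0 \<le> p" "p \<le> 1" "0 \<le> t"
  shows "1 + t \<le> exp (damping_int p t)"
proof -
  have "ln (1 + 0) - damping_int p 0 \<ge> ln (1 + t) - damping_int p t"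
  proof (rule DERIV_nonpos_imp_nonincreasing[OF assms(3)])
    fix x :: real assume x: "0 \<le> x" "x \<le> t"
    have "((\<lambda>x. ln (1 + x) - damping_int p x) has_real_derivative 1 / (1 + x) - damping p x) (at x)"
      using x by (auto intro!: derivative_eq_intros damping_int_deriv)
    then show "\<exists>y. ((\<lambda>x. ln (1 + x) - damping_int p x) has_real_derivative y) (at x) \<and> y \<le> 0"
      using damping_bounds(3)[OF assms(1,2) x(1)] by (intro exI[of _ "1 / (1 + x) - damping p x"]) auto
  qed
  then have "ln (1 + t) \<le> damping_int p t" by simp
  then have "exp (ln (1 + t)) \<le> exp (damping_int p t)" by simp
  then show ?thesis using assms by simp
qed

lemma damping_int_nonneg:
  assumes "0 \<le> p" "p \<le> 1" "0 \<le> t"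
  shows "0 \<le> damping_int p t"
proof -
  have "1 \<le> exp (damping_int p t)" using exp_damping_int[OF assms] assms by linarith
  then show ?thesis by simp
qed

definition energy :: "real \<Rightarrow> real \<Rightarrow> real \<Rightarrow> real \<Rightarrow> 'h::real_inner \<Rightarrow> 'h \<Rightarrow> 'h \<Rightarrow> real" where
  "energy \<kappa> \<epsilon> b c y v w =
     \<kappa> * (b * (b * (norm y)\<^sup>2 + 2 * \<epsilon> * inner y v)) + \<epsilon> * ((norm v)\<^sup>2 / c) + (norm w)\<^sup>2"

text \<open>Completing the square of b y + \<epsilon> v costs \<kappa> \<epsilon>^2 |v|^2, at most
  half of the term with |v|^2.\<close>

lemma energy_coercive:
  assumes "\<kappa> > 0" "\<epsilon> > 0" "0 < c" "c \<le> \<Lambda>" "\<epsilon> * (4 * \<Lambda> * \<kappa>) \<le> 1" "0 \<le> b"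
  shows "energy \<kappa> \<epsilon> b c y v w \<ge> (norm w)\<^sup>2 + \<epsilon> * (norm v)\<^sup>2 / (2 * c)"
proof -
  have "2 * \<kappa> * \<epsilon> * c \<le> \<epsilon> * (4 * \<Lambda> * \<kappa>)"
    using assms by (simp add: algebra_simps mult_left_mono)
  also have "\<dots> \<le> 1" by fact
  finally have *: "\<kappa> * \<epsilon> \<le> 1 / (2 * c)" using assms by (simp add: field_simps)
  have "- (2 * (b * inner y v) * \<epsilon>) \<le> 2 * (b * norm y) * (\<epsilon> * norm v)"
  proof -
    have "- inner y v \<le> norm y * norm v" using Cauchy_Schwarz_ineq2[of y v] by linarith
    from mult_left_mono[OF this, of "2 * b * \<epsilon>"] show ?thesis
      using assms by (simp add: algebra_simps)
  qed
  also have "\<dots> \<le> (b * norm y)\<^sup>2 + (\<epsilon> * norm v)\<^sup>2"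
    using two_mult_le_weighted[of 1 "b * norm y" "\<epsilon> * norm v"] by simp
  finally have "0 \<le> \<kappa> * ((b * norm y)\<^sup>2 + 2 * (b * inner y v) * \<epsilon> + (\<epsilon> * norm v)\<^sup>2)"
    using assms by simp
  then have "0 \<le> \<kappa> * (b * (b * (norm y)\<^sup>2 + 2 * \<epsilon> * inner y v)) + (\<kappa> * \<epsilon>) * (\<epsilon> * (norm v)\<^sup>2)"
    by (simp add: power2_eq_square algebra_simps)
  also have "(\<kappa> * \<epsilon>) * (\<epsilon> * (norm v)\<^sup>2) \<le> 1 / (2 * c) * (\<epsilon> * (norm v)\<^sup>2)"
    using * assms by (intro mult_right_mono) auto
  finally have "0 \<le> \<kappa> * (b * (b * (norm y)\<^sup>2 + 2 * \<epsilon> * inner y v)) + 1 / (2 * c) * (\<epsilon> * (norm v)\<^sup>2)"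
    by simp
  moreover have "\<epsilon> * ((norm v)\<^sup>2 / c) = 1 / (2 * c) * (\<epsilon> * (norm v)\<^sup>2) + \<epsilon> * (norm v)\<^sup>2 / (2 * c)"
    using assms by (simp add: field_simps)
  ultimately show ?thesis by (simp add: energy_def)
qed

text \<open>The number \<omega> is the room kept below the critical value 2 \<mu> \<nu>. Only right
  derivatives of W are required, because the rate chosen in \<open>weight_ex\<close> may
  jump.\<close>

locale weight =
  fixes p \<mu> \<nu> \<beta> \<omega> :: real and W a :: "real \<Rightarrow> real"
  assumes p: "0 \<le> p" "p \<le> 1" and pos: "\<mu> > 0" "\<nu> > 0" "\<beta> \<ge> 0" "\<omega> > 0"
    and W_cont: "continuous_on {0..} W"
    and W_0: "W 0 = 1" and W_ge_1: "\<And>t. t \<ge> 0 \<Longrightarrow> 1 \<le> W t"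
    and W_deriv: "\<And>t. t \<ge> 0 \<Longrightarrow> (W has_real_derivative a t * W t) (at_right t)"
    and a: "\<And>t. t \<ge> 0 \<Longrightarrow> 0 \<le> a t" "\<And>t. t \<ge> 0 \<Longrightarrow> a t \<le> \<beta> * damping p t"
      "\<And>t. t \<ge> 0 \<Longrightarrow> a t * damping p t \<le> 2 * \<mu> * \<nu> - \<omega>"
    and W_le: "\<And>t. t \<ge> 0 \<Longrightarrow> W t \<le> exp (\<beta> * damping_int p t)"
begin

definition \<kappa> :: real where "\<kappa> = (\<beta> + 2) * \<nu> / \<omega>"

lemma \<kappa>_pos: "\<kappa> > 0" and \<kappa>_eq: "\<kappa> * \<omega> = (\<beta> + 2) * \<nu>"
  using pos by (auto simp: \<kappa>_def)

abbreviation "b \<equiv> damping p"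
abbreviation "G \<equiv> damping_int p"

text \<open>The derivative of the corrector is of size \<open>e\<^sup>-\<^sup>G\<^sup>/\<^sup>\<epsilon>\<close>, of integral \<open>O(\<epsilon>)\<close>.  It enters linearly in the square root of
  the energy; the bounded factor in \<open>weight_corr\<close> produces the term \<open>rate_corr\<close> that absorbs it.\<close>

definition rate_corr :: "real \<Rightarrow> real \<Rightarrow> real" where
  "rate_corr \<epsilon> t = b t / \<epsilon> * exp (- (G t / (2 * \<epsilon>)))"

definition weight_corr :: "real \<Rightarrow> real \<Rightarrow> real" where
  "weight_corr \<epsilon> t = W t * exp (2 * exp (- (G t / (2 * \<epsilon>))))"

lemma weight_corr_deriv:
  assumes "t \<ge> 0" "\<epsilon> > 0"
  shows "(weight_corr \<epsilon> has_real_derivative (a t - rate_corr \<epsilon> t) * weight_corr \<epsilon> t) (at_right t)"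
  unfolding weight_corr_def[abs_def] using assms
  by (auto intro!: derivative_eq_intros W_deriv damping_int_deriv simp: rate_corr_def field_simps)

lemma weight_corr_bounds:
  assumes "t \<ge> 0" "\<epsilon> > 0"
  shows "W t \<le> weight_corr \<epsilon> t" "weight_corr \<epsilon> t \<le> exp 2 * W t" "1 \<le> weight_corr \<epsilon> t"
proof -
  have W: "1 \<le> W t" using W_ge_1 assms by simp
  have "0 \<le> G t / (2 * \<epsilon>)" using damping_int_nonneg[OF p, of t] assms by simp
  then have *: "exp (2 * exp (- (G t / (2 * \<epsilon>)))) \<le> exp 2" by simp
  have **: "1 \<le> exp (2 * exp (- (G t / (2 * \<epsilon>))))" by simp
  show 1: "W t \<le> weight_corr \<epsilon> t" using mult_left_mono[OF **, of "W t"] W by (simp add: weight_corr_def)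
  show "weight_corr \<epsilon> t \<le> exp 2 * W t"
    using mult_left_mono[OF *, of "W t"] W by (simp add: weight_corr_def mult.commute)
  show "1 \<le> weight_corr \<epsilon> t" using 1 W by simp
qed

lemma weight_corr_cont:
  assumes "\<epsilon> > 0"
  shows "continuous_on {0..} (weight_corr \<epsilon>)"
proof -
  show ?thesis unfolding weight_corr_def[abs_def] using \<open>\<epsilon> > 0\<close>
    by (intro continuous_intros W_cont damping_int_cont) auto
qed

lemma b_cont: "continuous_on {0..} b"
  unfolding continuous_on_eq_continuous_within
  using damping_deriv by (meson DERIV_continuous atLeast_iff)

text \<open>The abstract equation is y' = v + z and \<epsilon> v' + b v + c S (S y) = f, where z
  plays the role of the derivative of the corrector, c varies with Lipschitz error \<gamma> and v
  with error V. The operator S is a truncated square root of A, later \<open>B n\<close>.\<close>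

lemma energy_dini:
  fixes y v :: "real \<Rightarrow> 'h::real_inner" and S :: "'h \<Rightarrow> 'h"
  assumes S: "bounded_linear S" "\<And>x y. inner (S x) y = inner x (S y)"
    and t: "t \<ge> 0" and \<epsilon>: "\<epsilon> > 0" "\<epsilon> * energy_smallness \<kappa> \<mu> \<nu> \<Lambda> \<beta> \<le> 1"
    and c: "\<And>s. s \<ge> 0 \<Longrightarrow> \<mu> \<le> c s" "\<And>s. s \<ge> 0 \<Longrightarrow> c s \<le> \<Lambda>"
    and dc: "approx_deriv c 0 \<gamma> t" "\<gamma> \<ge> 0" "\<epsilon> * \<gamma> \<le> b t * c t / 4"
    and dy: "approx_deriv y (v t + z) 0 t"
    and dv: "approx_deriv v v1 V t" "V \<ge> 0"
    and eq: "\<epsilon> *\<^sub>R v1 = - b t *\<^sub>R v t - c t *\<^sub>R S (S (y t)) + f"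
    and coer: "\<nu> * (norm (y t))\<^sup>2 \<le> (norm (S (y t)))\<^sup>2" "\<nu> * (norm z)\<^sup>2 \<le> (norm (S z))\<^sup>2"
  shows "dini_le (\<lambda>s. weight_corr \<epsilon> s * energy \<kappa> \<epsilon> (b s) (c s) (y s) (v s) (S (y s)))
    (weight_corr \<epsilon> t * (forcing_const \<kappa> \<mu> \<nu> \<Lambda> * ((norm f)\<^sup>2 / b t + \<epsilon>\<^sup>2 * V\<^sup>2 / b t
       + (norm (S z))\<^sup>2 / rate_corr \<epsilon> t + \<epsilon>\<^sup>2 * (norm (S z))\<^sup>2))) t"
proof -
  interpret S: bounded_linear S by fact
  note bt = damping_bounds[OF p t]
  have ct: "0 < \<mu>" "\<mu> \<le> c t" "c t \<le> \<Lambda>" "0 < c t" using c[OF t] pos by auto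
  define b' where "b' = - (p / (1 + t)) * b t"
  have b'0: "b' \<le> 0" using p t bt by (simp add: b'_def)
  \<comment> \<open>This is where p \<le> 1 makes the terms with b' no larger than those with
    b^2.\<close>
  have b'2: "\<bar>b'\<bar> \<le> (b t)\<^sup>2"
  proof -
    have "p / (1 + t) \<le> 1 / (1 + t)" using p t by (intro divide_right_mono) auto
    also have "\<dots> \<le> b t" by (rule bt)
    finally have "p / (1 + t) * b t \<le> b t * b t" using bt by (intro mult_right_mono) auto
    then show ?thesis using p t bt by (simp add: b'_def power2_eq_square)
  qed
  have db: "approx_deriv b b' 0 t"
    using damping_deriv[OF t, of p "{t<..}"]
    by (intro approx_deriv_vector) (simp add: has_real_derivative_iff_has_vector_derivative b'_def)
  have dyy: "approx_deriv (\<lambda>s. (norm (y s))\<^sup>2) (2 * inner (y t) (v t + z)) 0 t"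
    using approx_deriv_inner[OF dy dy] by (simp add: dot_square_norm inner_commute)
  have dyv: "approx_deriv (\<lambda>s. inner (y s) (v s)) (inner (y t) v1 + inner (v t + z) (v t)) (norm (y t) * V) t"
    using approx_deriv_inner[OF dy dv(1)] by simp
  have dvv: "approx_deriv (\<lambda>s. (norm (v s))\<^sup>2) (2 * inner (v t) v1) (2 * norm (v t) * V) t"
    using approx_deriv_inner[OF dv(1) dv(1)] by (simp add: dot_square_norm inner_commute algebra_simps)
  have dci: "approx_deriv (\<lambda>s. 1 / c s) 0 (\<gamma> / (c t)\<^sup>2) t"
    using dc c(1) t pos by (intro approx_deriv_inverse) (auto intro: less_le_trans)
  have dSS: "approx_deriv (\<lambda>s. (norm (S (y s)))\<^sup>2) (2 * inner (S (y t)) (S (v t + z))) 0 t"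
    using approx_deriv_inner[OF approx_deriv_bounded_linear[OF S(1) dy] approx_deriv_bounded_linear[OF S(1) dy]]
    by (simp add: dot_square_norm inner_commute)
  define Q where "Q = b t * (norm (y t))\<^sup>2 + 2 * \<epsilon> * inner (y t) (v t)"
  define Q' where "Q' = b t * (2 * inner (y t) (v t + z)) + b' * (norm (y t))\<^sup>2
    + 2 * \<epsilon> * (inner (y t) v1 + inner (v t + z) (v t))"
  have "approx_deriv (\<lambda>s. b s * (norm (y s))\<^sup>2 + 2 * \<epsilon> * inner (y s) (v s)) Q' (2 * \<epsilon> * (norm (y t) * V)) t"
    using approx_deriv_add[OF approx_deriv_mult[OF db dyy] approx_deriv_cmult[OF dyv, of "2 * \<epsilon>"]] \<epsilon>
    by (simp add: Q'_def)
  from approx_deriv_cmult[OF approx_deriv_mult[OF db this], of \<kappa>]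
  have d1: "approx_deriv (\<lambda>s. \<kappa> * (b s * (b s * (norm (y s))\<^sup>2 + 2 * \<epsilon> * inner (y s) (v s))))
      (\<kappa> * (b t * Q' + b' * Q)) (\<kappa> * (b t * (2 * \<epsilon> * (norm (y t) * V)))) t"
    using bt \<kappa>_pos by (simp add: Q_def)
  from approx_deriv_cmult[OF approx_deriv_mult[OF dvv dci], of \<epsilon>]
  have d2: "approx_deriv (\<lambda>s. \<epsilon> * ((norm (v s))\<^sup>2 / c s)) (\<epsilon> * (2 * inner (v t) v1 / c t))
      (\<epsilon> * ((norm (v t))\<^sup>2 * (\<gamma> / (c t)\<^sup>2) + 2 * norm (v t) * V / c t)) t"
    using \<epsilon> ct by simp
  define E where "E = (\<lambda>s. energy \<kappa> \<epsilon> (b s) (c s) (y s) (v s) (S (y s)))"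
  define dE where "dE = \<kappa> * (b t * Q' + b' * Q) + \<epsilon> * (2 * inner (v t) v1 / c t)
    + 2 * inner (S (y t)) (S (v t + z))"
  define VE where "VE = \<kappa> * (b t * (2 * \<epsilon> * (norm (y t) * V)))
    + \<epsilon> * ((norm (v t))\<^sup>2 * (\<gamma> / (c t)\<^sup>2) + 2 * norm (v t) * V / c t)"
  have E: "approx_deriv E dE VE t"
    unfolding E_def energy_def dE_def VE_def
    using approx_deriv_add[OF approx_deriv_add[OF d1 d2] dSS] by simp
  define \<eta> where "\<eta> = rate_corr \<epsilon> t"
  have \<eta>: "\<eta> > 0" using bt \<epsilon> by (simp add: \<eta>_def rate_corr_def)
  have "approx_deriv (weight_corr \<epsilon>) ((a t - \<eta>) * weight_corr \<epsilon> t) 0 t"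
    using weight_corr_deriv[OF t \<epsilon>(1)]
    by (intro approx_deriv_vector) (simp add: has_real_derivative_iff_has_vector_derivative \<eta>_def)
  from approx_deriv_mult[OF this E]
  have Y: "approx_deriv (\<lambda>s. weight_corr \<epsilon> s * E s)
     (weight_corr \<epsilon> t * dE + (a t - \<eta>) * weight_corr \<epsilon> t * E t) (\<bar>weight_corr \<epsilon> t\<bar> * VE) t"
    by simp
  define ny nv nS nz nf nZ where "ny = norm (y t)" and "nv = norm (v t)" and "nS = norm (S (y t))"
    and "nz = norm z" and "nf = norm f" and "nZ = norm (S z)"
  note nd = ny_def nv_def nS_def nz_def nf_def nZ_def
  have nn: "0 \<le> ny" "0 \<le> nv" "0 \<le> nS" "0 \<le> nz" "0 \<le> nf" "0 \<le> nZ" by (auto simp: nd)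
  let ?F = "forcing_const \<kappa> \<mu> \<nu> \<Lambda> * (nf\<^sup>2 / b t + \<epsilon>\<^sup>2 * V\<^sup>2 / b t + nZ\<^sup>2 / \<eta> + \<epsilon>\<^sup>2 * nZ\<^sup>2)"
  have alg: "\<kappa> * b t * (2 * b t * (ny * nz) + 2 * \<epsilon> * nv\<^sup>2 + 2 * \<epsilon> * (nz * nv) - 2 * c t * nS\<^sup>2 + 2 * (ny * nf) + 2 * \<epsilon> * (ny * V))
      + 2 * \<kappa> * \<epsilon> * (b t)\<^sup>2 * (ny * nv) - 2 * b t / c t * nv\<^sup>2 + 2 / c t * (nv * nf) + 2 * \<epsilon> / c t * (nv * V)
      + \<epsilon> * \<gamma> * nv\<^sup>2 / (c t)\<^sup>2 + 2 * (nS * nZ)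
      + a t * (\<kappa> * (b t)\<^sup>2 * ny\<^sup>2 + 2 * \<kappa> * \<epsilon> * b t * (ny * nv) + \<epsilon> * nv\<^sup>2 / c t + nS\<^sup>2)
    \<le> \<eta> * nS\<^sup>2 + ?F"
    by (rule energy_algebra[OF bt(1,2) ct(1-3) pos(2) \<kappa>_pos pos(3,4) \<epsilon>(1) \<eta> \<kappa>_eq a[OF t] \<epsilon>(2) dc(3)
        nn(1,2,3,4,5) dv(2) nn(6)])
      (use coer in \<open>auto simp: nd\<close>)
  \<comment> \<open>The equation tested with x; it is used for x = y t and x = v t.\<close>
  have ev1: "\<epsilon> * inner x v1 = - b t * inner x (v t) - c t * inner (S x) (S (y t)) + inner x f" for x
  proof -
    have "\<epsilon> * inner x v1 = inner x (\<epsilon> *\<^sub>R v1)" by simp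
    then show ?thesis unfolding eq by (simp add: inner_add_right inner_diff_right S(2))
  qed
  \<comment> \<open>The term 2 b <y, v> from the derivative of b |y|^2 cancels against the one that
    the equation produces from 2 \<epsilon> <y, v'>.\<close>
  have "Q' = 2 * b t * inner (y t) z + b' * ny\<^sup>2 - 2 * c t * nS\<^sup>2 + 2 * inner (y t) f
     + 2 * \<epsilon> * nv\<^sup>2 + 2 * \<epsilon> * inner z (v t)"
    using ev1[of "y t"]
    by (simp add: Q'_def nd inner_add_right inner_add_left dot_square_norm algebra_simps)
  also have "\<dots> \<le> 2 * b t * (ny * nz) - 2 * c t * nS\<^sup>2 + 2 * (ny * nf) + 2 * \<epsilon> * nv\<^sup>2 + 2 * \<epsilon> * (nz * nv)"
  proof -
    have "b t * inner (y t) z \<le> b t * (ny * nz)" "inner (y t) f \<le> ny * nf" "\<epsilon> * inner z (v t) \<le> \<epsilon> * (nz * nv)"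
      using bt \<epsilon> by (auto simp: nd norm_cauchy_schwarz intro!: mult_left_mono)
    moreover have "b' * ny\<^sup>2 \<le> 0" using b'0 by (simp add: mult_nonpos_nonneg)
    ultimately show ?thesis by linarith
  qed
  finally have Q'_le: "Q' \<le> 2 * b t * (ny * nz) - 2 * c t * nS\<^sup>2 + 2 * (ny * nf) + 2 * \<epsilon> * nv\<^sup>2 + 2 * \<epsilon> * (nz * nv)" .
  have yv_abs: "\<bar>inner (y t) (v t)\<bar> \<le> ny * nv" by (simp add: nd Cauchy_Schwarz_ineq2)
  have bQ: "b' * Q \<le> 2 * \<epsilon> * (b t)\<^sup>2 * (ny * nv)"
  proof -
    have "b' * (b t * ny\<^sup>2) \<le> 0" using b'0 bt by (intro mult_nonpos_nonneg) auto
    moreover have "b' * inner (y t) (v t) \<le> (b t)\<^sup>2 * (ny * nv)"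
    proof -
      have "b' * inner (y t) (v t) \<le> \<bar>b'\<bar> * \<bar>inner (y t) (v t)\<bar>" by (metis abs_ge_self abs_mult)
      also have "\<dots> \<le> (b t)\<^sup>2 * (ny * nv)" using b'2 yv_abs by (intro mult_mono) auto
      finally show ?thesis .
    qed
    then have "2 * \<epsilon> * (b' * inner (y t) (v t)) \<le> 2 * \<epsilon> * ((b t)\<^sup>2 * (ny * nv))"
      using \<epsilon> by (intro mult_left_mono) auto
    ultimately show ?thesis by (simp add: Q_def ny_def algebra_simps)
  qed
  have P1: "\<kappa> * (b t * Q' + b' * Q) \<le> \<kappa> * b t * (2 * b t * (ny * nz) - 2 * c t * nS\<^sup>2 + 2 * (ny * nf) + 2 * \<epsilon> * nv\<^sup>2 + 2 * \<epsilon> * (nz * nv))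
      + 2 * \<kappa> * \<epsilon> * (b t)\<^sup>2 * (ny * nv)"
  proof -
    have "b t * Q' + b' * Q \<le> b t * (2 * b t * (ny * nz) - 2 * c t * nS\<^sup>2 + 2 * (ny * nf) + 2 * \<epsilon> * nv\<^sup>2 + 2 * \<epsilon> * (nz * nv))
       + 2 * \<epsilon> * (b t)\<^sup>2 * (ny * nv)"
      using Q'_le bQ bt by (intro add_mono mult_left_mono) auto
    from mult_left_mono[OF this less_imp_le[OF \<kappa>_pos]] show ?thesis by (simp add: algebra_simps)
  qed
  \<comment> \<open>Because of the factor 1 / c in the energy, the inner products of S v and S y
    cancel between the kinetic and the potential term.\<close>
  have P2: "\<epsilon> * (2 * inner (v t) v1 / c t) + 2 * inner (S (y t)) (S (v t + z))
      \<le> - 2 * b t / c t * nv\<^sup>2 + 2 / c t * (nv * nf) + 2 * (nS * nZ)"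
  proof -
    have "\<epsilon> * (2 * inner (v t) v1 / c t) = 2 / c t * (\<epsilon> * inner (v t) v1)" by simp
    also have "\<dots> = 2 / c t * (- b t * nv\<^sup>2 - c t * inner (S (v t)) (S (y t)) + inner (v t) f)"
      unfolding ev1 by (simp add: nd dot_square_norm)
    also have "\<dots> = - 2 * b t / c t * nv\<^sup>2 - 2 * inner (S (y t)) (S (v t)) + 2 / c t * inner (v t) f"
      using ct by (simp add: field_simps inner_commute)
    finally have "\<epsilon> * (2 * inner (v t) v1 / c t) + 2 * inner (S (y t)) (S (v t + z)) =
      - 2 * b t / c t * nv\<^sup>2 + 2 / c t * inner (v t) f + 2 * inner (S (y t)) (S z)"
      by (simp add: S.add inner_add_right)
    moreover have "2 / c t * inner (v t) f \<le> 2 / c t * (nv * nf)"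
      using ct by (intro mult_left_mono) (auto simp: nd norm_cauchy_schwarz)
    moreover have "inner (S (y t)) (S z) \<le> nS * nZ" by (simp add: nd norm_cauchy_schwarz)
    ultimately show ?thesis by linarith
  qed
  have P3: "a t * E t \<le> a t * (\<kappa> * (b t)\<^sup>2 * ny\<^sup>2 + 2 * \<kappa> * \<epsilon> * b t * (ny * nv) + \<epsilon> * nv\<^sup>2 / c t + nS\<^sup>2)"
  proof (intro mult_left_mono a t)
    have "\<kappa> * (b t * (2 * \<epsilon> * inner (y t) (v t))) \<le> \<kappa> * (b t * (2 * \<epsilon> * (ny * nv)))"
      using yv_abs \<kappa>_pos bt \<epsilon> by (intro mult_left_mono) auto
    then show "E t \<le> \<kappa> * (b t)\<^sup>2 * ny\<^sup>2 + 2 * \<kappa> * \<epsilon> * b t * (ny * nv) + \<epsilon> * nv\<^sup>2 / c t + nS\<^sup>2"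
      by (simp add: E_def energy_def nd algebra_simps power2_eq_square)
  qed
  have P4: "VE = \<kappa> * b t * (2 * \<epsilon> * (ny * V)) + \<epsilon> * \<gamma> * nv\<^sup>2 / (c t)\<^sup>2 + 2 * \<epsilon> / c t * (nv * V)"
    by (simp add: VE_def nd algebra_simps)
  \<comment> \<open>This bounds - \<eta> E by - \<eta> |S y|^2, which removes the first term on the
    right of \<open>alg\<close>.\<close>
  have P5: "nS\<^sup>2 \<le> E t"
  proof -
    have "nS\<^sup>2 + \<epsilon> * nv\<^sup>2 / (2 * c t) \<le> E t" unfolding E_def nd
      using energy_smallness_parts(3)[OF pos(1,2) _ \<kappa>_pos pos(3) \<epsilon>] ct \<kappa>_pos \<epsilon> bt
      by (intro energy_coercive[of _ _ _ \<Lambda>]) auto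
    moreover have "0 \<le> \<epsilon> * nv\<^sup>2 / (2 * c t)" using \<epsilon> ct by simp
    ultimately show ?thesis by linarith
  qed
  have "dE + VE + a t * E t \<le> \<eta> * nS\<^sup>2 + ?F"
  proof -
    have "dE + VE + a t * E t \<le>
      \<kappa> * b t * (2 * b t * (ny * nz) - 2 * c t * nS\<^sup>2 + 2 * (ny * nf) + 2 * \<epsilon> * nv\<^sup>2 + 2 * \<epsilon> * (nz * nv))
      + 2 * \<kappa> * \<epsilon> * (b t)\<^sup>2 * (ny * nv)
      + (- 2 * b t / c t * nv\<^sup>2 + 2 / c t * (nv * nf) + 2 * (nS * nZ))
      + (\<kappa> * b t * (2 * \<epsilon> * (ny * V)) + \<epsilon> * \<gamma> * nv\<^sup>2 / (c t)\<^sup>2 + 2 * \<epsilon> / c t * (nv * V))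
      + a t * (\<kappa> * (b t)\<^sup>2 * ny\<^sup>2 + 2 * \<kappa> * \<epsilon> * b t * (ny * nv) + \<epsilon> * nv\<^sup>2 / c t + nS\<^sup>2)"
      unfolding dE_def using P1 P2 P3 P4 by linarith
    also have "\<dots> = \<kappa> * b t * (2 * b t * (ny * nz) + 2 * \<epsilon> * nv\<^sup>2 + 2 * \<epsilon> * (nz * nv) - 2 * c t * nS\<^sup>2 + 2 * (ny * nf) + 2 * \<epsilon> * (ny * V))
      + 2 * \<kappa> * \<epsilon> * (b t)\<^sup>2 * (ny * nv) - 2 * b t / c t * nv\<^sup>2 + 2 / c t * (nv * nf) + 2 * \<epsilon> / c t * (nv * V)
      + \<epsilon> * \<gamma> * nv\<^sup>2 / (c t)\<^sup>2 + 2 * (nS * nZ)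
      + a t * (\<kappa> * (b t)\<^sup>2 * ny\<^sup>2 + 2 * \<kappa> * \<epsilon> * b t * (ny * nv) + \<epsilon> * nv\<^sup>2 / c t + nS\<^sup>2)"
      by (simp add: distrib_left right_diff_distrib)
    also note alg
    finally show ?thesis .
  qed
  moreover have "\<eta> * nS\<^sup>2 \<le> \<eta> * E t" using P5 \<eta> by (intro mult_left_mono) auto
  ultimately have main: "dE + VE + (a t - \<eta>) * E t \<le> ?F" by (simp add: left_diff_distrib)
  have W: "0 \<le> weight_corr \<epsilon> t" using weight_corr_bounds(3)[OF t \<epsilon>(1)] by simp
  have "weight_corr \<epsilon> t * dE + (a t - \<eta>) * weight_corr \<epsilon> t * E t + \<bar>weight_corr \<epsilon> t\<bar> * VE
     = weight_corr \<epsilon> t * (dE + VE + (a t - \<eta>) * E t)"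
    using W by (simp add: algebra_simps)
  also have "\<dots> \<le> weight_corr \<epsilon> t * ?F" using main W by (rule mult_left_mono)
  finally show ?thesis
    using dini_le_approx[OF Y] unfolding E_def \<eta>_def nd by blast
qed

end

section \<open>Spectral calculus of a projection-valued measure\<close>

definition symmetric_op :: "('h::real_inner \<Rightarrow> 'h) \<Rightarrow> bool" where
  "symmetric_op T \<longleftrightarrow> bounded_linear T \<and> (\<forall>x y. inner (T x) y = inner x (T y))"

lemma symmetric_op_polarization:
  assumes "symmetric_op T"
  shows "inner (T x) y = (inner (T (x + y)) (x + y) - inner (T (x - y)) (x - y)) / 4"
proof -
  have T: "bounded_linear T" using assms by (simp add: symmetric_op_def)
  have *: "inner (T y) x = inner (T x) y" using assms by (metis symmetric_op_def inner_commute)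
  have "T (x + y) = T x + T y" "T (x - y) = T x - T y"
    using T by (simp_all add: linear_simps)
  then show ?thesis
    using * by (simp only: inner_add_left inner_add_right inner_diff_left inner_diff_right) (simp add: field_simps)
qed

lemma symmetric_op_eqI:
  assumes "symmetric_op T" "symmetric_op U" "\<And>x. inner (T x) x = inner (U x) x"
  shows "T x = U x"
proof -
  have "inner (T x) y = inner (U x) y" for y
    by (simp only: symmetric_op_polarization[OF assms(1), of x y] symmetric_op_polarization[OF assms(2), of x y] assms(3))
  then have "inner (T x - U x) (T x - U x) = 0" by (simp add: inner_diff_left)
  then show ?thesis by simp
qed

text \<open>For y parallel to T x with |y| = |x|, the inner product <T x, y> equals |x| |T x|;
  polarization and the parallelogram law bound it by C |x|^2.\<close>

lemma symmetric_op_norm_le: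
  assumes T: "symmetric_op T" and C: "\<And>x. \<bar>inner (T x) x\<bar> \<le> C * (norm x)\<^sup>2" and "C \<ge> 0"
  shows "norm (T x) \<le> C * norm x"
proof (cases "x = 0 \<or> T x = 0")
  case True
  then show ?thesis using T \<open>C \<ge> 0\<close> by (auto simp: symmetric_op_def linear_simps)
next
  case False
  define y where "y = (norm x / norm (T x)) *\<^sub>R T x"
  have ny: "norm y = norm x" using False by (simp add: y_def)
  have "norm x * norm (T x) = inner (T x) y"
    using False by (simp add: y_def dot_square_norm power2_eq_square)
  also have "\<dots> \<le> (C * (norm (x + y))\<^sup>2 + C * (norm (x - y))\<^sup>2) / 4"
    using symmetric_op_polarization[OF T, of x y] C[of "x + y"] C[of "x - y"] by (simp add: abs_le_iff)
  also have "\<dots> = C * (norm x)\<^sup>2"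
  proof -
    have "(norm y)\<^sup>2 = (norm x)\<^sup>2" using ny by simp
    then have "(norm (x + y))\<^sup>2 + (norm (x - y))\<^sup>2 = 4 * (norm x)\<^sup>2"
      by (simp add: power2_norm_eq_inner inner_add_left inner_add_right inner_diff_left
          inner_diff_right inner_commute)
    then show ?thesis by (simp flip: distrib_left)
  qed
  finally show ?thesis using False by (simp add: power2_eq_square)
qed

locale pvm =
  fixes E :: "real set \<Rightarrow> 'h::{real_inner, complete_space} \<Rightarrow> 'h"
  assumes pvm: "projection_valued_measure E"
begin

lemma E_bounded_linear: "S \<in> sets borel \<Longrightarrow> bounded_linear (E S)"
  and E_idem: "S \<in> sets borel \<Longrightarrow> E S (E S x) = E S x"
  and E_sym: "S \<in> sets borel \<Longrightarrow> inner (E S x) y = inner x (E S y)"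
  and E_empty: "E {} x = 0"
  and E_UNIV: "E UNIV x = x"
  and E_Int: "S \<in> sets borel \<Longrightarrow> T \<in> sets borel \<Longrightarrow> E (S \<inter> T) x = E S (E T x)"
  and E_sums: "range F \<subseteq> sets borel \<Longrightarrow> disjoint_family F \<Longrightarrow> (\<lambda>n. E (F n) x) sums E (\<Union>n. F n) x"
  using pvm by (auto simp: projection_valued_measure_def)

lemma E_symmetric_op: "S \<in> sets borel \<Longrightarrow> symmetric_op (E S)"
  by (simp add: symmetric_op_def E_bounded_linear E_sym)

lemma E_commute: "S \<in> sets borel \<Longrightarrow> T \<in> sets borel \<Longrightarrow> E S (E T x) = E T (E S x)"
  by (metis E_Int Int_commute)

lemma inner_E: "S \<in> sets borel \<Longrightarrow> inner (E S x) x = (norm (E S x))\<^sup>2"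
  by (metis E_idem E_sym dot_square_norm)

lemma norm_E_le: "S \<in> sets borel \<Longrightarrow> norm (E S x) \<le> norm x"
  using inner_E[of S x] norm_cauchy_schwarz[of "E S x" x]
  by (cases "norm (E S x) = 0") (auto simp: power2_eq_square)

lemma norm_diff_E: "S \<in> sets borel \<Longrightarrow> (norm (x - E S x))\<^sup>2 = (norm x)\<^sup>2 - (norm (E S x))\<^sup>2"
  using inner_E[of S x]
  by (simp add: power2_norm_eq_inner inner_diff_left inner_diff_right inner_commute)

abbreviation "\<mu>\<^sub>x \<equiv> spectral_dist E"

lemma space_dist [simp]: "space (\<mu>\<^sub>x x) = UNIV"
  and sets_dist [simp, measurable_cong]: "sets (\<mu>\<^sub>x x) = sets borel"
  using sets.sigma_sets_eq[of "borel :: real measure"]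
  by (auto simp: spectral_dist_def space_measure_of_conv sets_measure_of_conv)

text \<open>\<open>measure_of\<close> reproduces the given set function only once it is known to be
  countably additive; here this comes from \<open>E_sums\<close>.\<close>

lemma emeasure_dist:
  assumes "S \<in> sets borel"
  shows "emeasure (\<mu>\<^sub>x x) S = ennreal ((norm (E S x))\<^sup>2)"
proof -
  have "emeasure (\<mu>\<^sub>x x) S = ennreal (inner (E S x) x)"
    unfolding spectral_dist_def
  proof (rule emeasure_measure_of_sigma)
    show "sigma_algebra UNIV (sets borel :: real set set)"
      using sets.sigma_algebra_axioms[of "borel :: real measure"] by simp
    show "positive (sets borel) (\<lambda>S. ennreal (inner (E S x) x))"
      by (simp add: positive_def E_empty)
    show "countably_additive (sets borel) (\<lambda>S. ennreal (inner (E S x) x))"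
      unfolding countably_additive_def
    proof (intro allI impI)
      fix F :: "nat \<Rightarrow> real set"
      assume F: "range F \<subseteq> sets borel" "disjoint_family F"
      have "(\<lambda>n. inner (E (F n) x) x) sums inner (E (\<Union>n. F n) x) x"
        by (rule bounded_linear.sums[OF bounded_linear_inner_left E_sums[OF F]])
      moreover have "0 \<le> inner (E (F n) x) x" for n
        using F by (subst inner_E) auto
      ultimately show "(\<Sum>n. ennreal (inner (E (F n) x) x)) = ennreal (inner (E (\<Union>n. F n) x) x)"
        by (intro suminf_ennreal_eq)
    qed
  qed (use assms in auto)
  then show ?thesis using inner_E[OF assms] by simp
qed

lemma finite_dist: "finite_measure (\<mu>\<^sub>x x)"
  by (rule finite_measureI) (simp add: emeasure_dist)

lemma measure_dist: "S \<in> sets borel \<Longrightarrow> measure (\<mu>\<^sub>x x) S = (norm (E S x))\<^sup>2"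
  by (simp add: measure_def emeasure_dist)

lemma dist_E:
  assumes S: "S \<in> sets borel"
  shows "\<mu>\<^sub>x (E S x) = density (\<mu>\<^sub>x x) (indicator S)"
proof (rule measure_eqI)
  fix T assume "T \<in> sets (\<mu>\<^sub>x (E S x))"
  then have T: "T \<in> sets borel" by simp
  have "emeasure (density (\<mu>\<^sub>x x) (indicator S)) T = emeasure (\<mu>\<^sub>x x) (S \<inter> T)"
    using S T by (subst emeasure_density)
      (auto simp: nn_integral_indicator[symmetric] indicator_inter_arith[symmetric] simp del: nn_integral_indicator)
  then show "emeasure (\<mu>\<^sub>x (E S x)) T = emeasure (density (\<mu>\<^sub>x x) (indicator S)) T"
    using S T by (simp add: emeasure_dist E_commute[OF S T] E_Int)
qed simp

lemma integral_dist_E: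
  assumes S: "S \<in> sets borel" and f: "f \<in> borel_measurable borel"
  shows "(LINT l|\<mu>\<^sub>x (E S x). f l) = (LINT l|\<mu>\<^sub>x x. f l * indicator S l :: real)"
proof -
  have "density (\<mu>\<^sub>x x) (indicator S) = density (\<mu>\<^sub>x x) (\<lambda>l. ennreal (indicator S l :: real))"
    by (simp add: ennreal_indicator)
  then show ?thesis unfolding dist_E[OF S]
    using S f by (simp add: integral_density mult.commute)
qed

section \<open>Functional calculus for bounded Borel functions\<close>

definition bdd_borel :: "(real \<Rightarrow> real) \<Rightarrow> bool" where
  "bdd_borel f \<longleftrightarrow> f \<in> borel_measurable borel \<and> (\<exists>C. \<forall>l. \<bar>f l\<bar> \<le> C)"

lemma bdd_borel_measurable: "bdd_borel f \<Longrightarrow> f \<in> borel_measurable borel"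
  by (simp add: bdd_borel_def)

lemma bdd_borel_integrable: "bdd_borel f \<Longrightarrow> integrable (\<mu>\<^sub>x x) f"
proof -
  assume "bdd_borel f"
  then obtain C where "f \<in> borel_measurable borel" "\<And>l. \<bar>f l\<bar> \<le> C" by (auto simp: bdd_borel_def)
  then show ?thesis
    by (intro finite_measure.integrable_const_bound[OF finite_dist, of _ C]) auto
qed

lemma bdd_borelI: "f \<in> borel_measurable borel \<Longrightarrow> (\<And>l. \<bar>f l\<bar> \<le> C) \<Longrightarrow> bdd_borel f"
  by (auto simp: bdd_borel_def)

lemma bdd_borelE:
  assumes "bdd_borel f"
  obtains C where "f \<in> borel_measurable borel" "\<And>l. \<bar>f l\<bar> \<le> C"
  using assms unfolding bdd_borel_def by blast

lemma bdd_borel_add: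
  assumes "bdd_borel f" "bdd_borel g"
  shows "bdd_borel (\<lambda>l. f l + g l)"
proof -
  obtain C D where f: "f \<in> borel_measurable borel" "\<And>l. \<bar>f l\<bar> \<le> C"
    and g: "g \<in> borel_measurable borel" "\<And>l. \<bar>g l\<bar> \<le> D"
    using assms by (metis bdd_borelE)
  show ?thesis
    by (rule bdd_borelI[where C = "C + D", OF borel_measurable_add[OF f(1) g(1)]])
       (rule order_trans[OF abs_triangle_ineq add_mono[OF f(2) g(2)]])
qed

lemma bdd_borel_mult:
  assumes "bdd_borel f" "bdd_borel g"
  shows "bdd_borel (\<lambda>l. f l * g l)"
proof -
  obtain C D where f: "f \<in> borel_measurable borel" "\<And>l. \<bar>f l\<bar> \<le> C"
    and g: "g \<in> borel_measurable borel" "\<And>l. \<bar>g l\<bar> \<le> D"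
    using assms by (metis bdd_borelE)
  have "\<bar>f l * g l\<bar> \<le> C * D" for l
    unfolding abs_mult using order_trans[OF abs_ge_zero f(2)[of 0]]
    by (rule mult_mono[OF f(2) g(2)]) simp
  then show ?thesis
    by (rule bdd_borelI[OF borel_measurable_times[OF f(1) g(1)]])
qed

lemma bdd_borel_const: "bdd_borel (\<lambda>_. c)"
  by (rule bdd_borelI[where C = "\<bar>c\<bar>"]) auto

lemma bdd_borel_cmult: "bdd_borel f \<Longrightarrow> bdd_borel (\<lambda>l. c * f l)"
  by (rule bdd_borel_mult[OF bdd_borel_const])

lemma bdd_borel_indicator: "S \<in> sets borel \<Longrightarrow> bdd_borel (indicator S)"
  unfolding bdd_borel_def by (auto intro!: exI[of _ 1] simp: indicator_def)

text \<open>\<open>T\<close> is the operator \<open>\<integral> f dE\<close>, for bounded \<open>f\<close>.  The multiplicativity in \<open>represents\<close> is linear and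
  continuous in \<open>f\<close>, so that it passes from step functions to their uniform limits.\<close>

definition represents0 :: "(real \<Rightarrow> real) \<Rightarrow> ('h \<Rightarrow> 'h) \<Rightarrow> bool" where
  "represents0 f T \<longleftrightarrow> symmetric_op T \<and> (\<forall>S\<in>sets borel. \<forall>x. T (E S x) = E S (T x)) \<and>
     (\<forall>x. inner (T x) x = (LINT l|\<mu>\<^sub>x x. f l))"

definition represents :: "(real \<Rightarrow> real) \<Rightarrow> ('h \<Rightarrow> 'h) \<Rightarrow> bool" where
  "represents f T \<longleftrightarrow> represents0 f T \<and>
     (\<forall>g U. bdd_borel g \<longrightarrow> represents0 g U \<longrightarrow> (\<forall>x. inner (T (U x)) x = (LINT l|\<mu>\<^sub>x x. f l * g l)))"

lemma symmetric_op_add: "symmetric_op T \<Longrightarrow> symmetric_op U \<Longrightarrow> symmetric_op (\<lambda>x. T x + U x)"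
  by (auto simp: symmetric_op_def inner_add_left inner_add_right intro: bounded_linear_add)

lemma symmetric_op_scaleR: "symmetric_op T \<Longrightarrow> symmetric_op (\<lambda>x. c *\<^sub>R T x)"
  by (auto simp: symmetric_op_def intro: bounded_linear_const_scaleR)

lemma represents0_add:
  assumes "represents0 f T" "represents0 g U" "bdd_borel f" "bdd_borel g"
  shows "represents0 (\<lambda>l. f l + g l) (\<lambda>x. T x + U x)"
  using assms unfolding represents0_def
  by (auto simp: symmetric_op_add inner_add_left bdd_borel_integrable linear_simps(1)[OF E_bounded_linear])

lemma represents0_scaleR:
  assumes "represents0 f T"
  shows "represents0 (\<lambda>l. c * f l) (\<lambda>x. c *\<^sub>R T x)"
  using assms unfolding represents0_def
  by (auto simp: symmetric_op_scaleR linear_simps(5)[OF E_bounded_linear])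

lemma represents_add:
  assumes "represents f T" "represents g U" "bdd_borel f" "bdd_borel g"
  shows "represents (\<lambda>l. f l + g l) (\<lambda>x. T x + U x)"
  using assms unfolding represents_def
  by (auto simp: represents0_add inner_add_left distrib_right bdd_borel_integrable bdd_borel_mult)

lemma represents_scaleR:
  assumes "represents f T"
  shows "represents (\<lambda>l. c * f l) (\<lambda>x. c *\<^sub>R T x)"
  using assms unfolding represents_def
  by (auto simp: represents0_scaleR mult.assoc)

lemma represents_zero: "represents (\<lambda>l. 0) (\<lambda>x. 0)"
  unfolding represents_def represents0_def symmetric_op_def
  by (auto simp: bounded_linear_zero linear_simps(3)[OF E_bounded_linear])

text \<open>Commutation and idempotence give <E(S) T x, x> = <T E(S) x, E(S) x>, and the measure of
  E(S) x is that of x restricted to S.\<close>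

lemma represents0_indicator_mult:
  assumes f: "represents0 f T" "bdd_borel f" and S: "S \<in> sets borel"
  shows "represents0 (\<lambda>l. f l * indicator S l) (\<lambda>x. E S (T x))"
proof -
  have T: "bounded_linear T" "\<And>x y. inner (T x) y = inner x (T y)"
    and com: "\<And>R x. R \<in> sets borel \<Longrightarrow> T (E R x) = E R (T x)"
    and diag: "\<And>x. inner (T x) x = (LINT l|\<mu>\<^sub>x x. f l)"
    using f by (auto simp: represents0_def symmetric_op_def)
  have "symmetric_op (\<lambda>x. E S (T x))"
    unfolding symmetric_op_def
    using bounded_linear_compose[OF E_bounded_linear[OF S] T(1)] by (simp add: E_sym[OF S] T(2) com[OF S])
  moreover have "inner (E S (T x)) x = (LINT l|\<mu>\<^sub>x x. f l * indicator S l)" for x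
  proof -
    have "inner (E S (T x)) x = inner (T (E S x)) (E S x)"
      by (metis E_idem E_sym S com)
    then show ?thesis using integral_dist_E[OF S bdd_borel_measurable[OF f(2)]] diag by simp
  qed
  ultimately show ?thesis
    by (auto simp: represents0_def com E_commute S)
qed

lemma represents_indicator:
  assumes S: "S \<in> sets borel"
  shows "represents (indicator S) (E S)"
  unfolding represents_def
proof (intro conjI allI impI)
  show "represents0 (indicator S) (E S)"
    unfolding represents0_def
    by (auto simp: E_symmetric_op S E_commute inner_E measure_dist)
  fix g U x assume "bdd_borel g" "represents0 g U"
  from represents0_indicator_mult[OF this(2,1) S]
  show "inner (E S (U x)) x = (LINT l|\<mu>\<^sub>x x. indicator S l * g l)"
    by (auto simp: represents0_def mult.commute)
qed

text \<open>The measure of x has total mass |x|^2, so the quadratic form is at most C |x|^2 in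
  modulus, and symmetry turns this into a norm bound.\<close>

lemma represents0_norm_le:
  assumes "represents0 f T" "\<And>l. \<bar>f l\<bar> \<le> C" "f \<in> borel_measurable borel"
  shows "norm (T x) \<le> C * norm x"
proof (rule symmetric_op_norm_le)
  show "symmetric_op T" using assms by (simp add: represents0_def)
  show "0 \<le> C" using assms(2)[of 0] by linarith
  fix x
  have f: "integrable (\<mu>\<^sub>x x) f" using assms by (intro bdd_borel_integrable) (auto simp: bdd_borel_def)
  have "\<bar>LINT l|\<mu>\<^sub>x x. f l\<bar> \<le> (LINT l|\<mu>\<^sub>x x. \<bar>f l\<bar>)" by (rule integral_abs_bound)
  also have "\<dots> \<le> (LINT l|\<mu>\<^sub>x x. C)"
    using assms f finite_measure.integrable_const[OF finite_dist] by (intro integral_mono) auto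
  also have "\<dots> = C * (norm x)\<^sup>2" using measure_dist[of UNIV x] by (simp add: E_UNIV)
  finally show "\<bar>inner (T x) x\<bar> \<le> C * (norm x)\<^sup>2" using assms(1) by (simp add: represents0_def)
qed

text \<open>\<open>represents0_norm_le\<close> applied to differences makes T k x a Cauchy sequence;
  the integral identities pass to the limit by dominated convergence for a finite measure.\<close>

lemma represents_limit:
  assumes rep: "\<And>k. represents (f k) (T k)"
    and meas: "\<And>k. f k \<in> borel_measurable borel" "f0 \<in> borel_measurable borel"
    and bnd: "\<And>k l. \<bar>f k l\<bar> \<le> C" "\<And>l. \<bar>f0 l\<bar> \<le> C"
    and conv: "\<And>k l. \<bar>f k l - f0 l\<bar> \<le> 1 / real (Suc k)"
  shows "\<exists>T0. represents f0 T0"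
proof -
  have bb: "bdd_borel (f k)" "bdd_borel f0" for k using meas bnd by (auto simp: bdd_borel_def)
  have r0: "represents0 (f k) (T k)" for k using rep by (simp add: represents_def)
  have bl: "bounded_linear (T k)" and sym: "inner (T k x) y = inner x (T k y)"
    and com: "S \<in> sets borel \<Longrightarrow> T k (E S x) = E S (T k x)" for k x y S
    using r0[of k] by (auto simp: represents0_def symmetric_op_def)
  have diff: "norm (T k x - T j x) \<le> (1 / real (Suc k) + 1 / real (Suc j)) * norm x" for k j x
  proof -
    have "represents0 (\<lambda>l. f k l + (-1) * f j l) (\<lambda>x. T k x + (-1) *\<^sub>R T j x)"
      by (intro represents0_add represents0_scaleR r0 bb bdd_borel_cmult)
    moreover have "\<bar>f k l + (-1) * f j l\<bar> \<le> 1 / real (Suc k) + 1 / real (Suc j)" for l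
      using conv[of k l] conv[of j l] by linarith
    ultimately have "norm (T k x + (-1) *\<^sub>R T j x) \<le> (1 / real (Suc k) + 1 / real (Suc j)) * norm x"
      by (rule represents0_norm_le) (use meas in auto)
    then show ?thesis by simp
  qed
  have "Cauchy (\<lambda>k. T k x)" for x
  proof (rule CauchyI)
    fix e :: real assume e: "e > 0"
    obtain N where N: "2 * norm x / e < real N" using reals_Archimedean2 by blast
    have "norm (T k x - T j x) < e" if "k \<ge> N" "j \<ge> N" for k j
    proof -
      have "norm (T k x - T j x) \<le> (1 / real (Suc k) + 1 / real (Suc j)) * norm x" by (rule diff)
      also have "\<dots> \<le> (1 / real (Suc N) + 1 / real (Suc N)) * norm x"
        using that by (intro mult_right_mono add_mono divide_left_mono) auto
      also have "\<dots> = 2 * norm x / real (Suc N)" by simp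
      also have "\<dots> < e"
        using N e by (simp add: field_simps)
      finally show ?thesis .
    qed
    then show "\<exists>M. \<forall>m\<ge>M. \<forall>n\<ge>M. norm (T m x - T n x) < e" by blast
  qed
  then have "\<forall>x. \<exists>y. (\<lambda>k. T k x) \<longlonglongrightarrow> y" using Cauchy_convergent convergent_def by blast
  then obtain T0 where T0: "\<And>x. (\<lambda>k. T k x) \<longlonglongrightarrow> T0 x" by metis
  have "symmetric_op T0"
    unfolding symmetric_op_def
  proof (intro conjI allI)
    show "bounded_linear T0"
    proof (rule bounded_linear_intro[of _ C])
      fix x y r
      have "(\<lambda>k. T k x + T k y) \<longlonglongrightarrow> T0 (x + y)" using T0[of "x + y"] by (simp add: linear_simps(1)[OF bl])
      then show "T0 (x + y) = T0 x + T0 y"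
        using LIMSEQ_unique tendsto_add[OF T0[of x] T0[of y]] by blast
      have "(\<lambda>k. r *\<^sub>R T k x) \<longlonglongrightarrow> T0 (r *\<^sub>R x)" using T0[of "r *\<^sub>R x"] by (simp add: linear_simps(5)[OF bl])
      then show "T0 (r *\<^sub>R x) = r *\<^sub>R T0 x"
        using LIMSEQ_unique tendsto_scaleR[OF tendsto_const T0[of x]] by blast
      have "norm (T k x) \<le> C * norm x" for k
        using represents0_norm_le[OF r0 bnd(1) meas(1)] .
      then show "norm (T0 x) \<le> norm x * C"
        by (intro tendsto_upperbound[OF tendsto_norm[OF T0]]) (auto simp: mult.commute)
    qed
    fix x y
    have "(\<lambda>k. inner (T k x) y) \<longlonglongrightarrow> inner (T0 x) y" by (intro tendsto_intros T0)
    moreover have "(\<lambda>k. inner (T k x) y) \<longlonglongrightarrow> inner x (T0 y)" unfolding sym by (intro tendsto_intros T0)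
    ultimately show "inner (T0 x) y = inner x (T0 y)" by (rule LIMSEQ_unique)
  qed
  moreover have "T0 (E S x) = E S (T0 x)" if "S \<in> sets borel" for S x
  proof -
    have "(\<lambda>k. E S (T k x)) \<longlonglongrightarrow> E S (T0 x)"
      by (rule bounded_linear.tendsto[OF E_bounded_linear[OF that] T0])
    then show ?thesis using T0[of "E S x"] LIMSEQ_unique by (simp add: com[OF that]) 
  qed
  moreover have lim: "(\<lambda>k. LINT l|\<mu>\<^sub>x x. f k l * g l) \<longlonglongrightarrow> (LINT l|\<mu>\<^sub>x x. f0 l * g l)"
    if g: "bdd_borel g" for g x
  proof -
    obtain D where D: "\<And>l. \<bar>g l\<bar> \<le> D" using g by (auto simp: bdd_borel_def)
    have conv': "(\<lambda>k. f k l) \<longlonglongrightarrow> f0 l" for l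
    proof (rule LIMSEQ_I)
      fix r :: real assume "r > 0"
      then obtain N where N: "1 / real (Suc N) < r" using nat_approx_posE by blast
      have "norm (f k l - f0 l) < r" if "k \<ge> N" for k
      proof -
        have "1 / real (Suc k) \<le> 1 / real (Suc N)" using that by (intro divide_left_mono) auto
        then show ?thesis using conv[of k l] N by simp
      qed
      then show "\<exists>no. \<forall>n\<ge>no. norm (f n l - f0 l) < r" by blast
    qed
    show ?thesis
    proof (rule integral_dominated_convergence[where w = "\<lambda>_. C * D"])
      have C: "0 \<le> C" using bnd(2)[of 0] by linarith
      show "integrable (\<mu>\<^sub>x x) (\<lambda>_. C * D)" by (rule finite_measure.integrable_const[OF finite_dist])
      show "AE l in \<mu>\<^sub>x x. (\<lambda>k. f k l * g l) \<longlonglongrightarrow> f0 l * g l"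
        by (intro AE_I2 tendsto_mult conv' tendsto_const)
      show "AE l in \<mu>\<^sub>x x. norm (f k l * g l) \<le> C * D" for k
        using bnd D C by (intro AE_I2) (auto simp: abs_mult intro!: mult_mono)
    qed (use meas bdd_borel_measurable[OF g] in auto)
  qed
  moreover have "inner (T0 x) x = (LINT l|\<mu>\<^sub>x x. f0 l)" for x
  proof -
    have one: "bdd_borel (\<lambda>_. 1)" by (rule bdd_borel_const)
    have "(\<lambda>k. inner (T k x) x) \<longlonglongrightarrow> inner (T0 x) x" by (intro tendsto_intros T0)
    moreover have "inner (T k x) x = (LINT l|\<mu>\<^sub>x x. f k l)" for k using r0 by (simp add: represents0_def)
    moreover have "(\<lambda>k. LINT l|\<mu>\<^sub>x x. f k l) \<longlonglongrightarrow> (LINT l|\<mu>\<^sub>x x. f0 l)"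
      using lim[OF one, of x] by simp
    ultimately show ?thesis using LIMSEQ_unique by simp
  qed
  moreover have "inner (T0 (U x)) x = (LINT l|\<mu>\<^sub>x x. f0 l * g l)"
    if "bdd_borel g" "represents0 g U" for g U x
  proof -
    have "(\<lambda>k. inner (T k (U x)) x) \<longlonglongrightarrow> inner (T0 (U x)) x" by (intro tendsto_intros T0)
    moreover have "inner (T k (U x)) x = (LINT l|\<mu>\<^sub>x x. f k l * g l)" for k
      using rep that by (simp add: represents_def)
    ultimately show ?thesis using LIMSEQ_unique[OF _ lim[OF that(1), of x]] by simp
  qed
  ultimately have "represents f0 T0" by (auto simp: represents_def represents0_def)
  then show ?thesis by blast
qed

lemma represents_sum:
  assumes "finite I" "\<And>i. i \<in> I \<Longrightarrow> S i \<in> sets borel"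
  shows "represents (\<lambda>l. \<Sum>i\<in>I. c i * indicator (S i) l) (\<lambda>x. \<Sum>i\<in>I. c i *\<^sub>R E (S i) x) \<and>
    bdd_borel (\<lambda>l. \<Sum>i\<in>I. c i * indicator (S i) l)"
  using assms
proof (induction I rule: finite_induct)
  case empty
  show ?case by (simp add: represents_zero bdd_borel_const)
next
  case (insert i I)
  have i: "represents (\<lambda>l. c i * indicator (S i) l) (\<lambda>x. c i *\<^sub>R E (S i) x)"
    "bdd_borel (\<lambda>l. c i * indicator (S i) l)"
    using insert.prems by (auto intro!: represents_scaleR represents_indicator bdd_borel_cmult bdd_borel_indicator)
  have I: "represents (\<lambda>l. \<Sum>i\<in>I. c i * indicator (S i) l) (\<lambda>x. \<Sum>i\<in>I. c i *\<^sub>R E (S i) x)"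
    "bdd_borel (\<lambda>l. \<Sum>i\<in>I. c i * indicator (S i) l)"
    using insert by auto
  show ?case
    using represents_add[OF i(1) I(1) i(2) I(2)] bdd_borel_add[OF i(2) I(2)] insert.hyps
    by (simp add: sum.insert del: sum_mult_indicator)
qed

lemma represents_ex:
  assumes f: "bdd_borel f"
  shows "\<exists>T. represents f T"
proof -
  obtain C where C: "\<And>l. \<bar>f l\<bar> \<le> C" and meas: "f \<in> borel_measurable borel"
    using f by (auto simp: bdd_borel_def)
  \<comment> \<open>Rounding down to multiples of 1 / (k + 1) gives a function at distance at most 1
    / (k + 1) from f which takes finitely many values, since f is bounded.\<close>
  define fk where "fk k l = real_of_int \<lfloor>real (Suc k) * f l\<rfloor> / real (Suc k)" for k l
  define S where "S k j = {l. real_of_int \<lfloor>real (Suc k) * f l\<rfloor> = real_of_int j}" for k j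
  have S: "S k j \<in> sets borel" for k j
  proof -
    have "{l \<in> space borel. real_of_int \<lfloor>real (Suc k) * f l\<rfloor> = real_of_int j} \<in> sets borel"
      using meas by (intro borel_measurable_eq) auto
    then show ?thesis by (simp add: S_def)
  qed
  define I where "I k = {- \<lceil>real (Suc k) * C\<rceil> - 1 .. \<lceil>real (Suc k) * C\<rceil>}" for k
  have fk_sum: "fk k l = (\<Sum>j\<in>I k. real_of_int j / real (Suc k) * indicator (S k j) l)" for k l
  proof -
    define j0 where "j0 = \<lfloor>real (Suc k) * f l\<rfloor>"
    have "\<bar>real (Suc k) * f l\<bar> \<le> real (Suc k) * C"
      unfolding abs_mult using C by (intro mult_mono) auto
    then have "real (Suc k) * f l \<le> real (Suc k) * C" "- (real (Suc k) * C) \<le> real (Suc k) * f l"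
      by linarith+
    then have "j0 \<in> I k" unfolding j0_def I_def atLeastAtMost_iff by linarith
    then have "(\<Sum>j\<in>I k. real_of_int j / real (Suc k) * indicator (S k j) l) =
       (\<Sum>j\<in>I k. if j = j0 then real_of_int j / real (Suc k) else 0)"
      by (intro sum.cong) (auto simp: S_def j0_def indicator_def)
    also have "\<dots> = real_of_int j0 / real (Suc k)" using \<open>j0 \<in> I k\<close> by (simp add: I_def)
    finally show ?thesis by (simp add: fk_def j0_def)
  qed
  have rep: "represents (fk k) (\<lambda>x. \<Sum>j\<in>I k. (real_of_int j / real (Suc k)) *\<^sub>R E (S k j) x)" for k
  proof -
    have "fk k = (\<lambda>l. \<Sum>j\<in>I k. real_of_int j / real (Suc k) * indicator (S k j) l)"
      using fk_sum by auto
    then show ?thesis using represents_sum[of "I k" "S k" "\<lambda>j. real_of_int j / real (Suc k)"] S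
      by (simp add: I_def)
  qed
  have conv: "\<bar>fk k l - f l\<bar> \<le> 1 / real (Suc k)" for k l
  proof -
    have "fk k l - f l = (real_of_int \<lfloor>real (Suc k) * f l\<rfloor> - real (Suc k) * f l) / real (Suc k)"
      by (simp add: fk_def field_simps)
    moreover have "\<bar>real_of_int \<lfloor>real (Suc k) * f l\<rfloor> - real (Suc k) * f l\<bar> \<le> 1" by linarith
    ultimately show ?thesis by (simp add: abs_divide divide_right_mono)
  qed
  have bnd: "\<bar>fk k l\<bar> \<le> C + 1" "\<bar>f l\<bar> \<le> C + 1" for k l
  proof -
    have "1 / real (Suc k) \<le> 1" by simp
    then show "\<bar>fk k l\<bar> \<le> C + 1" using conv[of k l] C[of l] by linarith
    show "\<bar>f l\<bar> \<le> C + 1" using C[of l] by linarith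
  qed
  have "fk k \<in> borel_measurable borel" for k unfolding fk_def using meas by measurable
  from represents_limit[OF rep this meas bnd conv] show ?thesis .
qed

definition opf :: "(real \<Rightarrow> real) \<Rightarrow> 'h \<Rightarrow> 'h" where
  "opf f = (SOME T. represents f T)"

lemma opf: "bdd_borel f \<Longrightarrow> represents f (opf f)"
  unfolding opf_def using represents_ex by (rule someI_ex)

lemma opf_symmetric: "bdd_borel f \<Longrightarrow> symmetric_op (opf f)"
  and opf_inner: "bdd_borel f \<Longrightarrow> inner (opf f x) x = (LINT l|\<mu>\<^sub>x x. f l)"
  and opf_opf_inner: "bdd_borel f \<Longrightarrow> bdd_borel g \<Longrightarrow> inner (opf f (opf g x)) x = (LINT l|\<mu>\<^sub>x x. f l * g l)"
  and opf_E_commute: "bdd_borel f \<Longrightarrow> S \<in> sets borel \<Longrightarrow> opf f (E S x) = E S (opf f x)"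
  using opf[of f] opf[of g] by (auto simp: represents_def represents0_def)

lemma opf_bounded_linear: "bdd_borel f \<Longrightarrow> bounded_linear (opf f)"
  and opf_sym: "bdd_borel f \<Longrightarrow> inner (opf f x) y = inner x (opf f y)"
  using opf_symmetric by (auto simp: symmetric_op_def)

lemma opf_norm: "bdd_borel f \<Longrightarrow> (norm (opf f x))\<^sup>2 = (LINT l|\<mu>\<^sub>x x. (f l)\<^sup>2)"
  using opf_opf_inner[of f f x] opf_sym[of f "opf f x" x]
  by (simp add: dot_square_norm power2_eq_square)

text \<open>A symmetric operator is determined by its quadratic form; this is how products of
  truncated operators such as \<open>B n (B n x)\<close> are identified later.\<close>

lemma opf_eqI:
  assumes "bdd_borel f" "symmetric_op T" "\<And>x. inner (T x) x = (LINT l|\<mu>\<^sub>x x. f l)"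
  shows "T x = opf f x"
  by (rule symmetric_op_eqI[of T "opf f"]) (simp_all only: assms opf_symmetric[OF assms(1)] opf_inner[OF assms(1)])

lemma E_opf:
  assumes f: "bdd_borel f" and S: "S \<in> sets borel"
  shows "E S (opf f x) = opf (\<lambda>l. f l * indicator S l) x"
proof -
  have "represents0 (\<lambda>l. f l * indicator S l) (\<lambda>x. E S (opf f x))"
    using opf[OF f] f S by (intro represents0_indicator_mult) (auto simp: represents_def)
  then show ?thesis
    using f S
    by (intro opf_eqI[where T = "\<lambda>x. E S (opf f x)"] bdd_borel_mult bdd_borel_indicator)
      (auto simp: represents0_def)
qed

end

section \<open>Exhaustions of the spectrum and unbounded functions\<close>

context pvm
begin

text \<open>The squared distance of x from its projection is |x|^2 minus the measure of S n, which
  tends to 0 by continuity of the finite measure of x.\<close>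

lemma E_incseq_tendsto:
  assumes S: "range S \<subseteq> sets borel" "incseq S" and full: "E (\<Union>n. S n) x = x"
  shows "(\<lambda>n. E (S n) x) \<longlonglongrightarrow> x"
proof -
  have Sn: "S n \<in> sets borel" for n using S by auto
  have U: "(\<Union>n. S n) \<in> sets borel" using Sn by auto
  have "(\<lambda>n. measure (\<mu>\<^sub>x x) (S n)) \<longlonglongrightarrow> measure (\<mu>\<^sub>x x) (\<Union>n. S n)"
    using S by (intro finite_measure.finite_Lim_measure_incseq[OF finite_dist]) auto
  then have "(\<lambda>n. (norm (E (S n) x))\<^sup>2) \<longlonglongrightarrow> (norm x)\<^sup>2"
    by (simp add: measure_dist Sn U full)
  from tendsto_diff[OF tendsto_const this]
  have "(\<lambda>n. (norm x)\<^sup>2 - (norm (E (S n) x))\<^sup>2) \<longlonglongrightarrow> (norm x)\<^sup>2 - (norm x)\<^sup>2" .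
  then have "(\<lambda>n. (norm (x - E (S n) x))\<^sup>2) \<longlonglongrightarrow> 0"
    by (simp add: norm_diff_E[OF Sn])
  then have "(\<lambda>n. sqrt ((norm (x - E (S n) x))\<^sup>2)) \<longlonglongrightarrow> sqrt 0"
    by (rule tendsto_real_sqrt)
  then have "(\<lambda>n. x - E (S n) x) \<longlonglongrightarrow> 0"
    by (simp add: tendsto_norm_zero_iff)
  from tendsto_diff[OF tendsto_const[of x] this] show ?thesis by simp
qed

end

text \<open>The union of the sets S n need not be the whole line, it only has to carry E; this
  admits the intervals [\<nu>, n], on which the powers of the spectral variable behave well.\<close>

locale pvm_exhaustion = pvm E for E :: "real set \<Rightarrow> 'h::{real_inner, complete_space} \<Rightarrow> 'h" +
  fixes S :: "nat \<Rightarrow> real set" and f :: "real \<Rightarrow> real"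
  assumes S_borel: "S n \<in> sets borel" and S_inc: "incseq S"
    and S_full: "E (\<Union>n. S n) x = x"
    and f_borel: "f \<in> borel_measurable borel"
    and f_bdd: "\<exists>C. \<forall>l\<in>S n. \<bar>f l\<bar> \<le> C"
begin

definition cut :: "nat \<Rightarrow> real \<Rightarrow> real" where "cut n l = f l * indicator (S n) l"

lemma bdd_cut: "bdd_borel (cut n)"
proof -
  obtain C where C: "\<And>l. l \<in> S n \<Longrightarrow> \<bar>f l\<bar> \<le> C" using f_bdd by blast
  show ?thesis
  proof (rule bdd_borelI)
    show "cut n \<in> borel_measurable borel" unfolding cut_def[abs_def] using f_borel S_borel by measurable
    show "\<bar>cut n l\<bar> \<le> \<bar>C\<bar>" for l using C[of l] by (cases "l \<in> S n") (auto simp: cut_def)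
  qed
qed

lemma E_S_tendsto: "(\<lambda>n. E (S n) x) \<longlonglongrightarrow> x"
  using S_borel S_inc S_full by (intro E_incseq_tendsto) auto

lemma AE_in_S: "AE l in \<mu>\<^sub>x x. l \<in> (\<Union>n. S n)"
proof (rule AE_I)
  define U where "U = (\<Union>n. S n)"
  have U: "U \<in> sets borel" using S_borel unfolding U_def by auto
  then have U': "- U \<in> sets borel" by (rule borel_comp)
  have "E (- U) x = E (- U) (E U x)" by (simp add: U_def S_full)
  also have "\<dots> = E (- U \<inter> U) x" using U U' by (subst E_Int) auto
  finally have "E (- U) x = 0" by (simp add: E_empty)
  then show "emeasure (\<mu>\<^sub>x x) (- U) = 0" using U' by (subst emeasure_dist) auto
  show "- U \<in> sets (\<mu>\<^sub>x x)" using U' by simp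
  show "{l \<in> space (\<mu>\<^sub>x x). l \<notin> (\<Union>n. S n)} \<subseteq> - U" by (auto simp: U_def)
qed

lemma opf_cut_E: "S n \<subseteq> S m \<Longrightarrow> E (S n) (opf (cut m) x) = opf (cut n) x"
proof -
  assume "S n \<subseteq> S m"
  then have "(\<lambda>l. cut m l * indicator (S n) l) = cut n"
    by (auto simp: cut_def fun_eq_iff indicator_def)
  then show ?thesis using E_opf[OF bdd_cut S_borel, of n m x] by (simp only:)
qed

lemma nn_integral_cut: "ennreal ((norm (opf (cut n) x))\<^sup>2) = (\<integral>\<^sup>+ l. ennreal ((cut n l)\<^sup>2) \<partial>\<mu>\<^sub>x x)"
proof -
  have "bdd_borel (\<lambda>l. (cut n l)\<^sup>2)" unfolding power2_eq_square by (intro bdd_borel_mult bdd_cut)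
  then show ?thesis unfolding opf_norm[OF bdd_cut]
    by (intro nn_integral_eq_integral[symmetric] bdd_borel_integrable) auto
qed

text \<open>By monotone convergence, square integrability of f is boundedness of the truncated
  integrals. Questions about domains thus become uniform bounds on bounded operators.\<close>

lemma dom_iff: "x \<in> spectral_integral_dom E f \<longleftrightarrow> (\<exists>K. \<forall>n. norm (opf (cut n) x) \<le> K)"
proof
  assume "x \<in> spectral_integral_dom E f"
  then have fin: "(\<integral>\<^sup>+ l. ennreal ((f l)\<^sup>2) \<partial>\<mu>\<^sub>x x) < \<infinity>" by (simp add: spectral_integral_dom_def)
  define K where "K = enn2real (\<integral>\<^sup>+ l. ennreal ((f l)\<^sup>2) \<partial>\<mu>\<^sub>x x)"
  have "norm (opf (cut n) x) \<le> sqrt K" for n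
  proof (rule real_le_rsqrt)
    have "ennreal ((norm (opf (cut n) x))\<^sup>2) \<le> (\<integral>\<^sup>+ l. ennreal ((f l)\<^sup>2) \<partial>\<mu>\<^sub>x x)"
      unfolding nn_integral_cut
      by (intro nn_integral_mono ennreal_leI) (auto simp: cut_def indicator_def)
    also have "\<dots> = ennreal K" using fin by (simp add: K_def)
    finally show "(norm (opf (cut n) x))\<^sup>2 \<le> K" by (simp add: K_def)
  qed
  then show "\<exists>K. \<forall>n. norm (opf (cut n) x) \<le> K" by blast
next
  assume "\<exists>K. \<forall>n. norm (opf (cut n) x) \<le> K"
  then obtain K where K: "\<And>n. norm (opf (cut n) x) \<le> K" by blast
  have mono: "incseq (\<lambda>n l. ennreal ((cut n l)\<^sup>2))"
  proof (rule incseq_SucI, rule le_funI)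
    fix n l
    have "S n \<subseteq> S (Suc n)" using S_inc by (rule incseq_SucD)
    then show "ennreal ((cut n l)\<^sup>2) \<le> ennreal ((cut (Suc n) l)\<^sup>2)"
      by (auto simp: cut_def indicator_def)
  qed
  have "(\<integral>\<^sup>+ l. ennreal ((f l)\<^sup>2) \<partial>\<mu>\<^sub>x x) = (\<integral>\<^sup>+ l. (SUP n. ennreal ((cut n l)\<^sup>2)) \<partial>\<mu>\<^sub>x x)"
  proof (rule nn_integral_cong_AE)
    show "AE l in \<mu>\<^sub>x x. ennreal ((f l)\<^sup>2) = (SUP n. ennreal ((cut n l)\<^sup>2))"
      using AE_in_S[of x]
    proof eventually_elim
      case (elim l)
      then obtain n where n: "l \<in> S n" by blast
      show ?case
      proof (rule antisym)
        show "ennreal ((f l)\<^sup>2) \<le> (SUP n. ennreal ((cut n l)\<^sup>2))"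
          by (rule SUP_upper2[of n]) (auto simp: cut_def n)
        show "(SUP n. ennreal ((cut n l)\<^sup>2)) \<le> ennreal ((f l)\<^sup>2)"
          by (rule SUP_least) (auto simp: cut_def indicator_def)
      qed
    qed
  qed
  also have "\<dots> = (SUP n. \<integral>\<^sup>+ l. ennreal ((cut n l)\<^sup>2) \<partial>\<mu>\<^sub>x x)"
    using bdd_borel_measurable[OF bdd_cut] by (intro nn_integral_monotone_convergence_SUP mono) measurable
  also have "\<dots> \<le> ennreal (K\<^sup>2)"
    unfolding nn_integral_cut[symmetric]
    by (intro SUP_least ennreal_leI power_mono K) auto
  also have "\<dots> < \<infinity>" by simp
  finally show "x \<in> spectral_integral_dom E f" by (simp add: spectral_integral_dom_def)
qed

lemma dom_add:
  assumes "x \<in> spectral_integral_dom E f" "y \<in> spectral_integral_dom E f"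
  shows "x + y \<in> spectral_integral_dom E f" "x - y \<in> spectral_integral_dom E f"
proof -
  obtain K L where K: "\<And>n. norm (opf (cut n) x) \<le> K" and L: "\<And>n. norm (opf (cut n) y) \<le> L"
    using assms dom_iff by metis
  have "norm (opf (cut n) (x + y)) \<le> K + L" "norm (opf (cut n) (x - y)) \<le> K + L" for n
    using norm_triangle_ineq[of "opf (cut n) x" "opf (cut n) y"]
      norm_triangle_ineq4[of "opf (cut n) x" "opf (cut n) y"] K[of n] L[of n]
    by (auto simp: linear_simps(1,2)[OF opf_bounded_linear[OF bdd_cut]])
  then show "x + y \<in> spectral_integral_dom E f" "x - y \<in> spectral_integral_dom E f"
    unfolding dom_iff by blast+
qed

lemma E_S_dom: "E (S n) x \<in> spectral_integral_dom E f"
  unfolding dom_iff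
proof (intro exI allI)
  fix m
  have "opf (cut m) (E (S n) x) = opf (\<lambda>l. cut m l * indicator (S n) l) x"
    by (simp add: opf_E_commute bdd_cut S_borel E_opf)
  also have "(\<lambda>l. cut m l * indicator (S n) l) = (\<lambda>l. cut n l * indicator (S m) l)"
    by (auto simp: cut_def indicator_def)
  also have "opf \<dots> x = E (S m) (opf (cut n) x)"
    by (simp add: bdd_cut S_borel E_opf)
  finally show "norm (opf (cut m) (E (S n) x)) \<le> norm (opf (cut n) x)"
    using norm_E_le[OF S_borel] by simp
qed

text \<open>For n \<le> m the vector \<open>opf (cut n) x\<close> is a projection of
  \<open>opf (cut m) x\<close>, so squared norms of differences are differences of squared norms,
  and these norms are increasing and bounded.\<close>

lemma opf_cut_Cauchy:
  assumes x: "x \<in> spectral_integral_dom E f"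
  shows "Cauchy (\<lambda>n. opf (cut n) x)"
proof -
  obtain K where K: "\<And>n. norm (opf (cut n) x) \<le> K" using x dom_iff by blast
  have diff: "(norm (opf (cut m) x - opf (cut n) x))\<^sup>2 = (norm (opf (cut m) x))\<^sup>2 - (norm (opf (cut n) x))\<^sup>2"
    if "n \<le> m" for n m
    using norm_diff_E[OF S_borel, of "opf (cut m) x" n] opf_cut_E[of n m x] incseqD[OF S_inc that] by simp
  define q where "q n = (norm (opf (cut n) x))\<^sup>2" for n
  have "q n \<le> q m" if "n \<le> m" for n m 
    unfolding q_def using diff[OF that] zero_le_power2[of "norm (opf (cut m) x - opf (cut n) x)"] by linarith
  then have "incseq q" by (simp add: incseq_def)
  moreover have "q n \<le> K\<^sup>2" for n unfolding q_def using K by (intro power_mono) auto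
  ultimately have "convergent q" by (meson incseq_convergent convergent_def)
  then have cau: "Cauchy q" by (rule convergent_Cauchy)
  show ?thesis
  proof (rule CauchyI)
    fix e :: real assume e: "e > 0"
    then obtain M where M: "\<And>m n. m \<ge> M \<Longrightarrow> n \<ge> M \<Longrightarrow> norm (q m - q n) < e\<^sup>2"
      using CauchyD[OF cau, of "e\<^sup>2"] by (metis zero_less_power)
    have "norm (opf (cut m) x - opf (cut n) x) < e" if "n \<ge> M" "m \<ge> n" for m n
      using diff[OF that(2)] M[of m n] that e
      by (intro power2_less_imp_less[of _ e]) (auto simp: q_def)
    then have "norm (opf (cut m) x - opf (cut n) x) < e" if "n \<ge> M" "m \<ge> M" for m n
      using that by (metis le_cases norm_minus_commute)
    then show "\<exists>M. \<forall>m\<ge>M. \<forall>n\<ge>M. norm (opf (cut m) x - opf (cut n) x) < e" by blast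
  qed
qed

text \<open>Since |f| \<le> 1 + f^2 and the measure is finite, square integrability supplies an
  integrable majorant.\<close>

lemma inner_cut_tendsto:
  assumes "x \<in> spectral_integral_dom E f"
  shows "(\<lambda>n. inner (opf (cut n) x) x) \<longlonglongrightarrow> (LINT l|\<mu>\<^sub>x x. f l)"
  unfolding opf_inner[OF bdd_cut]
proof (rule integral_dominated_convergence[where w = "\<lambda>l. 1 + (f l)\<^sup>2"])
  have "(\<integral>\<^sup>+ l. ennreal ((f l)\<^sup>2) \<partial>\<mu>\<^sub>x x) < \<infinity>" using assms by (simp add: spectral_integral_dom_def)
  then have "integrable (\<mu>\<^sub>x x) (\<lambda>l. (f l)\<^sup>2)" using f_borel by (intro integrableI_nonneg) auto
  then show "integrable (\<mu>\<^sub>x x) (\<lambda>l. 1 + (f l)\<^sup>2)"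
    using finite_measure.integrable_const[OF finite_dist] by (intro Bochner_Integration.integrable_add) auto
  show "AE l in \<mu>\<^sub>x x. (\<lambda>n. cut n l) \<longlonglongrightarrow> f l" using AE_in_S[of x]
  proof eventually_elim
    case (elim l)
    then obtain N where N: "l \<in> S N" by blast
    have "\<forall>\<^sub>F n in sequentially. cut n l = f l"
      using eventually_ge_at_top[of N]
      by eventually_elim (use N incseqD[OF S_inc] in \<open>auto simp: cut_def indicator_def\<close>)
    then show ?case by (rule tendsto_eventually)
  qed
  show "AE l in \<mu>\<^sub>x x. norm (cut n l) \<le> 1 + (f l)\<^sup>2" for n
  proof (rule AE_I2)
    fix l
    have "2 * 1 * \<bar>f l\<bar> \<le> 1 * 1\<^sup>2 + \<bar>f l\<bar>\<^sup>2 / 1" by (rule two_mult_le_weighted) simp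
    moreover have "norm (cut n l) \<le> \<bar>f l\<bar>" by (auto simp: cut_def indicator_def)
    ultimately show "norm (cut n l) \<le> 1 + (f l)\<^sup>2" by simp
  qed
qed (use f_borel bdd_borel_measurable[OF bdd_cut] in auto)

text \<open>The limit y of the truncated integrals satisfies the defining condition of
  \<open>spectral_integral\<close> by polarization. It is the only solution: for another solution w,
  the difference w - y is orthogonal to all vectors \<open>E (S n) (w - y)\<close>, which lie in the
  domain and tend to w - y.\<close>

lemma E_spectral_integral:
  assumes x: "x \<in> spectral_integral_dom E f"
  shows "E (S n) (spectral_integral E f x) = opf (cut n) x"
proof -
  obtain y where y: "(\<lambda>n. opf (cut n) x) \<longlonglongrightarrow> y"
    using opf_cut_Cauchy[OF x] Cauchy_convergent convergent_def by blast
  have form: "inner y z = spectral_form E f x z" if z: "z \<in> spectral_integral_dom E f" for z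
  proof -
    have "(\<lambda>n. inner (opf (cut n) x) z) \<longlonglongrightarrow> inner y z" by (intro tendsto_intros y)
    moreover have "inner (opf (cut n) x) z =
        (inner (opf (cut n) (x + z)) (x + z) - inner (opf (cut n) (x - z)) (x - z)) / 4" for n
      by (rule symmetric_op_polarization[OF opf_symmetric[OF bdd_cut]])
    moreover have "(\<lambda>n. (inner (opf (cut n) (x + z)) (x + z) - inner (opf (cut n) (x - z)) (x - z)) / 4)
        \<longlonglongrightarrow> spectral_form E f x z"
      unfolding spectral_form_def using dom_add[OF x z] by (intro tendsto_intros inner_cut_tendsto) auto
    ultimately show ?thesis using LIMSEQ_unique by simp
  qed
  have "spectral_integral E f x = y"
    unfolding spectral_integral_def
  proof (rule the_equality)
    show "\<forall>z\<in>spectral_integral_dom E f. inner y z = spectral_form E f x z" using form by blast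
    fix w assume w: "\<forall>z\<in>spectral_integral_dom E f. inner w z = spectral_form E f x z"
    have "(norm (E (S n) (w - y)))\<^sup>2 = 0" for n
    proof -
      have "(norm (E (S n) (w - y)))\<^sup>2 = inner (w - y) (E (S n) (w - y))"
        using inner_E[OF S_borel, of n "w - y"] E_sym[OF S_borel] by simp
      also have "\<dots> = 0" using w form E_S_dom by (simp add: inner_diff_left)
      finally show ?thesis .
    qed
    then have "(\<lambda>n. 0) \<longlonglongrightarrow> w - y" using E_S_tendsto[of "w - y"] by simp
    then show "w = y" using LIMSEQ_unique[OF tendsto_const] by fastforce
  qed
  moreover have "(\<lambda>m. E (S n) (opf (cut m) x)) \<longlonglongrightarrow> E (S n) y"
    by (rule bounded_linear.tendsto[OF E_bounded_linear[OF S_borel] y])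
  moreover have "\<forall>\<^sub>F m in sequentially. E (S n) (opf (cut m) x) = opf (cut n) x"
    using eventually_ge_at_top[of n] by eventually_elim (rule opf_cut_E, rule incseqD[OF S_inc])
  then have "(\<lambda>m. E (S n) (opf (cut m) x)) \<longlonglongrightarrow> opf (cut n) x" by (rule tendsto_eventually)
  ultimately show ?thesis using LIMSEQ_unique by simp
qed

end

section \<open>Spectral truncations of a positive operator\<close>

text \<open>The interface to the spectral theorem: Q stands for A^(1/2) and Dh for its domain. The
  additional regularity of u0 enters separately, as a uniform bound on three or four factors
  \<open>B n\<close> applied to u0.\<close>

locale truncated_operator =
  fixes D Dh :: "'h::real_inner set" and A Q :: "'h \<Rightarrow> 'h" and \<nu> :: real and P B :: "nat \<Rightarrow> 'h \<Rightarrow> 'h"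
  assumes \<nu>_pos: "\<nu> > 0"
    and P_bl: "bounded_linear (P n)" and B_bl: "bounded_linear (B n)"
    and B_sym: "inner (B n x) y = inner x (B n y)"
    and PB: "P n (B n x) = B n x" and BP: "B n (P n x) = B n x" and PP: "P n (P n x) = P n x"
    and P_tendsto: "(\<lambda>n. P n x) \<longlonglongrightarrow> x" and P_norm: "norm (P n x) \<le> norm x"
    and B_coercive: "\<nu> * (norm (P n x))\<^sup>2 \<le> (norm (B n x))\<^sup>2"
    and PA: "x \<in> D \<Longrightarrow> P n (A x) = B n (B n x)"
    and PQ: "x \<in> Dh \<Longrightarrow> P n (Q x) = B n x"
    and Dh_iff: "x \<in> Dh \<longleftrightarrow> (\<exists>K. \<forall>n. norm (B n x) \<le> K)"
    and D_diff: "x \<in> D \<Longrightarrow> y \<in> D \<Longrightarrow> x - y \<in> D"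
    and A_diff: "x \<in> D \<Longrightarrow> y \<in> D \<Longrightarrow> A (x - y) = A x - A y"

text \<open>For a bounded part T of {..<\<nu>}, coercivity applied to E(T) x says that the integral
  of \<nu> - l over T is at most 0, although the integrand is positive there; so T is a null set for
  the measure of x.\<close>

lemma (in pvm) spectral_measure_lower_bound:
  assumes D: "D = spectral_integral_dom E (\<lambda>l. l)" and A: "\<And>x. x \<in> D \<Longrightarrow> A x = spectral_integral E (\<lambda>l. l) x"
    and coer: "\<And>x. x \<in> D \<Longrightarrow> \<nu> * (norm x)\<^sup>2 \<le> inner (A x) x"
  shows "E {..<\<nu>} x = 0"
proof -
  define S where "S = (\<lambda>n::nat. {- real n..real n})"
  have US: "(\<Union>n. S n) = UNIV"
  proof -
    have "l \<in> (\<Union>n. S n)" for l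
    proof -
      obtain n :: nat where "\<bar>l\<bar> < real n" using reals_Archimedean2 by blast
      then show ?thesis by (auto simp: S_def intro!: exI[of _ n])
    qed
    then show ?thesis by blast
  qed
  interpret pvm_exhaustion E S "\<lambda>l. l"
  proof
    fix n show "S n \<in> sets borel" by (simp add: S_def)
    show "\<exists>C. \<forall>l\<in>S n. \<bar>l\<bar> \<le> C" by (auto simp: S_def intro!: exI[of _ "real n"])
    show "incseq S" by (auto simp: S_def incseq_def)
  qed (auto simp: US E_UNIV)
  have T: "E ({..<\<nu>} \<inter> S n) x = 0" for n
  proof -
    define T where "T = {..<\<nu>} \<inter> S n"
    have Tb: "T \<in> sets borel" using S_borel by (simp add: T_def)
    define z where "z = E T x"
    have zS: "E (S n) z = z"
    proof -
      have "E (S n) z = E (S n \<inter> T) x" using Tb S_borel by (simp add: z_def E_Int)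
      also have "S n \<inter> T = T" by (auto simp: T_def)
      finally show ?thesis by (simp add: z_def)
    qed
    have zD: "z \<in> D" unfolding D using E_S_dom[of n z] zS by simp
    have bT: "bdd_borel (\<lambda>l. l * indicator T l)"
    proof (rule bdd_borelI)
      show "(\<lambda>l. l * indicator T l) \<in> borel_measurable borel" using Tb by measurable
      show "\<bar>l * indicator T l\<bar> \<le> real n" for l by (auto simp: T_def S_def indicator_def)
    qed
    note bI = bdd_borel_cmult[OF bdd_borel_indicator[OF Tb], of \<nu>]
    have "inner (A z) z = inner (A z) (E (S n) z)" by (simp add: zS)
    also have "\<dots> = inner (E (S n) (A z)) z" by (simp add: E_sym S_borel)
    also have "E (S n) (A z) = opf (cut n) z"
      using E_spectral_integral[of z n] zD D A by simp
    also have "inner \<dots> z = (LINT l|\<mu>\<^sub>x z. cut n l)" by (rule opf_inner[OF bdd_cut])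
    also have "\<dots> = (LINT l|\<mu>\<^sub>x x. cut n l * indicator T l)"
      unfolding z_def by (rule integral_dist_E[OF Tb bdd_borel_measurable[OF bdd_cut]])
    also have "(\<lambda>l. cut n l * indicator T l) = (\<lambda>l. l * indicator T l)"
      by (auto simp: cut_def T_def indicator_def)
    finally have "inner (A z) z = (LINT l|\<mu>\<^sub>x x. l * indicator T l)" .
    moreover have "\<nu> * (norm z)\<^sup>2 = (LINT l|\<mu>\<^sub>x x. \<nu> * indicator T l)"
      by (simp add: z_def measure_dist[OF Tb] del: Bochner_Integration.integral_mult_right
          add: Bochner_Integration.integral_mult_right_zero) 
    ultimately have "(LINT l|\<mu>\<^sub>x x. \<nu> * indicator T l) \<le> (LINT l|\<mu>\<^sub>x x. l * indicator T l)"
      using coer[OF zD] by linarith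
    then have "(LINT l|\<mu>\<^sub>x x. \<nu> * indicator T l - l * indicator T l) \<le> 0"
      using Bochner_Integration.integral_diff[OF bdd_borel_integrable[OF bI] bdd_borel_integrable[OF bT], of x]
      by linarith
    moreover have nonneg: "0 \<le> \<nu> * indicator T l - l * indicator T l" for l
      by (auto simp: T_def indicator_def)
    moreover have int: "integrable (\<mu>\<^sub>x x) (\<lambda>l. \<nu> * indicator T l - l * indicator T l)"
      by (intro Bochner_Integration.integrable_diff bdd_borel_integrable bT bI)
    ultimately have "(LINT l|\<mu>\<^sub>x x. \<nu> * indicator T l - l * indicator T l) = 0"
      by (intro antisym integral_nonneg) auto
    then have "AE l in \<mu>\<^sub>x x. \<nu> * indicator T l - l * indicator T l = 0"
      using integral_nonneg_eq_0_iff_AE[OF int] nonneg by simp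
    then have "AE l in \<mu>\<^sub>x x. l \<notin> T"
      by eventually_elim (auto simp: T_def indicator_def)
    then have "emeasure (\<mu>\<^sub>x x) T = 0"
      using Tb by (subst (asm) AE_iff_measurable[of T]) auto
    then show ?thesis using Tb by (simp add: emeasure_dist T_def)
  qed
  have "E (S n) (E {..<\<nu>} x) = 0" for n
    using T[of n] E_Int[of "S n" "{..<\<nu>}" x] S_borel[of n] by (simp add: Int_commute)
  then have "(\<lambda>n. 0) \<longlonglongrightarrow> E {..<\<nu>} x" using E_S_tendsto[of "E {..<\<nu>} x"] by simp
  then show ?thesis using LIMSEQ_unique[OF tendsto_const] by fastforce
qed

text \<open>On S n = [\<nu>, n] the spectral variable is positive, so its powers multiply as
  expected, and the second, third and fourth powers of \<open>B n\<close> are the truncated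
  integrals of l, l^(3/2) and l^2. By \<open>dom_iff\<close>, membership in the domains of A^(3/2)
  and A^2 then becomes a uniform bound.\<close>

lemma spectral_truncation:
  fixes E :: "real set \<Rightarrow> 'h::{real_inner, complete_space} \<Rightarrow> 'h"
  assumes sm: "is_spectral_measure D A E" and lin: "linear_operator D A" and \<nu>: "\<nu> > 0"
    and coer: "\<And>x. x \<in> D \<Longrightarrow> \<nu> * (norm x)\<^sup>2 \<le> inner (A x) x"
  obtains P B where
    "truncated_operator D (spectral_integral_dom E (\<lambda>l. l powr (1/2))) A
       (spectral_integral E (\<lambda>l. l powr (1/2))) \<nu> P B"
    "\<And>x. x \<in> spectral_integral_dom E (\<lambda>l. l powr (3/2)) \<Longrightarrow> \<exists>K. \<forall>n. norm (B n (B n (B n x))) \<le> K"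
    "\<And>x. x \<in> spectral_integral_dom E (\<lambda>l. l powr 2) \<Longrightarrow> \<exists>K. \<forall>n. norm (B n (B n (B n (B n x)))) \<le> K"
proof -
  interpret pvm E by unfold_locales (use sm in \<open>simp add: is_spectral_measure_def\<close>)
  have D: "D = spectral_integral_dom E (\<lambda>l. l)" and A: "\<And>x. x \<in> D \<Longrightarrow> A x = spectral_integral E (\<lambda>l. l) x"
    using sm by (auto simp: is_spectral_measure_def)
  have neg: "E {..<\<nu>} x = 0" for x by (rule spectral_measure_lower_bound[OF D A coer])
  define S where "S = (\<lambda>n::nat. {\<nu>..real n})"
  have US: "(\<Union>n. S n) = {\<nu>..}"
  proof -
    have "l \<in> (\<Union>n. S n)" if "\<nu> \<le> l" for l
    proof -
      obtain n :: nat where "l < real n" using reals_Archimedean2 by blast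
      then show ?thesis using that by (auto simp: S_def intro!: exI[of _ n])
    qed
    then show ?thesis by (auto simp: S_def)
  qed
  have full: "E (\<Union>n. S n) x = x" for x
  proof -
    \<comment> \<open>As {..<\<nu>} carries no mass, all of |x|^2 sits on {\<nu>..}.\<close>
    have "(norm (E {..<\<nu>} x))\<^sup>2 + (norm (E {\<nu>..} x))\<^sup>2 = measure (\<mu>\<^sub>x x) ({..<\<nu>} \<union> {\<nu>..})"
      by (subst finite_measure.finite_measure_Union[OF finite_dist]) (auto simp: measure_dist)
    also have "{..<\<nu>} \<union> {\<nu>..} = UNIV" by auto
    also have "measure (\<mu>\<^sub>x x) UNIV = (norm x)\<^sup>2" by (simp add: measure_dist E_UNIV)
    finally have "(norm (x - E {\<nu>..} x))\<^sup>2 = 0" by (simp add: neg norm_diff_E)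
    then show ?thesis by (simp add: US)
  qed
  have Sb: "S n \<in> sets borel" for n by (simp add: S_def)
  have S_inc: "incseq S" by (auto simp: S_def incseq_def)
  have powr_ex: "pvm_exhaustion E S (\<lambda>l. l powr r)" if "r \<ge> 0" for r
  proof
    show "\<exists>C. \<forall>l\<in>S n. \<bar>l powr r\<bar> \<le> C" for n
      using that \<nu> by (auto simp: S_def intro!: exI[of _ "real n powr r"] powr_mono2)
  qed (use S_inc full in \<open>auto simp: S_def\<close>)
  interpret sq: pvm_exhaustion E S "\<lambda>l. l powr (1/2)" by (rule powr_ex) simp
  interpret th: pvm_exhaustion E S "\<lambda>l. l powr (3/2)" by (rule powr_ex) simp
  interpret tw: pvm_exhaustion E S "\<lambda>l. l powr 2" by (rule powr_ex) simp
  interpret i: pvm_exhaustion E S "\<lambda>l. l"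
  proof
    show "\<exists>C. \<forall>l\<in>S n. \<bar>l\<bar> \<le> C" for n
      using \<nu> by (auto simp: S_def intro!: exI[of _ "real n"])
  qed (use S_inc full in \<open>auto simp: S_def\<close>)
  define B where "B = (\<lambda>n. opf (sq.cut n))"
  define C where "C = (\<lambda>n. opf (i.cut n))"
  have Bsym: "symmetric_op (B n)" and Csym: "symmetric_op (C n)" for n
    by (auto simp: B_def C_def opf_symmetric sq.bdd_cut i.bdd_cut)
  have Bs: "inner (B n x) y = inner x (B n y)" and Cs: "inner (C n x) y = inner x (C n y)"
    and Bbl: "bounded_linear (B n)" for n x y
    using Bsym[of n] Csym[of n] by (auto simp: symmetric_op_def)
  have sqcut2: "(sq.cut n l)\<^sup>2 = i.cut n l" for n l
  proof (cases "l \<in> S n")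
    case True
    then have "l > 0" using \<nu> by (auto simp: S_def)
    then have "l powr (1/2) * l powr (1/2) = l powr (1/2 + 1/2)" by (simp only: powr_add)
    then show ?thesis using True \<open>l > 0\<close> by (simp add: sq.cut_def i.cut_def power2_eq_square)
  qed (simp add: sq.cut_def i.cut_def)
  have cut3: "sq.cut n l * i.cut n l = th.cut n l" for n l
  proof (cases "l \<in> S n")
    case True
    then have "l > 0" using \<nu> by (auto simp: S_def)
    then have "l powr (1/2) * l = l powr (1/2 + 1)" by (simp only: powr_add) simp
    then show ?thesis using True by (simp add: sq.cut_def i.cut_def th.cut_def)
  qed (simp add: sq.cut_def i.cut_def th.cut_def)
  have cut4: "(i.cut n l)\<^sup>2 = tw.cut n l" for n l
  proof (cases "l \<in> S n")
    case True
    then have "l > 0" using \<nu> by (auto simp: S_def)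
    then show ?thesis using True by (simp add: tw.cut_def i.cut_def powr_numeral)
  qed (simp add: tw.cut_def i.cut_def)
  have BB: "B n (B n x) = C n x" for n x
    unfolding C_def
  proof (rule opf_eqI[OF i.bdd_cut, of "\<lambda>x. B n (B n x)"])
    show "symmetric_op (\<lambda>x. B n (B n x))"
      using Bsym[of n] unfolding symmetric_op_def by (auto intro: bounded_linear_compose)
    fix x show "inner (B n (B n x)) x = (LINT l|\<mu>\<^sub>x x. i.cut n l)"
      using sqcut2[of n] by (simp add: B_def opf_opf_inner sq.bdd_cut power2_eq_square)
  qed
  have B3: "B n (B n (B n x)) = opf (th.cut n) x" for n x
  proof (rule opf_eqI[OF th.bdd_cut, of "\<lambda>x. B n (B n (B n x))"])
    show "symmetric_op (\<lambda>x. B n (B n (B n x)))"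
      using Bbl[of n] Bs[of n] unfolding symmetric_op_def by (auto intro!: bounded_linear_compose[of "B n"])
    fix x
    have "inner (B n (B n (B n x))) x = inner (opf (sq.cut n) (opf (i.cut n) x)) x"
      using BB[of n x] by (simp add: B_def C_def)
    also have "\<dots> = (LINT l|\<mu>\<^sub>x x. th.cut n l)"
      by (simp add: opf_opf_inner sq.bdd_cut i.bdd_cut cut3)
    finally show "inner (B n (B n (B n x))) x = (LINT l|\<mu>\<^sub>x x. th.cut n l)" .
  qed
  have B4: "B n (B n (B n (B n x))) = opf (tw.cut n) x" for n x
    unfolding BB
  proof (rule opf_eqI[OF tw.bdd_cut, of "\<lambda>x. C n (C n x)"])
    show "symmetric_op (\<lambda>x. C n (C n x))"
      using Csym[of n] unfolding symmetric_op_def by (auto intro: bounded_linear_compose)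
    fix x show "inner (C n (C n x)) x = (LINT l|\<mu>\<^sub>x x. tw.cut n l)"
      using cut4[of n] by (simp add: C_def opf_opf_inner i.bdd_cut power2_eq_square)
  qed
  show ?thesis
  proof (rule that[of "\<lambda>n. E (S n)" B])
    show "\<exists>K. \<forall>n. norm (B n (B n (B n x))) \<le> K" if "x \<in> spectral_integral_dom E (\<lambda>l. l powr (3/2))" for x
      using that by (simp add: B3 th.dom_iff)
    show "\<exists>K. \<forall>n. norm (B n (B n (B n (B n x)))) \<le> K" if "x \<in> spectral_integral_dom E (\<lambda>l. l powr 2)" for x
      using that by (simp add: B4 tw.dom_iff)
    show "truncated_operator D (spectral_integral_dom E (\<lambda>l. l powr (1/2))) A
       (spectral_integral E (\<lambda>l. l powr (1/2))) \<nu> (\<lambda>n. E (S n)) B"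
    proof (rule truncated_operator.intro)
      show "E (S n) (B n x) = B n x" for n x unfolding B_def by (rule sq.opf_cut_E) simp
      then show "B n (E (S n) x) = B n x" for n x
        unfolding B_def by (simp add: opf_E_commute sq.bdd_cut Sb)
      show "\<nu> * (norm (E (S n) x))\<^sup>2 \<le> (norm (B n x))\<^sup>2" for n x
      proof -
        have "\<nu> * (norm (E (S n) x))\<^sup>2 = \<nu> * (LINT l|\<mu>\<^sub>x x. indicator (S n) l)"
          by (simp add: measure_dist Sb)
        also have "\<dots> = (LINT l|\<mu>\<^sub>x x. \<nu> * indicator (S n) l)" by simp
        also have "\<dots> \<le> (LINT l|\<mu>\<^sub>x x. i.cut n l)"
        proof (rule integral_mono)
          show "integrable (\<mu>\<^sub>x x) (\<lambda>l. \<nu> * indicator (S n) l)"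
            by (intro bdd_borel_integrable bdd_borel_cmult bdd_borel_indicator Sb)
          show "integrable (\<mu>\<^sub>x x) (i.cut n)" by (intro bdd_borel_integrable i.bdd_cut)
          show "\<nu> * indicator (S n) l \<le> i.cut n l" for l
            unfolding i.cut_def by (cases "l \<in> S n") (simp_all, simp add: S_def)
        qed
        also have "\<dots> = (norm (B n x))\<^sup>2" by (simp add: B_def opf_norm sq.bdd_cut sqcut2)
        finally show ?thesis .
      qed
      show "E (S n) (A x) = B n (B n x)" if "x \<in> D" for n x
        unfolding BB C_def A[OF that] using that D by (intro i.E_spectral_integral) simp
      show "E (S n) (spectral_integral E (\<lambda>l. l powr (1/2)) x) = B n x"
        if "x \<in> spectral_integral_dom E (\<lambda>l. l powr (1/2))" for n x
        unfolding B_def using that by (intro sq.E_spectral_integral)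
      show "(x \<in> spectral_integral_dom E (\<lambda>l. l powr (1/2))) = (\<exists>K. \<forall>n. norm (B n x) \<le> K)" for x
        unfolding B_def by (rule sq.dom_iff)
      show "x - y \<in> D" if "x \<in> D" "y \<in> D" for x y
        using that lin by (auto simp: linear_operator_def intro: subspace_diff)
      show "A (x - y) = A x - A y" if "x \<in> D" "y \<in> D" for x y
      proof -
        have sub: "subspace D" and add: "\<And>x y. x \<in> D \<Longrightarrow> y \<in> D \<Longrightarrow> A (x + y) = A x + A y"
          and sc: "\<And>x c. x \<in> D \<Longrightarrow> A (c *\<^sub>R x) = c *\<^sub>R A x"
          using lin by (auto simp: linear_operator_def)
        have "A (x + (-1) *\<^sub>R y) = A x + A ((-1) *\<^sub>R y)"
          using that sub by (intro add subspace_scale)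
        also have "A ((-1) *\<^sub>R y) = (-1) *\<^sub>R A y" using that by (intro sc)
        finally have "A (x + (-1) *\<^sub>R y) = A x + (-1) *\<^sub>R A y" .
        then show ?thesis by simp
      qed
    qed (use \<nu> Bs Bbl in \<open>auto simp: Sb E_bounded_linear E_idem norm_E_le intro: sq.E_S_tendsto\<close>)
  qed
qed

section \<open>Limits of the truncations and admissible operators\<close>

context truncated_operator
begin

lemma B_tendsto: "x \<in> Dh \<Longrightarrow> (\<lambda>n. B n x) \<longlonglongrightarrow> Q x"
  using P_tendsto[of "Q x"] by (simp add: PQ)

lemma BB_tendsto: "x \<in> D \<Longrightarrow> (\<lambda>n. B n (B n x)) \<longlonglongrightarrow> A x"
  using P_tendsto[of "A x"] by (simp add: PA)

lemma norm_B_le: "x \<in> Dh \<Longrightarrow> norm (B n x) \<le> norm (Q x)"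
  using P_norm[of n "Q x"] by (simp add: PQ)

lemma norm_BB_le: "x \<in> D \<Longrightarrow> norm (B n (B n x)) \<le> norm (A x)"
  using P_norm[of n "A x"] by (simp add: PA)

text \<open>Symmetry of \<open>B n\<close> gives |B n x|^2 = <B n (B n x), x> \<le> |A x| |x|,
  uniformly in n.\<close>

lemma D_imp_Dh: "x \<in> D \<Longrightarrow> x \<in> Dh"
  unfolding Dh_iff
proof (intro exI allI)
  fix n assume "x \<in> D"
  have "(norm (B n x))\<^sup>2 = inner (B n (B n x)) x" by (simp add: B_sym dot_square_norm)
  also have "\<dots> \<le> norm (B n (B n x)) * norm x" by (rule norm_cauchy_schwarz)
  also have "\<dots> \<le> norm (A x) * norm x" using norm_BB_le[OF \<open>x \<in> D\<close>] by (intro mult_right_mono) auto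
  finally show "norm (B n x) \<le> sqrt (norm (A x) * norm x)" by (rule real_le_rsqrt)
qed

lemma Q_square: "x \<in> D \<Longrightarrow> (norm (Q x))\<^sup>2 = inner (A x) x"
proof -
  assume x: "x \<in> D"
  have "(\<lambda>n. inner (B n (B n x)) x) \<longlonglongrightarrow> inner (A x) x" by (intro tendsto_intros BB_tendsto x)
  moreover have "inner (B n (B n x)) x = (norm (B n x))\<^sup>2" for n by (simp add: B_sym dot_square_norm)
  moreover have "(\<lambda>n. (norm (B n x))\<^sup>2) \<longlonglongrightarrow> (norm (Q x))\<^sup>2" by (intro tendsto_intros B_tendsto D_imp_Dh x)
  ultimately show ?thesis using LIMSEQ_unique by simp
qed

lemma A_sym: "x \<in> D \<Longrightarrow> y \<in> D \<Longrightarrow> inner (A x) y = inner x (A y)"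
proof -
  assume x: "x \<in> D" and y: "y \<in> D"
  have "(\<lambda>n. inner (B n (B n x)) y) \<longlonglongrightarrow> inner (A x) y" by (intro tendsto_intros BB_tendsto x)
  moreover have "(\<lambda>n. inner (B n (B n x)) y) \<longlonglongrightarrow> inner x (A y)"
    unfolding B_sym by (intro tendsto_intros BB_tendsto y)
  ultimately show ?thesis by (rule LIMSEQ_unique)
qed

lemma Q_coercive: "x \<in> Dh \<Longrightarrow> \<nu> * (norm x)\<^sup>2 \<le> (norm (Q x))\<^sup>2"
proof (rule LIMSEQ_le)
  assume x: "x \<in> Dh"
  show "(\<lambda>n. \<nu> * (norm (P n x))\<^sup>2) \<longlonglongrightarrow> \<nu> * (norm x)\<^sup>2" by (intro tendsto_intros P_tendsto)
  show "(\<lambda>n. (norm (B n x))\<^sup>2) \<longlonglongrightarrow> (norm (Q x))\<^sup>2" by (intro tendsto_intros B_tendsto x)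
qed (use B_coercive in auto)

lemma A_coercive: "x \<in> D \<Longrightarrow> \<nu> * (norm (Q x))\<^sup>2 \<le> (norm (A x))\<^sup>2"
proof (rule LIMSEQ_le)
  assume x: "x \<in> D"
  show "(\<lambda>n. \<nu> * (norm (B n x))\<^sup>2) \<longlonglongrightarrow> \<nu> * (norm (Q x))\<^sup>2" by (intro tendsto_intros B_tendsto D_imp_Dh x)
  show "(\<lambda>n. (norm (B n (B n x)))\<^sup>2) \<longlonglongrightarrow> (norm (A x))\<^sup>2" by (intro tendsto_intros BB_tendsto x)
  have "\<nu> * (norm (B n x))\<^sup>2 \<le> (norm (B n (B n x)))\<^sup>2" for n
    using B_coercive[of n "B n x"] by (simp add: PB)
  then show "\<exists>N. \<forall>n\<ge>N. \<nu> * (norm (B n x))\<^sup>2 \<le> (norm (B n (B n x)))\<^sup>2" by blast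
qed

lemma Dh_linear:
  assumes "x \<in> Dh" "y \<in> Dh"
  shows "x + y \<in> Dh" "x - y \<in> Dh" "c *\<^sub>R x \<in> Dh"
    "Q (x + y) = Q x + Q y" "Q (x - y) = Q x - Q y" "Q (c *\<^sub>R x) = c *\<^sub>R Q x"
proof -
  note lin = linear_simps[OF B_bl]
  have nB: "norm (B n x) \<le> norm (Q x)" "norm (B n y) \<le> norm (Q y)" for n
    using assms norm_B_le by auto
  have "norm (B n (x + y)) \<le> norm (Q x) + norm (Q y)" "norm (B n (x - y)) \<le> norm (Q x) + norm (Q y)"
    "norm (B n (c *\<^sub>R x)) \<le> \<bar>c\<bar> * norm (Q x)" for n
    using nB[of n] norm_triangle_ineq[of "B n x" "B n y"] norm_triangle_ineq4[of "B n x" "B n y"]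
    by (auto simp: lin mult_left_mono)
  then show *: "x + y \<in> Dh" "x - y \<in> Dh" "c *\<^sub>R x \<in> Dh" unfolding Dh_iff by blast+
  show "Q (x + y) = Q x + Q y"
    using LIMSEQ_unique[OF B_tendsto[OF *(1)]] tendsto_add[OF B_tendsto[OF assms(1)] B_tendsto[OF assms(2)]]
    by (simp add: lin)
  show "Q (x - y) = Q x - Q y"
    using LIMSEQ_unique[OF B_tendsto[OF *(2)]] tendsto_diff[OF B_tendsto[OF assms(1)] B_tendsto[OF assms(2)]]
    by (simp add: lin)
  show "Q (c *\<^sub>R x) = c *\<^sub>R Q x"
    using LIMSEQ_unique[OF B_tendsto[OF *(3)]] tendsto_scaleR[OF tendsto_const B_tendsto[OF assms(1)]]
    by (simp add: lin)
qed

text \<open>The derivative d need not lie in the domain of Q. By symmetry of A the difference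
  quotient of |Q w|^2 is the inner product of A (w s) + A (w t) with the difference quotient of w,
  so continuity of A w and differentiability of w in H suffice.\<close>

lemma Q_square_deriv:
  fixes w :: "real \<Rightarrow> 'h"
  assumes w: "(w has_vector_derivative d) (at t within {0..})" and t: "t \<ge> 0"
    and D: "\<And>s. s \<ge> 0 \<Longrightarrow> w s \<in> D" and cont: "continuous_on {0..} (\<lambda>s::real. A (w s))"
  shows "((\<lambda>s::real. (norm (Q (w s)))\<^sup>2) has_real_derivative 2 * inner (A (w t)) d) (at t within {0..})"
  unfolding has_field_derivative_iff
proof (rule Lim_transform_eventually)
  have "((\<lambda>s::real. A (w s)) \<longlongrightarrow> A (w t)) (at t within {0..})"
    using cont t by (simp add: continuous_on_def)
  then have "((\<lambda>s::real. inner (A (w s) + A (w t)) ((1 / (s - t)) *\<^sub>R (w s - w t))) \<longlongrightarrow>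
      inner (A (w t) + A (w t)) d) (at t within {0..})"
    by (intro tendsto_intros has_vector_derivative_slope w)
  then show "((\<lambda>s::real. inner (A (w s) + A (w t)) ((1 / (s - t)) *\<^sub>R (w s - w t))) \<longlongrightarrow>
      2 * inner (A (w t)) d) (at t within {0..})"
    by (simp add: inner_add_left)
  show "\<forall>\<^sub>F s in at t within {0..}. inner (A (w s) + A (w t)) ((1 / (s - t)) *\<^sub>R (w s - w t)) =
      ((norm (Q (w s)))\<^sup>2 - (norm (Q (w t)))\<^sup>2) / (s - t)"
    unfolding eventually_at_filter
  proof (rule always_eventually, intro allI impI)
    fix s :: real assume s: "s \<in> {0..}"
    then have Ds: "w s \<in> D" "w t \<in> D" using D t by auto
    have "inner (A (w s) + A (w t)) (w s - w t) = inner (A (w s)) (w s) - inner (A (w t)) (w t)"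
      using A_sym[OF Ds]
      by (simp add: inner_add_left inner_add_right inner_diff_left inner_diff_right inner_commute)
    then show "inner (A (w s) + A (w t)) ((1 / (s - t)) *\<^sub>R (w s - w t)) =
      ((norm (Q (w s)))\<^sup>2 - (norm (Q (w t)))\<^sup>2) / (s - t)"
      by (simp add: Q_square Ds)
  qed
qed

text \<open>Modelled on P n and the powers of \<open>B n\<close>: the choice of J selects the
  regularity level at which an estimate is carried out.\<close>

definition admissible :: "nat \<Rightarrow> ('h \<Rightarrow> 'h) \<Rightarrow> bool" where
  "admissible n J \<longleftrightarrow> bounded_linear J \<and> (\<forall>x. P n (J x) = J x) \<and> (\<forall>x. J (P n x) = J x) \<and>
     (\<forall>x. J (B n x) = B n (J x))"

lemma admissible_P: "admissible n (P n)"
  by (simp add: admissible_def P_bl PP PB BP)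

lemma admissible_B_comp: "admissible n J \<Longrightarrow> admissible n (\<lambda>x. B n (J x))"
  by (auto simp: admissible_def PB intro: bounded_linear_compose[OF B_bl])

lemma admissible_B: "admissible n (B n)"
  by (simp add: admissible_def B_bl PB BP)

lemma admissible_A: "admissible n J \<Longrightarrow> x \<in> D \<Longrightarrow> J (A x) = B n (B n (J x))"
  by (metis admissible_def PA)

lemma admissible_coercive: "admissible n J \<Longrightarrow> \<nu> * (norm (J x))\<^sup>2 \<le> (norm (B n (J x)))\<^sup>2"
  by (metis admissible_def B_coercive)

end

section \<open>Decay of parabolic and hyperbolic solutions\<close>

locale kirchhoff =
  truncated_operator D "power_dom D A (1/2)" A "power_op D A (1/2)" \<nu> P B +
  weight p \<mu> \<nu> \<beta> \<omega> W a
  for D :: "'h::real_inner set" and A :: "'h \<Rightarrow> 'h" and \<nu> :: real and P B :: "nat \<Rightarrow> 'h \<Rightarrow> 'h"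
    and p \<mu> \<beta> \<omega> :: real and W a :: "real \<Rightarrow> real" +
  fixes m :: "real \<Rightarrow> real" and u0 u1 :: 'h and u :: "real \<Rightarrow> 'h" and c0 :: real
  assumes W_poly: "t \<ge> 0 \<Longrightarrow> 1 \<le> c0 * W t * (damping p t)\<^sup>2"
    and m_lower: "s \<ge> 0 \<Longrightarrow> \<mu> \<le> m s"
    and m_lip: "s \<ge> 0 \<Longrightarrow> \<exists>d>0. \<exists>L. L-lipschitz_on (cball s d \<inter> {0..}) m"
    and u0_D: "u0 \<in> D" and u1_Dh: "u1 \<in> power_dom D A (1/2)"
    and u_sol: "parabolic_solution D A m p u0 u"
begin

abbreviation "Dh \<equiv> power_dom D A (1/2)"
abbreviation "Q \<equiv> power_op D A (1/2)"

lemma u_D: "t \<ge> 0 \<Longrightarrow> u t \<in> D"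
  and u_deriv: "t \<ge> 0 \<Longrightarrow> (u has_vector_derivative dt u t) (at t within {0..})"
  and u_0: "u 0 = u0"
  and u_cont: "continuous_on {0..} u" and Au_cont: "continuous_on {0..} (\<lambda>t. A (u t))"
  and u'_cont: "continuous_on {0..} (dt u)"
  using u_sol by (auto simp: parabolic_solution_def C1_half_line_def C0_graph_def)

definition c :: "real \<Rightarrow> real" where "c t = m ((norm (Q (u t)))\<^sup>2)"

lemma b_pos: "t \<ge> 0 \<Longrightarrow> 0 < b t" and b_le_1: "t \<ge> 0 \<Longrightarrow> b t \<le> 1"
  and b_inv: "t \<ge> 0 \<Longrightarrow> 1 / b t \<le> 1 + t"
  using damping_bounds[OF p] by auto

lemma W_pos: "t \<ge> 0 \<Longrightarrow> 0 < W t"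
  using W_ge_1[of t] by simp

lemma u_eq: "t \<ge> 0 \<Longrightarrow> b t *\<^sub>R dt u t = - c t *\<^sub>R A (u t)"
  using u_sol by (simp add: parabolic_solution_def kirchhoff_term_def damping_def c_def eq_neg_iff_add_eq_0)

lemma u'_eq: "t \<ge> 0 \<Longrightarrow> dt u t = - (c t / b t) *\<^sub>R A (u t)"
proof -
  assume t: "t \<ge> 0"
  have "dt u t = (1 / b t) *\<^sub>R (b t *\<^sub>R dt u t)" using b_pos[OF t] by simp
  then show ?thesis unfolding u_eq[OF t] by simp
qed

lemma c_lower: "t \<ge> 0 \<Longrightarrow> \<mu> \<le> c t"
  by (simp add: c_def m_lower)

section \<open>Decay of the parabolic solution\<close>

lemma admissible_deriv:
  assumes "admissible n J" "(w has_vector_derivative d) (at t within S)"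
  shows "((\<lambda>s. J (w s)) has_vector_derivative J d) (at t within S)"
  using assms by (auto simp: admissible_def intro: bounded_linear.has_vector_derivative)

lemma parabolic_dissipation:
  assumes J: "admissible n J" and t: "t \<ge> 0" and l: "0 \<le> l" "l \<le> \<omega>"
  shows "dini_le (\<lambda>s. W s * (exp (l * s) * (norm (J (u s)))\<^sup>2))
    (- ((\<omega> - l) / \<nu>) * (W t * (exp (l * t) * (norm (B n (J (u t))))\<^sup>2))) t"
proof -
  have bt: "0 < b t" "b t \<le> 1" using b_pos b_le_1 t by auto
  interpret J: bounded_linear J using J by (simp add: admissible_def)
  have Ju: "((\<lambda>s. J (u s)) has_vector_derivative J (dt u t)) (at_right t)"
    by (rule admissible_deriv[OF J has_vector_derivative_right[OF u_deriv]]) (use t in auto)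
  have JA: "J (A (u t)) = B n (B n (J (u t)))" using admissible_A[OF J u_D] t by simp
  have dJ: "J (dt u t) = - (c t / b t) *\<^sub>R B n (B n (J (u t)))"
    unfolding u'_eq[OF t] J.scaleR JA ..
  define x where "x = (norm (J (u t)))\<^sup>2"
  define y where "y = (norm (B n (J (u t))))\<^sup>2"
  have xy: "\<nu> * x \<le> y" using admissible_coercive[OF J] by (simp add: x_def y_def)
  have "inner (J (u t)) (J (dt u t)) = - (c t / b t) * y"
    unfolding dJ by (simp add: y_def dot_square_norm flip: B_sym)
  then have d2: "approx_deriv (\<lambda>s. (norm (J (u s)))\<^sup>2) (- 2 * (c t / b t) * y) 0 t"
    using approx_deriv_inner[OF approx_deriv_vector[OF Ju] approx_deriv_vector[OF Ju]]
    by (simp add: dot_square_norm inner_commute mult_ac)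
  have de: "approx_deriv (\<lambda>s. exp (l * s)) (l * exp (l * t)) 0 t"
    by (rule approx_deriv_vector)
      (auto simp flip: has_real_derivative_iff_has_vector_derivative intro!: derivative_eq_intros)
  have dW: "approx_deriv W (a t * W t) 0 t"
    using W_deriv[OF t] by (intro approx_deriv_vector) (simp add: has_real_derivative_iff_has_vector_derivative)
  from approx_deriv_mult[OF dW approx_deriv_mult[OF de d2]]
  have d: "approx_deriv (\<lambda>s. W s * (exp (l * s) * (norm (J (u s)))\<^sup>2))
     (W t * exp (l * t) * ((a t + l) * x - 2 * (c t / b t) * y)) 0 t"
    by (simp add: x_def algebra_simps)
  have "(a t + l) * x - 2 * (c t / b t) * y \<le> - ((\<omega> - l) / \<nu>) * y"
  proof -
    have y: "0 \<le> y" and x: "0 \<le> x" by (auto simp: x_def y_def)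
    define k where "k = (2 * \<mu> * \<nu> - (\<omega> - l)) / b t"
    have "l * b t \<le> l" using bt l by (simp add: mult_left_le)
    then have "(a t + l) * b t \<le> 2 * \<mu> * \<nu> - (\<omega> - l)" using a(3)[OF t] by (simp add: algebra_simps)
    then have "a t + l \<le> k" using bt by (simp add: k_def field_simps)
    moreover have "x \<le> y / \<nu>" using xy \<nu>_pos by (simp add: field_simps)
    ultimately have "(a t + l) * x \<le> k * (y / \<nu>)"
      using x l a(1)[OF t] by (intro mult_mono) (auto intro: order_trans[of 0 "a t + l"])
    moreover have "2 * (\<mu> / b t) * y \<le> 2 * (c t / b t) * y"
      using c_lower[OF t] bt y by (intro mult_right_mono mult_left_mono divide_right_mono) auto
    moreover have "k * (y / \<nu>) - 2 * (\<mu> / b t) * y = - ((\<omega> - l) / \<nu> * y) * (1 / b t)"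
      using bt \<nu>_pos by (simp add: k_def field_simps)
    moreover have "- ((\<omega> - l) / \<nu> * y) * (1 / b t) \<le> - ((\<omega> - l) / \<nu> * y) * 1"
      using bt l y \<nu>_pos by (intro mult_left_mono_neg) auto
    ultimately show ?thesis by simp
  qed
  from mult_left_mono[OF this, of "W t * exp (l * t)"]
  show ?thesis
    using W_pos[OF t] by (intro dini_le_approx[OF d]) (simp add: y_def algebra_simps)
qed

lemma W_cont_nonneg: "continuous_on {0..} (\<lambda>s. W s * (exp (l * s) * (norm (J (u s)))\<^sup>2))"
  if "admissible n J"
proof -
  have "continuous_on {0..} (\<lambda>s. J (u s))"
    using that u_cont by (auto simp: admissible_def intro: bounded_linear.continuous_on)
  then show ?thesis by (intro continuous_intros W_cont)
qed

lemma parabolic_decay: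
  assumes J: "admissible n J" and t: "t \<ge> 0"
  shows "W t * (exp (\<omega> * t) * (norm (J (u t)))\<^sup>2) \<le> (norm (J u0))\<^sup>2"
proof -
  have "W t * (exp (\<omega> * t) * (norm (J (u t)))\<^sup>2) \<le> W 0 * (exp (\<omega> * 0) * (norm (J (u 0)))\<^sup>2)"
  proof (rule dini_le_nonincreasing[OF W_cont_nonneg[OF J] t])
    fix s :: real assume "0 \<le> s"
    from parabolic_dissipation[OF J this, of \<omega>]
    show "dini_le (\<lambda>s. W s * (exp (\<omega> * s) * (norm (J (u s)))\<^sup>2)) 0 s" using pos by simp
  qed
  then show ?thesis by (simp add: W_0 u_0)
qed

lemma Au_decay:
  assumes t: "t \<ge> 0"
  shows "W t * (exp (\<omega> * t) * (norm (A (u t)))\<^sup>2) \<le> (norm (A u0))\<^sup>2"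
proof (rule LIMSEQ_le_const2)
  show "(\<lambda>n. W t * (exp (\<omega> * t) * (norm (B n (B n (u t))))\<^sup>2)) \<longlonglongrightarrow> W t * (exp (\<omega> * t) * (norm (A (u t)))\<^sup>2)"
    by (intro tendsto_intros BB_tendsto u_D t)
  have "W t * (exp (\<omega> * t) * (norm (B n (B n (u t))))\<^sup>2) \<le> (norm (A u0))\<^sup>2" for n
    by (rule order_trans[OF parabolic_decay[OF admissible_B_comp[OF admissible_B] t]
        power_mono[OF norm_BB_le[OF u0_D]]]) simp
  then show "\<exists>N. \<forall>n\<ge>N. W t * (exp (\<omega> * t) * (norm (B n (B n (u t))))\<^sup>2) \<le> (norm (A u0))\<^sup>2" by blast
qed

lemma Au_bound:
  assumes t: "t \<ge> 0"
  shows "norm (A (u t)) \<le> norm (A u0)"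
proof -
  have "1 * (1 * (norm (A (u t)))\<^sup>2) \<le> W t * (exp (\<omega> * t) * (norm (A (u t)))\<^sup>2)"
    using W_ge_1[OF t] t pos by (intro mult_mono) auto
  also have "\<dots> \<le> (norm (A u0))\<^sup>2" by (rule Au_decay[OF t])
  finally show ?thesis by (simp add: power2_le_iff_abs_le)
qed

section \<open>A priori bounds for the hyperbolic solution\<close>

lemma hyperbolic_facts:
  assumes "hyperbolic_solution D A m p u0 u1 \<epsilon> v"
  shows "v 0 = u0" "dt v 0 = u1"
    "continuous_on {0..} (dt v)" "continuous_on {0..} (\<lambda>t. A (v t))" "continuous_on {0..} v"
    and "t \<ge> 0 \<Longrightarrow> v t \<in> D" "t \<ge> 0 \<Longrightarrow> dt v t \<in> Dh"
    and "t \<ge> 0 \<Longrightarrow> (v has_vector_derivative dt v t) (at t within {0..})"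
    and "t \<ge> 0 \<Longrightarrow> (dt v has_vector_derivative dt (dt v) t) (at t within {0..})"
    and "t \<ge> 0 \<Longrightarrow> \<epsilon> *\<^sub>R dt (dt v) t = - b t *\<^sub>R dt v t - m ((norm (Q (v t)))\<^sup>2) *\<^sub>R A (v t)"
proof -
  have gen: "x = - y - z" if "x + y + z = 0" for x y z :: 'h
  proof -
    have "x = (x + y + z) - y - z" by simp
    then show ?thesis by (simp add: that)
  qed
  show "\<epsilon> *\<^sub>R dt (dt v) t = - b t *\<^sub>R dt v t - m ((norm (Q (v t)))\<^sup>2) *\<^sub>R A (v t)" if "t \<ge> 0"
    using gen[of "\<epsilon> *\<^sub>R dt (dt v) t" "b t *\<^sub>R dt v t" "m ((norm (Q (v t)))\<^sup>2) *\<^sub>R A (v t)"] assms that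
    by (simp add: hyperbolic_solution_def kirchhoff_term_def damping_def)
qed (use assms in \<open>auto simp: hyperbolic_solution_def C2_half_line_def C1_half_line_def C0_graph_def C1_graph_def\<close>)

lemma Q_square_le:
  assumes "x \<in> D" "W t * (norm (A x))\<^sup>2 \<le> M" "t \<ge> 0"
  shows "(norm (Q x))\<^sup>2 \<le> M / \<nu>"
proof -
  have "\<nu> * (norm (Q x))\<^sup>2 \<le> (norm (A x))\<^sup>2" by (rule A_coercive[OF assms(1)])
  also have "\<dots> \<le> W t * (norm (A x))\<^sup>2" using W_ge_1[OF assms(3)] by (simp add: mult_le_cancel_right1)
  finally show ?thesis using assms(2) \<nu>_pos by (simp add: field_simps)
qed

lemma lipschitz_min:
  assumes "L-lipschitz_on {0..R} m" "R \<ge> 0"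
  shows "L-lipschitz_on {0..} (\<lambda>s. m (min s R))"
proof (rule lipschitz_onI)
  show L: "0 \<le> L" by (rule lipschitz_on_nonneg[OF assms(1)])
  fix x y :: real assume "x \<in> {0..}" "y \<in> {0..}"
  then have "dist (m (min x R)) (m (min y R)) \<le> L * dist (min x R) (min y R)"
    using assms by (intro lipschitz_onD[OF assms(1)]) auto
  also have "\<dots> \<le> L * dist x y" using L by (intro mult_left_mono) (auto simp: dist_real_def min_def)
  finally show "dist (m (min x R)) (m (min y R)) \<le> L * dist x y" .
qed

lemma lipschitz_upper:
  assumes "L-lipschitz_on {0..R} m" "0 \<le> s" "s \<le> R"
  shows "m s \<le> m 0 + L * R"
proof -
  have "dist (m s) (m 0) \<le> L * dist s 0" using assms by (intro lipschitz_onD[OF assms(1)]) auto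
  also have "\<dots> \<le> L * R" using assms lipschitz_on_nonneg[OF assms(1)] by (intro mult_left_mono) auto
  finally show ?thesis by (simp add: dist_real_def)
qed

text \<open>By \<open>W_poly\<close> the weight is at least of order 1 / b^2, so boundedness with
  the weight is smallness of order b.\<close>

lemma b_powers: "t \<ge> 0 \<Longrightarrow> W t * x\<^sup>2 \<le> M \<Longrightarrow> x\<^sup>2 \<le> c0 * M * (b t)\<^sup>2"
proof -
  assume t: "t \<ge> 0" and x: "W t * x\<^sup>2 \<le> M"
  have c0: "0 \<le> c0"
  proof (rule ccontr)
    assume "\<not> 0 \<le> c0"
    then have "c0 * W t * (b t)\<^sup>2 \<le> 0" using W_pos[OF t] by (simp add: mult_nonpos_nonneg)
    then show False using W_poly[OF t] by simp
  qed
  have "1 * x\<^sup>2 \<le> (c0 * W t * (b t)\<^sup>2) * x\<^sup>2" using W_poly[OF t] by (intro mult_right_mono) auto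
  also have "\<dots> = c0 * (b t)\<^sup>2 * (W t * x\<^sup>2)" by simp
  also have "\<dots> \<le> c0 * (b t)\<^sup>2 * M" using x c0 by (intro mult_left_mono) auto
  finally show ?thesis by (simp add: algebra_simps)
qed

text \<open>Capping the argument of m at R makes the coefficient bounded and Lipschitz at all times,
  including those where the bootstrap bound is not yet known; where |Q v|^2 \<le> R it is the
  coefficient of the equation.\<close>

definition coef :: "real \<Rightarrow> (real \<Rightarrow> 'h) \<Rightarrow> real \<Rightarrow> real" where
  "coef R v s = m (min ((norm (Q (v s)))\<^sup>2) R)"

lemma coef_bounds:
  assumes "L-lipschitz_on {0..R} m" "R \<ge> 0"
  shows "\<mu> \<le> coef R v s" "coef R v s \<le> m 0 + L * R"
  unfolding coef_def using assms by (auto intro: m_lower lipschitz_upper)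

lemma coef_approx_deriv:
  assumes sol: "hyperbolic_solution D A m p u0 u1 \<epsilon> v" and L: "L-lipschitz_on {0..R} m" "R \<ge> 0" and t: "0 \<le> t"
  shows "approx_deriv (coef R v) 0 (L * \<bar>2 * inner (A (v t)) (dt v t)\<bar>) t"
proof -
  note v = hyperbolic_facts[OF sol]
  have "((\<lambda>s. (norm (Q (v s)))\<^sup>2) has_real_derivative 2 * inner (A (v t)) (dt v t)) (at_right t)"
    by (rule has_real_derivative_right[OF Q_square_deriv[OF v(8)[OF t] t v(6) v(4)] t])
  then have "approx_deriv (\<lambda>s. (norm (Q (v s)))\<^sup>2) (2 * inner (A (v t)) (dt v t)) 0 t"
    by (intro approx_deriv_vector) (simp add: has_real_derivative_iff_has_vector_derivative)
  from approx_deriv_lipschitz_comp[OF lipschitz_min[OF L] this] show ?thesis by (simp add: coef_def[abs_def])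
qed

lemma coef_continuous:
  assumes sol: "hyperbolic_solution D A m p u0 u1 \<epsilon> v" and L: "L-lipschitz_on {0..R} m" "R \<ge> 0"
  shows "continuous_on {0..} (coef R v)"
proof -
  note v = hyperbolic_facts[OF sol]
  have Qcont: "continuous_on {0..} (\<lambda>s. (norm (Q (v s)))\<^sup>2)"
    unfolding continuous_on_eq_continuous_within
    using Q_square_deriv[OF v(8) _ v(6) v(4)] by (meson DERIV_continuous atLeast_iff)
  show ?thesis unfolding coef_def[abs_def]
    by (rule continuous_on_compose2[OF lipschitz_on_continuous_on[OF lipschitz_min[OF L]] Qcont]) auto
qed

text \<open>The factor b on the right comes from the decay of x, in the applications A v: its norm
  is at most \<open>sqrt (c0 * M1) * b t\<close>.\<close>

lemma coef_slow:
  assumes M: "W t * (norm x)\<^sup>2 \<le> M1" "(norm y)\<^sup>2 \<le> M2" and t: "0 \<le> t" and L0: "0 \<le> L" and \<epsilon>: "0 < \<epsilon>"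
    and small: "\<epsilon> * (L * (2 * (sqrt (c0 * M1) * sqrt M2))) \<le> \<mu> / 4"
  shows "\<epsilon> * (L * \<bar>2 * inner x y\<bar>) \<le> b t * (\<mu> / 4)"
proof -
  have "sqrt ((norm x)\<^sup>2) \<le> sqrt (c0 * M1 * (b t)\<^sup>2)"
    using b_powers[OF t M(1)] by (rule real_sqrt_le_mono)
  then have x: "norm x \<le> sqrt (c0 * M1) * b t" using b_pos[OF t] by (simp add: real_sqrt_mult)
  have y: "norm y \<le> sqrt M2" using M(2) by (rule real_le_rsqrt)
  have "\<bar>inner x y\<bar> \<le> norm x * norm y" by (rule Cauchy_Schwarz_ineq2)
  also have "\<dots> \<le> (sqrt (c0 * M1) * b t) * sqrt M2"
    using x y by (intro mult_mono) (auto intro: order_trans[OF norm_ge_zero])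
  finally have "\<epsilon> * (L * \<bar>2 * inner x y\<bar>) \<le> \<epsilon> * (L * (2 * ((sqrt (c0 * M1) * b t) * sqrt M2)))"
    using \<epsilon> L0 by (intro mult_left_mono) (auto simp: abs_mult)
  also have "\<dots> = b t * (\<epsilon> * (L * (2 * (sqrt (c0 * M1) * sqrt M2))))" by simp
  also have "\<dots> \<le> b t * (\<mu> / 4)" using small b_pos[OF t] by (intro mult_left_mono) auto
  finally show ?thesis .
qed

text \<open>Under the bootstrap hypotheses on \<open>[0, T)\<close>, the coefficient of the equation varies slowly enough
  (\<open>\<epsilon> \<bar>c'\<bar> \<le> b c / 4\<close>) for the energy inequality to apply.\<close>

lemma hyperbolic_energy_step:
  assumes sol: "hyperbolic_solution D A m p u0 u1 \<epsilon> v" and \<epsilon>: "0 < \<epsilon>"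
    and L: "L-lipschitz_on {0..M1 / \<nu>} m" and M: "0 \<le> M1" "0 \<le> M2" and \<Lambda>: "\<Lambda> = m 0 + L * (M1 / \<nu>)"
    and small: "\<epsilon> * energy_smallness \<kappa> \<mu> \<nu> \<Lambda> \<beta> \<le> 1"
      "\<epsilon> * (L * (2 * (sqrt (c0 * M1) * sqrt M2))) \<le> \<mu> / 4"
    and T: "T \<ge> 0"
    and boot: "\<And>t. 0 \<le> t \<Longrightarrow> t < T \<Longrightarrow> W t * (norm (A (v t)))\<^sup>2 \<le> M1"
      "\<And>t. 0 \<le> t \<Longrightarrow> t < T \<Longrightarrow> (norm (dt v t))\<^sup>2 \<le> M2"
  shows "W T * (norm (A (v T)))\<^sup>2 \<le>
      exp 2 * (\<kappa> * ((norm (Q u0))\<^sup>2 + 2 * \<epsilon> * (norm (Q u0) * norm (Q u1))) + \<epsilon> * ((norm (Q u1))\<^sup>2 / \<mu>) + (norm (A u0))\<^sup>2)"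
    (is "_ \<le> exp 2 * ?E0")
    and "(norm (dt v T))\<^sup>2 \<le> (norm u1)\<^sup>2 + \<Lambda>\<^sup>2 * (c0 * M1)"
proof -
  note v = hyperbolic_facts[OF sol]
  define R where "R = M1 / \<nu>"
  have R: "R \<ge> 0" using M \<nu>_pos by (simp add: R_def)
  define cv where "cv = coef R v"
  have LR: "L-lipschitz_on {0..R} m" using L by (simp add: R_def)
  have L0: "L \<ge> 0" by (rule lipschitz_on_nonneg[OF L])
  have cv: "\<mu> \<le> cv s" "cv s \<le> \<Lambda>" for s
    using coef_bounds[OF LR R, of v s] by (simp_all add: cv_def \<Lambda> R_def)
  have \<Lambda>0: "0 \<le> \<Lambda>" using cv[of 0] pos by linarith
  have cveq: "m ((norm (Q (v t)))\<^sup>2) = cv t" if "0 \<le> t" "t < T" for t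
  proof -
    have "(norm (Q (v t)))\<^sup>2 \<le> R" unfolding R_def
      using Q_square_le[OF v(6)[OF that(1)] boot(1)[OF that] that(1)] .
    then show ?thesis by (simp add: cv_def coef_def min_absorb1)
  qed
  have A_le: "norm (A (v t)) \<le> sqrt (c0 * M1) * b t" if "0 \<le> t" "t < T" for t
  proof -
    have "sqrt ((norm (A (v t)))\<^sup>2) \<le> sqrt (c0 * M1 * (b t)\<^sup>2)"
      using b_powers[OF that(1) boot(1)[OF that]] by (rule real_sqrt_le_mono)
    then show ?thesis using b_pos[OF that(1)] by (simp add: real_sqrt_mult)
  qed
  have v'_le: "norm (dt v t) \<le> sqrt M2" if "0 \<le> t" "t < T" for t
    using boot(2)[OF that] by (rule real_le_rsqrt)
  have \<gamma>_small: "\<epsilon> * (L * \<bar>2 * inner (A (v t)) (dt v t)\<bar>) \<le> b t * cv t / 4" if t: "0 \<le> t" "t < T" for t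
  proof -
    have "b t * (\<mu> / 4) \<le> b t * (cv t / 4)" using cv(1)[of t] b_pos[OF t(1)] by (intro mult_left_mono) auto
    then show ?thesis using coef_slow[OF boot(1)[OF t] boot(2)[OF t] t(1) L0 \<epsilon> small(2)] by simp
  qed
  note lin = linear_simps[OF B_bl]
  have Bcont: "continuous_on {0..} (\<lambda>s. B n (w s))" if "continuous_on {0..} w" for n and w :: "real \<Rightarrow> 'h"
    by (rule bounded_linear.continuous_on[OF B_bl that])
  have cvcont: "continuous_on {0..} cv" unfolding cv_def by (rule coef_continuous[OF sol LR R])
  \<comment> \<open>The energy of \<open>B n v\<close> contains |B n (B n v)|^2, which tends to |A
    v|^2. Neither a force nor a corrector is present, so the right side of
    \<open>energy_dini\<close> vanishes and Y does not increase.\<close>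
  have step: "W T * (norm (B n (B n (v T))))\<^sup>2 \<le> exp 2 * ?E0" for n
  proof -
    define Y where "Y = (\<lambda>s. weight_corr \<epsilon> s * energy \<kappa> \<epsilon> (b s) (cv s) (B n (v s)) (B n (dt v s)) (B n (B n (v s))))"
    have cvne: "\<forall>x\<in>{0..}. cv x \<noteq> 0" using cv(1) pos by (metis less_le_trans less_irrefl)
    have "continuous_on {0..} Y" unfolding Y_def energy_def
      by (intro continuous_intros weight_corr_cont \<epsilon> b_cont Bcont v(3,5) cvcont cvne)
    moreover have "dini_le Y 0 t" if t: "0 \<le> t" "t < T" for t
    proof -
      have "dini_le Y (weight_corr \<epsilon> t * (forcing_const \<kappa> \<mu> \<nu> \<Lambda> * ((norm (0::'h))\<^sup>2 / b t + \<epsilon>\<^sup>2 * 0\<^sup>2 / b t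
         + (norm (B n 0))\<^sup>2 / rate_corr \<epsilon> t + \<epsilon>\<^sup>2 * (norm (B n 0))\<^sup>2))) t"
        unfolding Y_def
      proof (rule energy_dini[OF B_bl B_sym t(1) \<epsilon> small(1)])
        show "\<mu> \<le> cv s" "cv s \<le> \<Lambda>" for s by (rule cv)+
        show "approx_deriv cv 0 (L * \<bar>2 * inner (A (v t)) (dt v t)\<bar>) t" unfolding cv_def by (rule coef_approx_deriv[OF sol LR R t(1)])
        show "\<epsilon> * (L * \<bar>2 * inner (A (v t)) (dt v t)\<bar>) \<le> b t * cv t / 4" by (rule \<gamma>_small[OF t])
        show "approx_deriv (\<lambda>s. B n (v s)) (B n (dt v t) + 0) 0 t"
          using approx_deriv_vector[OF admissible_deriv[OF admissible_B has_vector_derivative_right[OF v(8)[OF t(1)] t(1)]]]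
          by simp
        show "approx_deriv (\<lambda>s. B n (dt v s)) (B n (dt (dt v) t)) 0 t"
          using approx_deriv_vector[OF admissible_deriv[OF admissible_B has_vector_derivative_right[OF v(9)[OF t(1)] t(1)]]] .
        have "\<epsilon> *\<^sub>R B n (dt (dt v) t) = B n (\<epsilon> *\<^sub>R dt (dt v) t)" by (simp add: lin)
        also have "\<dots> = - b t *\<^sub>R B n (dt v t) - cv t *\<^sub>R B n (A (v t))"
          unfolding v(10)[OF t(1)] cveq[OF t] by (simp add: lin)
        also have "B n (A (v t)) = B n (B n (B n (v t)))" by (rule admissible_A[OF admissible_B v(6)[OF t(1)]])
        finally show "\<epsilon> *\<^sub>R B n (dt (dt v) t) = - b t *\<^sub>R B n (dt v t) - cv t *\<^sub>R B n (B n (B n (v t))) + 0" by simp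
        show "\<nu> * (norm (B n (v t)))\<^sup>2 \<le> (norm (B n (B n (v t))))\<^sup>2"
          by (rule admissible_coercive[OF admissible_B])
      qed (use L0 in \<open>auto simp: lin\<close>)
      then show ?thesis by (simp add: lin)
    qed
    ultimately have Y: "Y T \<le> Y 0" by (intro dini_le_nonincreasing T) auto
    have sp: "\<epsilon> * (4 * \<Lambda> * \<kappa>) \<le> 1"
      using energy_smallness_parts(3)[OF pos(1) \<nu>_pos _ \<kappa>_pos pos(3) \<epsilon> small(1)] cv[of 0] pos by linarith
    have "(norm (B n (B n (v T))))\<^sup>2 + \<epsilon> * (norm (B n (dt v T)))\<^sup>2 / (2 * cv T) \<le>
       energy \<kappa> \<epsilon> (b T) (cv T) (B n (v T)) (B n (dt v T)) (B n (B n (v T)))"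
      using cv[of T] pos b_pos[OF T] by (intro energy_coercive[OF \<kappa>_pos \<epsilon> _ cv(2) sp]) auto
    moreover have "0 \<le> \<epsilon> * (norm (B n (dt v T)))\<^sup>2 / (2 * cv T)" using \<epsilon> cv[of T] pos by simp
    ultimately have 1: "(norm (B n (B n (v T))))\<^sup>2 \<le> energy \<kappa> \<epsilon> (b T) (cv T) (B n (v T)) (B n (dt v T)) (B n (B n (v T)))"
      by linarith
    have "W T * (norm (B n (B n (v T))))\<^sup>2 \<le> weight_corr \<epsilon> T * (norm (B n (B n (v T))))\<^sup>2"
      using weight_corr_bounds[OF T \<epsilon>] by (intro mult_right_mono) auto
    also have "\<dots> \<le> Y T" unfolding Y_def using weight_corr_bounds(3)[OF T \<epsilon>] 1 by (intro mult_left_mono) auto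
    also note Y
    also have "Y 0 \<le> exp 2 * ?E0"
    proof -
      have b0: "b 0 = 1" by (simp add: damping_def)
      have w0: "weight_corr \<epsilon> 0 = exp 2" by (simp add: weight_corr_def W_0)
      have "energy \<kappa> \<epsilon> (b 0) (cv 0) (B n (v 0)) (B n (dt v 0)) (B n (B n (v 0))) \<le> ?E0"
        unfolding energy_def v(1,2) b0 mult_1
      proof (intro add_mono mult_left_mono)
        have Qs: "norm (B n u0) \<le> norm (Q u0)" "norm (B n u1) \<le> norm (Q u1)"
          using norm_B_le D_imp_Dh u0_D u1_Dh by auto
        show "(norm (B n u0))\<^sup>2 \<le> (norm (Q u0))\<^sup>2" using Qs by (intro power_mono) auto
        have "inner (B n u0) (B n u1) \<le> norm (B n u0) * norm (B n u1)" by (rule norm_cauchy_schwarz)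
        also have "\<dots> \<le> norm (Q u0) * norm (Q u1)" using Qs by (intro mult_mono) auto
        finally show "inner (B n u0) (B n u1) \<le> norm (Q u0) * norm (Q u1)" .
        show "(norm (B n u1))\<^sup>2 / cv 0 \<le> (norm (Q u1))\<^sup>2 / \<mu>"
          using Qs cv[of 0] pos by (intro frac_le power_mono) auto
        show "(norm (B n (B n u0)))\<^sup>2 \<le> (norm (A u0))\<^sup>2" using norm_BB_le[OF u0_D] by (intro power_mono) auto
      qed (use \<kappa>_pos \<epsilon> in auto)
      then show ?thesis unfolding Y_def w0 by (intro mult_left_mono) auto
    qed
    finally show ?thesis .
  qed
  show "W T * (norm (A (v T)))\<^sup>2 \<le> exp 2 * ?E0"
  proof (rule LIMSEQ_le_const2)
    show "(\<lambda>n. W T * (norm (B n (B n (v T))))\<^sup>2) \<longlonglongrightarrow> W T * (norm (A (v T)))\<^sup>2"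
      by (intro tendsto_intros BB_tendsto v(6) T)
  qed (use step in blast)
  \<comment> \<open>For v' the equation reads \<epsilon> v'' + b v' = - c A v, with right side at
    most sqrt K times b. So |v'|^2 relaxes below the level K at a rate proportional to b /
    \<epsilon>, and exp (G / \<epsilon>) is the integrating factor.\<close>
  define K where "K = \<Lambda>\<^sup>2 * (c0 * M1)"
  define g where "g = (\<lambda>s. exp (G s / \<epsilon>) * ((norm (dt v s))\<^sup>2 - K))"
  have "g T \<le> g 0"
  proof (rule dini_le_nonincreasing[OF _ T])
    show "continuous_on {0..} g" unfolding g_def using \<epsilon> by (intro continuous_intros damping_int_cont v(3)) auto
    fix t assume t: "0 \<le> t" "t < T"
    define i where "i = inner (dt v t) (dt (dt v) t)"
    have d: "(dt v has_vector_derivative dt (dt v) t) (at_right t)"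
      by (rule has_vector_derivative_right[OF v(9)[OF t(1)] t(1)])
    have d2: "approx_deriv (\<lambda>s. (norm (dt v s))\<^sup>2) (2 * i) 0 t"
      using approx_deriv_inner[OF approx_deriv_vector[OF d] approx_deriv_vector[OF d]]
      by (simp add: dot_square_norm inner_commute i_def)
    have d2': "approx_deriv (\<lambda>s. (norm (dt v s))\<^sup>2 - K) (2 * i) 0 t"
      using approx_deriv_add[OF d2 approx_deriv_const[of "- K"]] by simp
    have de: "approx_deriv (\<lambda>s. exp (G s / \<epsilon>)) (b t / \<epsilon> * exp (G t / \<epsilon>)) 0 t"
      by (rule approx_deriv_vector)
        (use t \<epsilon> in \<open>auto simp flip: has_real_derivative_iff_has_vector_derivative
          intro!: derivative_eq_intros damping_int_deriv\<close>)
    have "approx_deriv g (exp (G t / \<epsilon>) * (2 * i) + b t / \<epsilon> * exp (G t / \<epsilon>) * ((norm (dt v t))\<^sup>2 - K)) 0 t"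
      using approx_deriv_mult[OF de d2'] by (simp add: g_def)
    moreover have "2 * i + b t / \<epsilon> * ((norm (dt v t))\<^sup>2 - K) \<le> 0"
    proof -
      define x where "x = norm (dt v t)"
      have "\<epsilon> * i = inner (dt v t) (\<epsilon> *\<^sub>R dt (dt v) t)" by (simp add: i_def)
      also have "\<dots> = - b t * x\<^sup>2 + - (cv t * inner (dt v t) (A (v t)))"
        unfolding v(10)[OF t(1)] cveq[OF t] by (simp add: inner_diff_right x_def dot_square_norm)
      finally have i1: "\<epsilon> * i = - b t * x\<^sup>2 + - (cv t * inner (dt v t) (A (v t)))" .
      have i2: "- (cv t * inner (dt v t) (A (v t))) \<le> \<Lambda> * (x * (sqrt (c0 * M1) * b t))"
      proof -
        have "- (cv t * inner (dt v t) (A (v t))) \<le> \<bar>cv t\<bar> * \<bar>inner (dt v t) (A (v t))\<bar>"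
          by (metis abs_mult abs_ge_minus_self)
        also have "\<dots> \<le> \<Lambda> * (x * (sqrt (c0 * M1) * b t))"
        proof (intro mult_mono)
          show "\<bar>cv t\<bar> \<le> \<Lambda>" using cv[of t] pos by simp
          have "\<bar>inner (dt v t) (A (v t))\<bar> \<le> norm (dt v t) * norm (A (v t))" by (rule Cauchy_Schwarz_ineq2)
          also have "\<dots> \<le> x * (sqrt (c0 * M1) * b t)"
            unfolding x_def by (intro mult_left_mono A_le t) auto
          finally show "\<bar>inner (dt v t) (A (v t))\<bar> \<le> x * (sqrt (c0 * M1) * b t)" .
        qed (use \<Lambda>0 in auto)
        finally show ?thesis .
      qed
      have i3: "\<Lambda> * (x * (sqrt (c0 * M1) * b t)) \<le> b t * ((x\<^sup>2 + K) / 2)"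
      proof -
        have "0 \<le> c0 * M1 * (b t)\<^sup>2" using b_powers[OF t(1) boot(1)[OF t]] by (rule order_trans[OF zero_le_power2])
        then have cM: "0 \<le> c0 * M1" using b_pos[OF t(1)] by (simp add: zero_le_mult_iff)
        have "2 * x * (\<Lambda> * sqrt (c0 * M1)) \<le> 1 * x\<^sup>2 + (\<Lambda> * sqrt (c0 * M1))\<^sup>2 / 1"
          by (rule two_mult_le_weighted) simp
        also have "(\<Lambda> * sqrt (c0 * M1))\<^sup>2 = K" using cM by (simp add: K_def power_mult_distrib)
        finally have "x * (\<Lambda> * sqrt (c0 * M1)) \<le> (x\<^sup>2 + K) / 2" by simp
        from mult_left_mono[OF this less_imp_le[OF b_pos[OF t(1)]]] show ?thesis by (simp add: algebra_simps)
      qed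
      have "\<epsilon> * i \<le> - b t * x\<^sup>2 + b t * ((x\<^sup>2 + K) / 2)" using i1 i2 i3 by linarith
      also have "\<dots> = - (b t / 2) * (x\<^sup>2 - K)" by (simp add: field_simps)
      finally have "\<epsilon> * i \<le> - (b t / 2) * (x\<^sup>2 - K)" .
      then have "i \<le> - (b t / 2) * (x\<^sup>2 - K) / \<epsilon>" using \<epsilon> by (simp add: field_simps)
      then show ?thesis using \<epsilon> by (simp add: x_def field_simps)
    qed
    then have "exp (G t / \<epsilon>) * (2 * i + b t / \<epsilon> * ((norm (dt v t))\<^sup>2 - K)) \<le> 0"
      by (intro mult_nonneg_nonpos) auto
    moreover have "exp (G t / \<epsilon>) * (2 * i) + b t / \<epsilon> * exp (G t / \<epsilon>) * ((norm (dt v t))\<^sup>2 - K) =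
        exp (G t / \<epsilon>) * (2 * i + b t / \<epsilon> * ((norm (dt v t))\<^sup>2 - K))"
      by (simp only: distrib_left mult_ac)
    ultimately show "dini_le g 0 t" by (intro dini_le_approx) auto
  qed
  then have gT: "exp (G T / \<epsilon>) * ((norm (dt v T))\<^sup>2 - K) \<le> (norm u1)\<^sup>2 - K" by (simp add: g_def v(2))
  have K0: "0 \<le> K" 
  proof -
    have "0 \<le> c0" using W_poly[of 0] by (simp add: W_0 damping_def)
    then show ?thesis using M by (simp add: K_def)
  qed
  show "(norm (dt v T))\<^sup>2 \<le> (norm u1)\<^sup>2 + \<Lambda>\<^sup>2 * (c0 * M1)"
  proof (rule ccontr)
    assume "\<not> ?thesis"
    then have n: "(norm (dt v T))\<^sup>2 - K > (norm u1)\<^sup>2" by (simp add: K_def)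
    then have "0 \<le> (norm (dt v T))\<^sup>2 - K" by (meson less_imp_le order_trans zero_le_power2)
    moreover have "1 \<le> exp (G T / \<epsilon>)" using damping_int_nonneg[OF p T] \<epsilon> by simp
    ultimately have "1 * ((norm (dt v T))\<^sup>2 - K) \<le> exp (G T / \<epsilon>) * ((norm (dt v T))\<^sup>2 - K)"
      by (intro mult_right_mono) auto
    then have "(norm (dt v T))\<^sup>2 - K \<le> (norm u1)\<^sup>2 - K" using gT by (simp only: mult_1)
    then have "(norm (dt v T))\<^sup>2 - K \<le> (norm u1)\<^sup>2" using K0 by argo
    then show False using n by (simp only: not_less[symmetric] simp_thms)
  qed
qed

definition w0 :: 'h where "w0 = u1 + c 0 *\<^sub>R A u0"

text \<open>The derivative r', with the derivative of the corrector in the closed form of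
  \<open>corrector_derivative\<close>; \<open>w0\<close> is the initial slope of the
  corrector.\<close>

definition rem :: "real \<Rightarrow> (real \<Rightarrow> 'h) \<Rightarrow> real \<Rightarrow> 'h" where
  "rem \<epsilon> v t = dt v t - dt u t - exp (- (G t / \<epsilon>)) *\<^sub>R w0"

definition controlled :: "real \<Rightarrow> real \<Rightarrow> (real \<Rightarrow> 'h) \<Rightarrow> bool" where
  "controlled M \<epsilon> v \<longleftrightarrow> hyperbolic_solution D A m p u0 u1 \<epsilon> v \<and>
     (\<forall>t\<ge>0. W t * (norm (A (v t)))\<^sup>2 \<le> M \<and> (norm (dt v t))\<^sup>2 \<le> M)"

lemma hyperbolic_apriori:
  "\<exists>M \<epsilon>1. 0 < \<epsilon>1 \<and>
     (\<forall>\<epsilon> v. 0 < \<epsilon> \<longrightarrow> \<epsilon> < \<epsilon>1 \<longrightarrow> hyperbolic_solution D A m p u0 u1 \<epsilon> v \<longrightarrow> controlled M \<epsilon> v)"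
proof -
  \<comment> \<open>The order of the choices matters: N1 involves neither L nor \<epsilon>; then L
    and \<Lambda> are fixed by M1, and N2 by \<Lambda> and M1; \<epsilon> is made small last. The
    additions of 1 in M1 and M2 produce the strict inequality demanded by
    \<open>continuation\<close>.\<close>
  define N1 where "N1 = exp 2 * (\<kappa> * ((norm (Q u0))\<^sup>2 + 2 * (norm (Q u0) * norm (Q u1))) + (norm (Q u1))\<^sup>2 / \<mu> + (norm (A u0))\<^sup>2)"
  define M1 where "M1 = N1 + 1"
  have N1: "0 \<le> N1" unfolding N1_def using \<kappa>_pos pos by auto
  then have M1: "0 \<le> M1" by (simp add: M1_def)
  obtain L where L: "L-lipschitz_on {0..M1 / \<nu>} m" using locally_lipschitz_imp_lipschitz[OF m_lip] by blast
  define \<Lambda> where "\<Lambda> = m 0 + L * (M1 / \<nu>)"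
  define N2 where "N2 = (norm u1)\<^sup>2 + \<Lambda>\<^sup>2 * (c0 * M1)"
  define M2 where "M2 = N2 + 1"
  have c00: "0 \<le> c0" using W_poly[of 0] by (simp add: W_0 damping_def)
  have M2: "0 \<le> M2" unfolding M2_def N2_def using c00 M1 by (intro add_nonneg_nonneg mult_nonneg_nonneg) auto
  define K where "K = \<bar>energy_smallness \<kappa> \<mu> \<nu> \<Lambda> \<beta>\<bar> + L * (2 * (sqrt (c0 * M1) * sqrt M2)) * (4 / \<mu>) + 1"
  have L0: "0 \<le> L" by (rule lipschitz_on_nonneg[OF L])
  have x0: "0 \<le> L * (2 * (sqrt (c0 * M1) * sqrt M2)) * (4 / \<mu>)"
    using L0 c00 M1 M2 pos by (intro mult_nonneg_nonneg) auto
  then have K: "1 \<le> K" by (simp add: K_def)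
  have main: "controlled (max M1 M2) \<epsilon> v"
    if \<epsilon>: "0 < \<epsilon>" "\<epsilon> < 1 / K" and sol: "hyperbolic_solution D A m p u0 u1 \<epsilon> v" for \<epsilon> v
  proof -
    note v = hyperbolic_facts[OF sol]
    have \<epsilon>K: "\<epsilon> * x \<le> 1" if "x \<le> K" for x
    proof -
      have "\<epsilon> * x \<le> \<epsilon> * K" using that \<epsilon> by (intro mult_left_mono) auto
      also have "\<dots> \<le> 1" using \<epsilon> K by (simp add: field_simps)
      finally show ?thesis .
    qed
    have \<epsilon>1: "\<epsilon> \<le> 1" using \<epsilon>K[OF K] by simp
    have s1: "\<epsilon> * energy_smallness \<kappa> \<mu> \<nu> \<Lambda> \<beta> \<le> 1" by (rule \<epsilon>K) (use x0 in \<open>simp add: K_def\<close>)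
    have "\<epsilon> * (L * (2 * (sqrt (c0 * M1) * sqrt M2)) * (4 / \<mu>)) \<le> 1" by (rule \<epsilon>K) (simp add: K_def)
    then have s2: "\<epsilon> * (L * (2 * (sqrt (c0 * M1) * sqrt M2))) \<le> \<mu> / 4" using pos by (simp add: field_simps)
    define X where "X = (\<lambda>t. max (W t * (norm (A (v t)))\<^sup>2 - M1) ((norm (dt v t))\<^sup>2 - M2))"
    have "X t < 0" if "t \<ge> 0" for t
    proof (rule continuation[OF _ continuous_on_const _ that])
      show "continuous_on {0..} X" unfolding X_def by (intro continuous_intros W_cont v(3,4))
      fix T :: real assume T: "T \<ge> 0" and "\<And>t. 0 \<le> t \<Longrightarrow> t < T \<Longrightarrow> X t \<le> 0"
      then have boot: "\<And>t. 0 \<le> t \<Longrightarrow> t < T \<Longrightarrow> W t * (norm (A (v t)))\<^sup>2 \<le> M1"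
        "\<And>t. 0 \<le> t \<Longrightarrow> t < T \<Longrightarrow> (norm (dt v t))\<^sup>2 \<le> M2"
        by (auto simp: X_def)
      note st = hyperbolic_energy_step[OF sol \<epsilon>(1) L M1 M2 \<Lambda>_def s1 s2 T boot]
      have "W T * (norm (A (v T)))\<^sup>2 \<le> N1"
      proof (rule order_trans[OF st(1)])
        have "\<epsilon> * (norm (Q u0) * norm (Q u1)) \<le> 1 * (norm (Q u0) * norm (Q u1))"
          "\<epsilon> * ((norm (Q u1))\<^sup>2 / \<mu>) \<le> 1 * ((norm (Q u1))\<^sup>2 / \<mu>)"
          using pos by (intro mult_right_mono \<epsilon>1; simp)+
        then show "exp 2 * (\<kappa> * ((norm (Q u0))\<^sup>2 + 2 * \<epsilon> * (norm (Q u0) * norm (Q u1))) + \<epsilon> * ((norm (Q u1))\<^sup>2 / \<mu>) + (norm (A u0))\<^sup>2) \<le> N1"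
          unfolding N1_def using \<kappa>_pos by (intro mult_left_mono add_mono) auto
      qed
      moreover have "(norm (dt v T))\<^sup>2 \<le> N2" using st(2) by (simp add: N2_def)
      ultimately show "X T < 0" by (simp add: X_def M1_def M2_def)
    qed
    then have "W t * (norm (A (v t)))\<^sup>2 \<le> max M1 M2" "(norm (dt v t))\<^sup>2 \<le> max M1 M2" if "t \<ge> 0" for t
      using that by (force simp: X_def)+
    then show ?thesis using sol by (simp add: controlled_def)
  qed
  have "0 < 1 / K" using K by simp
  with main show ?thesis by blast
qed

end

section \<open>The remainder\<close>

text \<open>M bounds the squared norm of A on both solutions, hence M / \<nu> bounds the arguments
  of m. The power 5 arises as (1 + t)^4 from the squared error in u', times 1 / b \<le> 1 +
  t.\<close>

locale kirchhoff_bounds = kirchhoff D A \<nu> P B p \<mu> \<beta> \<omega> W a m u0 u1 u c0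
  for D :: "'h::real_inner set" and A \<nu> P B p \<mu> \<beta> \<omega> W a m u0 u1 u c0 +
  fixes M L C5 K :: real
  assumes M_ge: "(norm (A u0))\<^sup>2 \<le> M"
    and L_lip: "L-lipschitz_on {0..M / \<nu>} m"
    and C5: "t \<ge> 0 \<Longrightarrow> (1 + t) ^ 5 \<le> C5 * exp (\<omega> / 2 * t)"
begin

definition R :: real where "R = M / \<nu>"
definition \<Lambda> :: real where "\<Lambda> = m 0 + L * R"
definition Cv :: real where "Cv = \<Lambda>\<^sup>2 + \<Lambda> / \<nu> + 2 * L * \<Lambda> * M / \<nu>"
definition small :: "real \<Rightarrow> bool" where
  "small \<epsilon> \<longleftrightarrow> 0 < \<epsilon> \<and> \<epsilon> \<le> 1 \<and> \<epsilon> * energy_smallness \<kappa> \<mu> \<nu> \<Lambda> \<beta> \<le> 1 \<and>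
     \<epsilon> * (L * (2 * (sqrt (c0 * M) * sqrt M))) \<le> \<mu> / 4"

lemma M_nonneg: "0 \<le> M"
  using M_ge zero_le_power2 by (rule order_trans[rotated])

lemma R_nonneg: "0 \<le> R"
  using M_nonneg \<nu>_pos by (simp add: R_def)

lemma L_lip': "L-lipschitz_on {0..R} m"
  using L_lip by (simp add: R_def)

lemma L_nonneg: "0 \<le> L"
  by (rule lipschitz_on_nonneg[OF L_lip])

lemma cv: "\<mu> \<le> coef R v s" "coef R v s \<le> \<Lambda>"
  using coef_bounds[OF L_lip' R_nonneg] by (simp_all add: \<Lambda>_def)

lemma \<Lambda>_pos: "0 < \<Lambda>" "\<mu> \<le> \<Lambda>"
  using cv[of u 0] pos by linarith+

lemma C5_pos: "0 < C5"
  using C5[of 0] by simp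

lemma Cv_nonneg: "0 \<le> Cv"
  unfolding Cv_def using \<Lambda>_pos \<nu>_pos L_nonneg M_nonneg by (intro add_nonneg_nonneg divide_nonneg_nonneg mult_nonneg_nonneg) auto

lemma Qu_le: "t \<ge> 0 \<Longrightarrow> (norm (Q (u t)))\<^sup>2 \<le> R"
proof -
  assume t: "t \<ge> 0"
  have "\<nu> * (norm (Q (u t)))\<^sup>2 \<le> (norm (A (u t)))\<^sup>2" by (rule A_coercive[OF u_D[OF t]])
  also have "\<dots> \<le> (norm (A u0))\<^sup>2" using Au_bound[OF t] by (intro power_mono) auto
  also note M_ge
  finally show ?thesis using \<nu>_pos by (simp add: R_def field_simps)
qed

lemma c_le: "t \<ge> 0 \<Longrightarrow> c t \<le> \<Lambda>"
  unfolding c_def \<Lambda>_def using Qu_le by (intro lipschitz_upper[OF L_lip']) auto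

lemma Qv_le: "controlled M \<epsilon> v \<Longrightarrow> t \<ge> 0 \<Longrightarrow> (norm (Q (v t)))\<^sup>2 \<le> R"
  unfolding R_def controlled_def using hyperbolic_facts(6) Q_square_le by blast

lemma coef_eq: "controlled M \<epsilon> v \<Longrightarrow> t \<ge> 0 \<Longrightarrow> m ((norm (Q (v t)))\<^sup>2) = coef R v t"
  using Qv_le[of \<epsilon> v t] by (simp add: coef_def min_absorb1)

lemma approx_deriv_c:
  assumes t: "t \<ge> 0"
  shows "approx_deriv c 0 (2 * L * \<Lambda> * M * (1 + t)) t"
proof -
  have "((\<lambda>s. (norm (Q (u s)))\<^sup>2) has_real_derivative 2 * inner (A (u t)) (dt u t)) (at_right t)"
    by (rule has_real_derivative_right[OF Q_square_deriv[OF u_deriv[OF t] t u_D Au_cont] t])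
  then have "approx_deriv (\<lambda>s. (norm (Q (u s)))\<^sup>2) (2 * inner (A (u t)) (dt u t)) 0 t"
    by (intro approx_deriv_vector) (simp add: has_real_derivative_iff_has_vector_derivative)
  from approx_deriv_lipschitz_comp[OF L_lip' this]
  have d: "approx_deriv c 0 (L * \<bar>2 * inner (A (u t)) (dt u t)\<bar>) t"
    unfolding c_def[abs_def] using Qu_le t by simp
  have nA: "(norm (A (u t)))\<^sup>2 \<le> M"
    by (rule order_trans[OF power_mono[OF Au_bound[OF t]] M_ge]) simp
  have "\<bar>inner (A (u t)) (dt u t)\<bar> = c t / b t * (norm (A (u t)))\<^sup>2"
    unfolding u'_eq[OF t] using c_lower[OF t] pos b_pos[OF t] by (simp add: dot_square_norm)
  also have "\<dots> = (c t * (1 / b t)) * (norm (A (u t)))\<^sup>2" by simp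
  also have "\<dots> \<le> (\<Lambda> * (1 + t)) * M"
    using nA c_le[OF t] b_inv[OF t] c_lower[OF t] pos b_pos[OF t] t by (intro mult_mono mult_nonneg_nonneg) auto
  finally have "L * \<bar>2 * inner (A (u t)) (dt u t)\<bar> \<le> L * (2 * ((\<Lambda> * (1 + t)) * M))"
    using L_nonneg by (intro mult_left_mono) (auto simp: abs_mult)
  then show ?thesis by (intro approx_deriv_mono[OF d]) (simp add: algebra_simps)
qed

text \<open>Formally u'' is minus the derivative of c A u / b. It only acts as a force multiplied by
  \<epsilon>, so no derivative has to be identified: it is set to 0 and the whole size becomes the
  error. Substituting the equation for u' produces the four factors \<open>B n\<close> and the
  growth (1 + t)^2 from two factors 1 / b.\<close>

lemma approx_deriv_Ju':
  assumes J: "admissible n J" and t: "t \<ge> 0"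
  shows "approx_deriv (\<lambda>s. J (dt u s)) 0 (Cv * (1 + t)\<^sup>2 * norm (B n (B n (B n (B n (J (u t))))))) t"
proof -
  interpret J: bounded_linear J using J by (simp add: admissible_def)
  interpret Bn: bounded_linear "B n" by (rule B_bl)
  define q where "q s = (1 + s) powr p *\<^sub>R B n (B n (J (u s)))" for s
  define x2 x3 x4 where "x2 = norm (B n (B n (J (u t))))" and "x3 = norm (B n (B n (B n (J (u t)))))"
    and "x4 = norm (B n (B n (B n (B n (J (u t))))))"
  note J2 = admissible_B_comp[OF admissible_B_comp[OF J]]
  have x24: "x2 \<le> x4 / \<nu>"
  proof -
    have "\<nu> * (\<nu> * x2\<^sup>2) \<le> \<nu> * x3\<^sup>2"
      using admissible_coercive[OF J2, of "u t"] \<nu>_pos by (intro mult_left_mono) (auto simp: x2_def x3_def)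
    also have "\<dots> \<le> x4\<^sup>2"
      using admissible_coercive[OF admissible_B_comp[OF J2], of "u t"] by (simp add: x3_def x4_def)
    finally have "(\<nu> * x2)\<^sup>2 \<le> x4\<^sup>2" by (simp add: power2_eq_square mult_ac)
    then have "\<nu> * x2 \<le> x4" by (rule power2_le_imp_le) (simp add: x4_def)
    then show ?thesis using \<nu>_pos by (simp add: field_simps)
  qed
  have b1: "1 / b s = (1 + s) powr p" for s by (simp add: damping_def)
  have eq: "J (dt u s) = - c s *\<^sub>R q s" if "s \<ge> t" for s
  proof -
    have s: "s \<ge> 0" using that t by simp
    have "J (dt u s) = - (c s / b s) *\<^sub>R J (A (u s))" unfolding u'_eq[OF s] by (simp add: J.scaleR J.neg)
    also have "J (A (u s)) = B n (B n (J (u s)))" by (rule admissible_A[OF J u_D[OF s]])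
    finally show ?thesis using b1[of s] by (simp add: q_def divide_inverse)
  qed
  define k where "k = p * (1 + t) powr (p - 1)"
  have k: "0 \<le> k" "k \<le> 1"
  proof -
    have "(1 + t) powr (p - 1) \<le> (1 + t) powr 0" using p t by (intro powr_mono) auto
    then have "(1 + t) powr (p - 1) \<le> 1" using t by simp
    then show "0 \<le> k" "k \<le> 1" unfolding k_def using p by (auto intro: mult_le_one)
  qed
  define q' where "q' = (1 + t) powr p *\<^sub>R B n (B n (J (dt u t))) + k *\<^sub>R B n (B n (J (u t)))"
  have dq: "approx_deriv q q' 0 t"
  proof -
    have 1: "approx_deriv (\<lambda>s. (1 + s) powr p) k 0 t"
      using has_real_derivative_shifted_powr[OF t, of p "{t<..}"]
      by (intro approx_deriv_vector) (simp add: k_def has_real_derivative_iff_has_vector_derivative)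
    have 2: "approx_deriv (\<lambda>s. B n (B n (J (u s)))) (B n (B n (J (dt u t)))) 0 t"
      by (rule approx_deriv_vector[OF admissible_deriv[OF J2 has_vector_derivative_right[OF u_deriv[OF t] t]]])
    show ?thesis using approx_deriv_scaleR[OF 1 2] by (simp add: q_def[abs_def] q'_def)
  qed
  have dmc: "approx_deriv (\<lambda>s. - c s) 0 (2 * L * \<Lambda> * M * (1 + t)) t"
    using approx_deriv_cmult[OF approx_deriv_c[OF t], of "-1"] by simp
  from approx_deriv_scaleR[OF this dq]
  have d: "approx_deriv (\<lambda>s. - c s *\<^sub>R q s) (- c t *\<^sub>R q') (2 * L * \<Lambda> * M * (1 + t) * norm (q t)) t" by simp
  have pw: "(1 + t) powr p \<le> 1 + t" using b_inv[OF t] b1 by simp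
  have ct: "0 \<le> c t" "c t \<le> \<Lambda>" using c_lower[OF t] c_le[OF t] pos by auto
  have nq: "norm (q t) \<le> (1 + t) * (x4 / \<nu>)"
  proof -
    have "norm (q t) = (1 + t) powr p * x2" by (simp add: q_def x2_def)
    also have "\<dots> \<le> (1 + t) * (x4 / \<nu>)" using pw x24 t by (intro mult_mono) (auto simp: x2_def)
    finally show ?thesis .
  qed
  have nq': "norm q' \<le> (1 + t)\<^sup>2 * \<Lambda> * x4 + x4 / \<nu>"
  proof -
    have "J (dt u t) = - (c t * (1 + t) powr p) *\<^sub>R B n (B n (J (u t)))" using eq[of t] by (simp add: q_def)
    then have "norm (B n (B n (J (dt u t)))) = c t * (1 + t) powr p * x4"
      using ct by (simp add: Bn.scaleR Bn.neg x4_def abs_mult)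
    also have "\<dots> \<le> \<Lambda> * (1 + t) * x4" using pw ct t by (intro mult_mono) (auto simp: x4_def)
    finally have 1: "norm ((1 + t) powr p *\<^sub>R B n (B n (J (dt u t)))) \<le> (1 + t) * (\<Lambda> * (1 + t) * x4)"
      using pw t by (auto intro!: mult_mono)
    have "k * x2 \<le> 1 * (x4 / \<nu>)" using k x24 by (intro mult_mono) (auto simp: x2_def)
    then have 2: "norm (k *\<^sub>R B n (B n (J (u t)))) \<le> x4 / \<nu>" using k by (simp add: x2_def)
    show ?thesis unfolding q'_def
      using norm_triangle_mono[OF 1 2] by (simp add: power2_eq_square algebra_simps)
  qed
  have "2 * L * \<Lambda> * M * (1 + t) * norm (q t) + norm (- c t *\<^sub>R q' - 0) \<le> Cv * (1 + t)\<^sup>2 * x4"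
  proof -
    have "2 * L * \<Lambda> * M * (1 + t) * norm (q t) \<le> 2 * L * \<Lambda> * M * (1 + t) * ((1 + t) * (x4 / \<nu>))"
      using nq L_nonneg \<Lambda>_pos M_nonneg t by (intro mult_left_mono mult_nonneg_nonneg) auto
    moreover have "norm (- c t *\<^sub>R q' - 0) \<le> \<Lambda> * ((1 + t)\<^sup>2 * \<Lambda> * x4 + x4 / \<nu>)"
      using nq' ct by (auto intro!: mult_mono)
    moreover have "\<Lambda> * (x4 / \<nu>) * 1 \<le> \<Lambda> * (x4 / \<nu>) * (1 + t)\<^sup>2"
      using \<Lambda>_pos \<nu>_pos t by (intro mult_left_mono) (auto simp: x4_def)
    ultimately have "2 * L * \<Lambda> * M * (1 + t) * norm (q t) + norm (- c t *\<^sub>R q' - 0) \<le>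
       2 * L * \<Lambda> * M * (1 + t) * ((1 + t) * (x4 / \<nu>)) + \<Lambda> * ((1 + t)\<^sup>2 * \<Lambda> * x4) + \<Lambda> * (x4 / \<nu>) * (1 + t)\<^sup>2"
      by (simp add: distrib_left)
    also have "\<dots> = Cv * (1 + t)\<^sup>2 * x4"
      using \<nu>_pos by (simp add: Cv_def power2_eq_square field_simps)
    finally show ?thesis .
  qed
  from approx_deriv_mono[OF d this] show ?thesis
    unfolding x4_def by (rule approx_deriv_cong) (rule eq)
qed

text \<open>The force that the difference of the two nonlinear coefficients, applied to A u, leaves
  in the equation of the remainder, seen through J.\<close>

definition forcing :: "nat \<Rightarrow> ('h \<Rightarrow> 'h) \<Rightarrow> (real \<Rightarrow> 'h) \<Rightarrow> real \<Rightarrow> 'h" where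
  "forcing n J v t = (c t - coef R v t) *\<^sub>R B n (B n (J (u t)))"

text \<open>The derivative of \<open>J (rem \<epsilon> v)\<close> without the contribution of u'',
  which is carried as the error in \<open>rem_approx_deriv\<close>.\<close>

definition rem_dt :: "real \<Rightarrow> ('h \<Rightarrow> 'h) \<Rightarrow> (real \<Rightarrow> 'h) \<Rightarrow> real \<Rightarrow> 'h" where
  "rem_dt \<epsilon> J v t = J (dt (dt v) t) + (b t / \<epsilon> * exp (- (G t / \<epsilon>))) *\<^sub>R J w0"

lemma rem_approx_deriv:
  assumes J: "admissible n J" and t: "t \<ge> 0" and \<epsilon>: "\<epsilon> > 0" and v: "controlled M \<epsilon> v"
  shows "approx_deriv (\<lambda>s. J (rem \<epsilon> v s)) (rem_dt \<epsilon> J v t)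
      (Cv * (1 + t)\<^sup>2 * norm (B n (B n (B n (B n (J (u t))))))) t"
proof -
  interpret J: bounded_linear J using J by (simp add: admissible_def)
  note v = hyperbolic_facts[OF v[unfolded controlled_def, THEN conjunct1]]
  have d1: "approx_deriv (\<lambda>s. J (dt v s)) (J (dt (dt v) t)) 0 t"
    by (rule approx_deriv_vector[OF admissible_deriv[OF J has_vector_derivative_right[OF v(9)[OF t] t]]])
  have "((\<lambda>s. - exp (- (G s / \<epsilon>))) has_real_derivative b t / \<epsilon> * exp (- (G t / \<epsilon>))) (at_right t)"
    using t \<epsilon> by (auto intro!: derivative_eq_intros damping_int_deriv)
  then have "approx_deriv (\<lambda>s. - exp (- (G s / \<epsilon>))) (b t / \<epsilon> * exp (- (G t / \<epsilon>))) 0 t"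
    by (intro approx_deriv_vector) (simp add: has_real_derivative_iff_has_vector_derivative)
  from approx_deriv_scaleR[OF this approx_deriv_const[of "J w0"]]
  have d2: "approx_deriv (\<lambda>s. - exp (- (G s / \<epsilon>)) *\<^sub>R J w0) ((b t / \<epsilon> * exp (- (G t / \<epsilon>))) *\<^sub>R J w0) 0 t" by simp
  have d3: "approx_deriv (\<lambda>s. - 1 *\<^sub>R J (dt u s)) 0 (Cv * (1 + t)\<^sup>2 * norm (B n (B n (B n (B n (J (u t))))))) t"
    using approx_deriv_scaleR[OF approx_deriv_const[of "-1"] approx_deriv_Ju'[OF J t]] by simp
  from approx_deriv_add[OF approx_deriv_add[OF d1 d2] d3]
  show ?thesis
    by (rule approx_deriv_cong[THEN approx_deriv_mono])
      (simp_all add: rem_def rem_dt_def J.diff J.scaleR)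
qed

text \<open>\<epsilon> times the corrector part of \<open>rem_dt\<close> equals - b times the
  corrector part of \<open>rem\<close>, so the corrector drops out. What remains of u' is b u',
  which the parabolic equation turns into - c A u.\<close>

lemma rem_equation:
  assumes J: "admissible n J" and t: "t \<ge> 0" and \<epsilon>: "\<epsilon> > 0" and v: "controlled M \<epsilon> v"
  shows "\<epsilon> *\<^sub>R rem_dt \<epsilon> J v t =
     - b t *\<^sub>R J (rem \<epsilon> v t) - coef R v t *\<^sub>R B n (B n (J (v t - u t))) + forcing n J v t"
proof -
  interpret J: bounded_linear J using J by (simp add: admissible_def)
  interpret Bn: bounded_linear "B n" by (rule B_bl)
  note sol = v[unfolded controlled_def, THEN conjunct1]
  note vf = hyperbolic_facts[OF sol]
  have "\<epsilon> *\<^sub>R J (dt (dt v) t) = J (\<epsilon> *\<^sub>R dt (dt v) t)" by (simp add: J.scaleR)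
  also have "\<dots> = - b t *\<^sub>R J (dt v t) - coef R v t *\<^sub>R J (A (v t))"
    unfolding vf(10)[OF t] coef_eq[OF v t] by (simp add: J.diff J.scaleR J.neg)
  also have "J (A (v t)) = B n (B n (J (v t)))" by (rule admissible_A[OF J vf(6)[OF t]])
  finally have 1: "\<epsilon> *\<^sub>R J (dt (dt v) t) = - b t *\<^sub>R J (dt v t) - coef R v t *\<^sub>R B n (B n (J (v t)))" .
  have "b t *\<^sub>R J (dt u t) = J (b t *\<^sub>R dt u t)" by (simp add: J.scaleR)
  also have "\<dots> = - c t *\<^sub>R J (A (u t))" unfolding u_eq[OF t] by (simp add: J.scaleR J.neg)
  also have "J (A (u t)) = B n (B n (J (u t)))" by (rule admissible_A[OF J u_D[OF t]])
  finally have 2: "c t *\<^sub>R B n (B n (J (u t))) = - b t *\<^sub>R J (dt u t)" by simp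
  show ?thesis
    unfolding rem_dt_def rem_def forcing_def
    using \<epsilon> by (simp add: 1 2 scaleR_add_right J.diff J.scaleR Bn.diff scaleR_diff_right scaleR_diff_left)
qed

lemma coef_diff:
  assumes t: "t \<ge> 0" and v: "controlled M \<epsilon> v"
  shows "(c t - coef R v t)\<^sup>2 \<le> 4 * L\<^sup>2 * R * (norm (Q (v t - u t)))\<^sup>2"
proof -
  note vf = hyperbolic_facts[OF v[unfolded controlled_def, THEN conjunct1]]
  have D: "u t \<in> Dh" "v t \<in> Dh" using u_D[OF t] vf(6)[OF t] D_imp_Dh by auto
  define x y z where "x = norm (Q (u t))" and "y = norm (Q (v t))" and "z = norm (Q (v t - u t))"
  have xy: "x\<^sup>2 \<le> R" "y\<^sup>2 \<le> R" using Qu_le[OF t] Qv_le[OF v t] by (auto simp: x_def y_def)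
  have "\<bar>x - y\<bar> \<le> z"
    unfolding x_def y_def z_def Dh_linear(5)[OF D(2,1)] by (metis norm_minus_commute norm_triangle_ineq3)
  moreover have "(x + y)\<^sup>2 \<le> 4 * R"
  proof -
    have "(x + y)\<^sup>2 \<le> 2 * x\<^sup>2 + 2 * y\<^sup>2" using two_mult_le_weighted[of 1 x y] by (simp add: power2_sum)
    then show ?thesis using xy by simp
  qed
  ultimately have "(x\<^sup>2 - y\<^sup>2)\<^sup>2 \<le> z\<^sup>2 * (4 * R)"
  proof -
    assume 1: "\<bar>x - y\<bar> \<le> z" and 2: "(x + y)\<^sup>2 \<le> 4 * R"
    have "(x\<^sup>2 - y\<^sup>2)\<^sup>2 = (\<bar>x - y\<bar>)\<^sup>2 * (x + y)\<^sup>2" by (simp add: power2_eq_square algebra_simps)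
    also have "\<dots> \<le> z\<^sup>2 * (4 * R)" using 1 2 by (intro mult_mono power_mono) auto
    finally show ?thesis .
  qed
  have "dist (m (x\<^sup>2)) (m (y\<^sup>2)) \<le> L * dist (x\<^sup>2) (y\<^sup>2)" using xy by (intro lipschitz_onD[OF L_lip']) auto
  moreover have "c t = m (x\<^sup>2)" "coef R v t = m (y\<^sup>2)"
    using coef_eq[OF v t] by (auto simp: c_def x_def y_def)
  ultimately have "\<bar>c t - coef R v t\<bar> \<le> L * \<bar>x\<^sup>2 - y\<^sup>2\<bar>" by (simp add: dist_real_def)
  then have "(\<bar>c t - coef R v t\<bar>)\<^sup>2 \<le> (L * \<bar>x\<^sup>2 - y\<^sup>2\<bar>)\<^sup>2" by (rule power_mono) simp
  also have "\<dots> = L\<^sup>2 * (x\<^sup>2 - y\<^sup>2)\<^sup>2" by (simp add: power_mult_distrib)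
  also have "\<dots> \<le> L\<^sup>2 * (z\<^sup>2 * (4 * R))" using \<open>(x\<^sup>2 - y\<^sup>2)\<^sup>2 \<le> z\<^sup>2 * (4 * R)\<close> by (intro mult_left_mono) auto
  finally show ?thesis by (simp add: z_def mult_ac)
qed

end

context kirchhoff_bounds
begin

text \<open>The factor exp 2 is the price of replacing \<open>weight_corr\<close> by W.\<close>

definition F :: real where "F = exp 2 * forcing_const \<kappa> \<mu> \<nu> \<Lambda>"
definition Cf :: real where "Cf = F * (4 * L\<^sup>2 * R) * (K\<^sup>2 / \<nu>) * C5"
text \<open>The factor 2 \<nu> / \<omega> inverts the dissipation rate of
  \<open>parabolic_dissipation\<close> for l = \<omega> / 2, so Cz times this dissipation is exactly
  the bound of \<open>acceleration_bound\<close>.\<close>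

definition Cz :: real where "Cz = F * Cv\<^sup>2 * C5 * (2 * \<nu> / \<omega>)"
definition Ce :: real where "Ce = (2 * F + Cz) * K\<^sup>2"

lemma F_nonneg: "0 \<le> F"
  unfolding F_def forcing_const_def using \<Lambda>_pos \<nu>_pos pos by (intro mult_nonneg_nonneg add_nonneg_nonneg) auto

lemma Cf_nonneg: "0 \<le> Cf"
  unfolding Cf_def using F_nonneg R_nonneg \<nu>_pos C5_pos by auto

lemma Cz_nonneg: "0 \<le> Cz"
  unfolding Cz_def using F_nonneg \<nu>_pos C5_pos pos by auto

lemma Ce_nonneg: "0 \<le> Ce"
  unfolding Ce_def using F_nonneg Cz_nonneg by auto

text \<open>The decay exp (- \<omega> t) of the parabolic factor pays for 1 / b and leaves exp (-
  \<omega> t / 2), an integrable kernel for the Gronwall argument in |Q (v - u)|^2.\<close>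

lemma forcing_bound:
  assumes J: "admissible n J" and t: "t \<ge> 0" and v: "controlled M \<epsilon> v"
    and K: "norm (B n (B n (B n (J u0)))) \<le> K"
  shows "F * (W t * ((norm (forcing n J v t))\<^sup>2 / b t)) \<le> Cf * (exp (- (\<omega> / 2 * t)) * (W t * (norm (Q (v t - u t)))\<^sup>2))"
proof -
  define z where "z = (norm (Q (v t - u t)))\<^sup>2"
  define x2 where "x2 = (norm (B n (B n (J (u t)))))\<^sup>2"
  note J2 = admissible_B_comp[OF admissible_B_comp[OF J]]
  have e: "exp (- (\<omega> * t)) * exp (\<omega> / 2 * t) = exp (- (\<omega> / 2 * t))" by (simp flip: exp_add)
  have W: "1 \<le> W t" by (rule W_ge_1[OF t])
  have x2: "x2 \<le> K\<^sup>2 / \<nu> * exp (- (\<omega> * t))"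
  proof -
    define y where "y = (norm (B n (B n (B n (J (u t))))))\<^sup>2"
    have "exp (\<omega> * t) * y \<le> W t * (exp (\<omega> * t) * y)"
      using mult_right_mono[OF W, of "exp (\<omega> * t) * y"] by (simp add: y_def)
    also have "\<dots> \<le> (norm (B n (B n (B n (J u0)))))\<^sup>2"
      unfolding y_def by (rule parabolic_decay[OF admissible_B_comp[OF J2] t])
    also have "\<dots> \<le> K\<^sup>2" using K by (intro power_mono) auto
    finally have "exp (- (\<omega> * t)) * (exp (\<omega> * t) * y) \<le> exp (- (\<omega> * t)) * K\<^sup>2" by (intro mult_left_mono) auto
    then have "y \<le> exp (- (\<omega> * t)) * K\<^sup>2" by (simp add: mult.assoc[symmetric] flip: exp_add)
    moreover have "\<nu> * x2 \<le> y" unfolding x2_def y_def by (rule admissible_coercive[OF J2])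
    ultimately show ?thesis using \<nu>_pos by (simp add: field_simps)
  qed
  have "(norm (forcing n J v t))\<^sup>2 = (c t - coef R v t)\<^sup>2 * x2"
    by (simp add: forcing_def power_mult_distrib x2_def)
  also have "\<dots> \<le> (4 * L\<^sup>2 * R * z) * (K\<^sup>2 / \<nu> * exp (- (\<omega> * t)))"
    using coef_diff[OF t v] x2 R_nonneg by (intro mult_mono) (auto simp: z_def x2_def)
  finally have "(norm (forcing n J v t))\<^sup>2 * (1 / b t) \<le> (4 * L\<^sup>2 * R * z) * (K\<^sup>2 / \<nu> * exp (- (\<omega> * t))) * (1 + t)"
    using b_inv[OF t] b_pos[OF t] R_nonneg \<nu>_pos by (intro mult_mono) (auto simp: z_def)
  also have "\<dots> \<le> (4 * L\<^sup>2 * R * z) * (K\<^sup>2 / \<nu> * exp (- (\<omega> * t))) * (C5 * exp (\<omega> / 2 * t))"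
  proof (rule mult_left_mono)
    have "1 + t \<le> (1 + t) ^ 5" using t by (intro self_le_power) auto
    then show "1 + t \<le> C5 * exp (\<omega> / 2 * t)" using C5[OF t] by simp
  qed (use R_nonneg \<nu>_pos in \<open>auto simp: z_def\<close>)
  also have "\<dots> = (4 * L\<^sup>2 * R) * (K\<^sup>2 / \<nu>) * C5 * (exp (- (\<omega> / 2 * t)) * z)"
    unfolding e[symmetric] by (simp only: mult_ac)
  finally have "F * W t * ((norm (forcing n J v t))\<^sup>2 / b t) \<le> F * W t * ((4 * L\<^sup>2 * R) * (K\<^sup>2 / \<nu>) * C5 * (exp (- (\<omega> / 2 * t)) * z))"
    using F_nonneg W by (intro mult_left_mono) auto
  then show ?thesis by (simp add: Cf_def z_def mult_ac)
qed

text \<open>With g = G / \<epsilon>, the square of z gives exp (- 2 g), division by the rate loses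
  exp (g / 2), and the weight together with 1 / b loses exp ((\<beta> + 2) G) \<le> exp (g / 2). The
  remaining b exp (- g) is \<epsilon> times the derivative of - exp (- g), so the right side has an
  integral of order \<epsilon>^2.\<close>

lemma corrector_bound:
  assumes t: "t \<ge> 0" and \<epsilon>: "small \<epsilon>" and z: "z \<le> K * exp (- (G t / \<epsilon>))" "0 \<le> z"
  shows "W t * (z\<^sup>2 / rate_corr \<epsilon> t + \<epsilon>\<^sup>2 * z\<^sup>2) \<le> 2 * K\<^sup>2 * (\<epsilon> * (b t * exp (- (G t / \<epsilon>))))"
proof -
  have e0: "0 < \<epsilon>" "\<epsilon> \<le> 1" and sm: "\<epsilon> * energy_smallness \<kappa> \<mu> \<nu> \<Lambda> \<beta> \<le> 1" using \<epsilon> by (auto simp: small_def)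
  have bt: "0 < b t" "b t \<le> 1" using b_pos b_le_1 t by auto
  have G0: "0 \<le> G t" by (rule damping_int_nonneg[OF p t])
  define g where "g = G t / \<epsilon>"
  have gg: "G t / (2 * \<epsilon>) = g / 2" by (simp add: g_def)
  have g0: "0 \<le> g" using G0 e0 by (simp add: g_def)
  have z2: "z\<^sup>2 \<le> K\<^sup>2 * exp (- (2 * g))"
  proof -
    have "z\<^sup>2 \<le> (K * exp (- g))\<^sup>2" using z by (intro power_mono) (auto simp: g_def)
    also have "\<dots> = K\<^sup>2 * exp (- (2 * g))" by (simp add: power_mult_distrib power2_eq_square flip: exp_add)
    finally show ?thesis .
  qed
  \<comment> \<open>Trading 1 / b for b exp (2 G) produces the factor b that makes the bound an
    exact derivative.\<close>
  have binv: "1 / b t \<le> b t * exp (2 * G t)"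
  proof -
    have "1 / b t \<le> exp (G t)" using b_inv[OF t] exp_damping_int[OF p t] by simp
    then have "(1 / b t) * (1 / b t) \<le> exp (G t) * exp (G t)" using bt by (intro mult_mono) auto
    then have "b t * ((1 / b t) * (1 / b t)) \<le> b t * (exp (G t) * exp (G t))" using bt by (intro mult_left_mono) auto
    then show ?thesis using bt by (simp flip: exp_add)
  qed
  have r: "1 / rate_corr \<epsilon> t = \<epsilon> * (1 / b t) * exp (g / 2)"
    unfolding rate_corr_def gg exp_minus using bt e0 by (simp add: field_simps)
  have e2: "\<epsilon>\<^sup>2 \<le> \<epsilon> * (1 / b t) * exp (g / 2)"
  proof -
    have "\<epsilon> * \<epsilon> \<le> \<epsilon> * ((1 / b t) * exp (g / 2))"
    proof (rule mult_left_mono)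
      have "1 * 1 \<le> (1 / b t) * exp (g / 2)" using bt g0 by (intro mult_mono) auto
      then show "\<epsilon> \<le> (1 / b t) * exp (g / 2)" using e0 by simp
    qed (use e0 in simp)
    then show ?thesis by (simp add: power2_eq_square)
  qed
  have "z\<^sup>2 / rate_corr \<epsilon> t + \<epsilon>\<^sup>2 * z\<^sup>2 = z\<^sup>2 * (1 / rate_corr \<epsilon> t + \<epsilon>\<^sup>2)" by (simp add: algebra_simps)
  also have "\<dots> \<le> (K\<^sup>2 * exp (- (2 * g))) * (2 * (\<epsilon> * (1 / b t) * exp (g / 2)))"
    using z2 e2 r by (intro mult_mono) (use e0 bt in auto)
  finally have "W t * (z\<^sup>2 / rate_corr \<epsilon> t + \<epsilon>\<^sup>2 * z\<^sup>2) \<le>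
      exp (\<beta> * G t) * ((K\<^sup>2 * exp (- (2 * g))) * (2 * (\<epsilon> * (b t * exp (2 * G t)) * exp (g / 2))))"
  proof (rule order_trans[OF mult_left_mono])
    show "0 \<le> W t" using W_pos[OF t] by simp
    show "W t * ((K\<^sup>2 * exp (- (2 * g))) * (2 * (\<epsilon> * (1 / b t) * exp (g / 2)))) \<le>
      exp (\<beta> * G t) * ((K\<^sup>2 * exp (- (2 * g))) * (2 * (\<epsilon> * (b t * exp (2 * G t)) * exp (g / 2))))"
    proof (rule mult_mono[OF W_le[OF t]])
      show "(K\<^sup>2 * exp (- (2 * g))) * (2 * (\<epsilon> * (1 / b t) * exp (g / 2))) \<le>
         (K\<^sup>2 * exp (- (2 * g))) * (2 * (\<epsilon> * (b t * exp (2 * G t)) * exp (g / 2)))"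
        using binv e0 by (intro mult_left_mono mult_right_mono) auto
    qed (use e0 bt in auto)
  qed
  also have "\<dots> = 2 * K\<^sup>2 * (\<epsilon> * (b t * exp (\<beta> * G t + - (2 * g) + 2 * G t + g / 2)))"
    by (simp only: exp_add mult_ac)
  also have "\<dots> \<le> 2 * K\<^sup>2 * (\<epsilon> * (b t * exp (- g)))"
  proof -
    have "(\<beta> + 2) \<le> 1 / (2 * \<epsilon>)"
      using energy_smallness_parts(4)[OF pos(1) \<nu>_pos \<Lambda>_pos(1) \<kappa>_pos pos(3) e0(1) sm] e0 by (simp add: field_simps)
    then have "(\<beta> + 2) * G t \<le> 1 / (2 * \<epsilon>) * G t" using G0 by (rule mult_right_mono)
    then have "\<beta> * G t + - (2 * g) + 2 * G t + g / 2 \<le> - g" by (simp add: g_def field_simps)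
    then show ?thesis using e0 bt by (intro mult_left_mono) auto
  qed
  finally show ?thesis by (simp add: g_def)
qed

lemma acceleration_bound:
  assumes t: "t \<ge> 0"
  shows "F * (W t * ((Cv * (1 + t)\<^sup>2 * x)\<^sup>2 / b t)) \<le> F * Cv\<^sup>2 * C5 * (W t * (exp (\<omega> / 2 * t) * x\<^sup>2))"
proof -
  have "(Cv * (1 + t)\<^sup>2 * x)\<^sup>2 / b t = Cv\<^sup>2 * x\<^sup>2 * ((1 + t) ^ 4 * (1 / b t))"
    by (simp add: power_mult_distrib flip: power_mult)
  also have "\<dots> \<le> Cv\<^sup>2 * x\<^sup>2 * ((1 + t) ^ 4 * (1 + t))"
    using b_inv[OF t] t by (intro mult_left_mono) auto
  also have "(1 + t) ^ 4 * (1 + t) = (1 + t) ^ 5" by (simp add: eval_nat_numeral)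
  also have "Cv\<^sup>2 * x\<^sup>2 * (1 + t) ^ 5 \<le> Cv\<^sup>2 * x\<^sup>2 * (C5 * exp (\<omega> / 2 * t))"
    using C5[OF t] by (intro mult_left_mono) auto
  finally have "F * W t * ((Cv * (1 + t)\<^sup>2 * x)\<^sup>2 / b t) \<le> F * W t * (Cv\<^sup>2 * x\<^sup>2 * (C5 * exp (\<omega> / 2 * t)))"
    using F_nonneg W_pos[OF t] by (intro mult_left_mono) auto
  then show ?thesis by (simp add: mult_ac)
qed

text \<open>The purpose of the corrector: its initial slope removes the mismatch between u1 and the
  slope of the parabolic solution.\<close>

lemma rem_0: "controlled M \<epsilon> v \<Longrightarrow> rem \<epsilon> v 0 = 0"
proof -
  assume v: "controlled M \<epsilon> v"
  have "dt u 0 = - c 0 *\<^sub>R A u0" using u'_eq[of 0] by (simp add: damping_def u_0)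
  then show ?thesis using hyperbolic_facts(2)[OF v[unfolded controlled_def, THEN conjunct1]]
    by (simp add: rem_def w0_def)
qed

lemma rem_cont:
  assumes "controlled M \<epsilon> v" "\<epsilon> > 0"
  shows "continuous_on {0..} (rem \<epsilon> v)"
  unfolding rem_def[abs_def] using \<open>\<epsilon> > 0\<close>
  by (intro continuous_intros damping_int_cont hyperbolic_facts(3)[OF assms(1)[unfolded controlled_def, THEN conjunct1]] u'_cont) auto

text \<open>The dissipation of the parabolic solution absorbs the term coming from the (only Lipschitz
  continuous) derivative \<open>u'\<close>; the nonlinear term is controlled by the non-truncated remainder,
  which is estimated by \<open>\<Phi>\<close>.\<close>

lemma remainder_energy:
  assumes J: "admissible n J" and \<epsilon>: "small \<epsilon>" and v: "controlled M \<epsilon> v" and T: "T \<ge> 0"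
    and K: "norm (B n (B n (B n (J u0)))) \<le> K" "norm (B n (J w0)) \<le> K"
    and \<Phi>: "\<And>t. t \<ge> 0 \<Longrightarrow> (\<Phi> has_real_derivative \<phi> t) (at t within {0..})"
    and \<phi>: "\<And>t. 0 \<le> t \<Longrightarrow> t < T \<Longrightarrow>
        Cf * (exp (- (\<omega> / 2 * t)) * (W t * (norm (Q (v t - u t)))\<^sup>2)) \<le> \<phi> t"
  shows "W T * ((norm (B n (J (v T - u T))))\<^sup>2 + \<epsilon> * (norm (J (rem \<epsilon> v T)))\<^sup>2 / (2 * \<Lambda>)) \<le> \<Phi> T - \<Phi> 0 + Ce * \<epsilon>\<^sup>2"
proof -
  interpret J: bounded_linear J using J by (simp add: admissible_def)
  interpret Bn: bounded_linear "B n" by (rule B_bl)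
  have e0: "0 < \<epsilon>" "\<epsilon> \<le> 1" and sm: "\<epsilon> * energy_smallness \<kappa> \<mu> \<nu> \<Lambda> \<beta> \<le> 1"
    and sm2: "\<epsilon> * (L * (2 * (sqrt (c0 * M) * sqrt M))) \<le> \<mu> / 4" using \<epsilon> by (auto simp: small_def)
  note sol = v[unfolded controlled_def, THEN conjunct1]
  note vf = hyperbolic_facts[OF sol]
  define cc where "cc = coef R v"
  have cc: "\<mu> \<le> cc s" "cc s \<le> \<Lambda>" for s using cv by (auto simp: cc_def)
  define y where "y s = J (v s - u s)" for s
  define w where "w s = J (rem \<epsilon> v s)" for s
  define Y where "Y = (\<lambda>s. weight_corr \<epsilon> s * energy \<kappa> \<epsilon> (b s) (cc s) (y s) (w s) (B n (y s)))"
  define x4 where "x4 t = norm (B n (B n (B n (B n (J (u t))))))" for t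
  define Z where "Z = (\<lambda>s. W s * (exp (\<omega> / 2 * s) * (norm (B n (B n (B n (J (u s))))))\<^sup>2))"
  note J3 = admissible_B_comp[OF admissible_B_comp[OF admissible_B_comp[OF J]]]
  define \<psi> where "\<psi> t = F * Cv\<^sup>2 * C5 * (W t * (exp (\<omega> / 2 * t) * (x4 t)\<^sup>2))" for t
  have dY: "dini_le Y (\<phi> t + \<epsilon>\<^sup>2 * \<psi> t + 2 * K\<^sup>2 * F * (\<epsilon> * (b t * exp (- (G t / \<epsilon>))))) t" if t: "0 \<le> t" "t < T" for t
  proof -
    define z where "z = exp (- (G t / \<epsilon>)) *\<^sub>R J w0"
    define V where "V = Cv * (1 + t)\<^sup>2 * x4 t"
    have V0: "0 \<le> V" using Cv_nonneg by (simp add: V_def x4_def)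
    have "dini_le Y (weight_corr \<epsilon> t * (forcing_const \<kappa> \<mu> \<nu> \<Lambda> * ((norm (forcing n J v t))\<^sup>2 / b t + \<epsilon>\<^sup>2 * V\<^sup>2 / b t
         + (norm (B n z))\<^sup>2 / rate_corr \<epsilon> t + \<epsilon>\<^sup>2 * (norm (B n z))\<^sup>2))) t"
      unfolding Y_def
    proof (rule energy_dini[OF B_bl B_sym t(1) e0(1) sm])
      show "\<mu> \<le> cc s" "cc s \<le> \<Lambda>" for s by (rule cc)+
      show "approx_deriv cc 0 (L * \<bar>2 * inner (A (v t)) (dt v t)\<bar>) t"
        unfolding cc_def by (rule coef_approx_deriv[OF sol L_lip' R_nonneg t(1)])
      have "\<epsilon> * (L * \<bar>2 * inner (A (v t)) (dt v t)\<bar>) \<le> b t * (\<mu> / 4)"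
        using v t e0 by (intro coef_slow[OF _ _ t(1) L_nonneg e0(1) sm2]) (auto simp: controlled_def)
      also have "\<dots> \<le> b t * (cc t / 4)" using cc(1)[of t] b_pos[OF t(1)] by (intro mult_left_mono) auto
      finally show "\<epsilon> * (L * \<bar>2 * inner (A (v t)) (dt v t)\<bar>) \<le> b t * cc t / 4" by simp
      have "((\<lambda>s. v s - u s) has_vector_derivative dt v t - dt u t) (at_right t)"
        by (intro has_vector_derivative_diff has_vector_derivative_right[OF vf(8)[OF t(1)] t(1)]
            has_vector_derivative_right[OF u_deriv[OF t(1)] t(1)])
      from approx_deriv_vector[OF admissible_deriv[OF J this]]
      show "approx_deriv y (w t + z) 0 t"
        by (simp add: y_def[abs_def] w_def z_def rem_def J.diff J.scaleR)
      show "approx_deriv w (rem_dt \<epsilon> J v t) V t"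
        using rem_approx_deriv[OF J t(1) e0(1) v] by (simp add: w_def[abs_def] V_def x4_def)
      show "\<epsilon> *\<^sub>R rem_dt \<epsilon> J v t = - b t *\<^sub>R w t - cc t *\<^sub>R B n (B n (y t)) + forcing n J v t"
        using rem_equation[OF J t(1) e0(1) v] by (simp add: w_def cc_def y_def)
      show "\<nu> * (norm (y t))\<^sup>2 \<le> (norm (B n (y t)))\<^sup>2" unfolding y_def by (rule admissible_coercive[OF J])
      show "\<nu> * (norm z)\<^sup>2 \<le> (norm (B n z))\<^sup>2"
        using admissible_coercive[OF J, of "exp (- (G t / \<epsilon>)) *\<^sub>R w0"] by (simp add: z_def J.scaleR)
    qed (use L_nonneg V0 in auto)
    then show ?thesis
    proof (rule dini_le_mono)
      define X where "X = (norm (forcing n J v t))\<^sup>2 / b t + \<epsilon>\<^sup>2 * V\<^sup>2 / b t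
         + (norm (B n z))\<^sup>2 / rate_corr \<epsilon> t + \<epsilon>\<^sup>2 * (norm (B n z))\<^sup>2"
      have X0: "0 \<le> X" unfolding X_def using b_pos[OF t(1)] e0 by (auto simp: rate_corr_def intro!: add_nonneg_nonneg)
      have fc: "0 \<le> forcing_const \<kappa> \<mu> \<nu> \<Lambda>" using F_nonneg by (simp add: F_def zero_le_mult_iff)
      have "weight_corr \<epsilon> t * (forcing_const \<kappa> \<mu> \<nu> \<Lambda> * X) \<le> (exp 2 * W t) * (forcing_const \<kappa> \<mu> \<nu> \<Lambda> * X)"
        using weight_corr_bounds(2)[OF t(1) e0(1)] fc X0 by (intro mult_right_mono) auto
      also have "\<dots> = F * (W t * X)" by (simp add: F_def)
      also have "\<dots> = F * (W t * ((norm (forcing n J v t))\<^sup>2 / b t)) + \<epsilon>\<^sup>2 * (F * (W t * (V\<^sup>2 / b t)))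
         + F * (W t * ((norm (B n z))\<^sup>2 / rate_corr \<epsilon> t + \<epsilon>\<^sup>2 * (norm (B n z))\<^sup>2))"
        by (simp add: X_def algebra_simps)
      also have "\<dots> \<le> \<phi> t + \<epsilon>\<^sup>2 * \<psi> t + F * (2 * K\<^sup>2 * (\<epsilon> * (b t * exp (- (G t / \<epsilon>)))))"
      proof (intro add_mono mult_left_mono)
        show "F * (W t * ((norm (forcing n J v t))\<^sup>2 / b t)) \<le> \<phi> t"
          by (rule order_trans[OF forcing_bound[OF J t(1) v K(1)] \<phi>[OF t]])
        show "F * (W t * (V\<^sup>2 / b t)) \<le> \<psi> t"
          unfolding V_def \<psi>_def by (rule acceleration_bound[OF t(1)])
        have "norm (B n z) = exp (- (G t / \<epsilon>)) * norm (B n (J w0))" by (simp add: z_def Bn.scaleR)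
        also have "\<dots> \<le> exp (- (G t / \<epsilon>)) * K" using K(2) by (intro mult_left_mono) auto
        finally show "W t * ((norm (B n z))\<^sup>2 / rate_corr \<epsilon> t + \<epsilon>\<^sup>2 * (norm (B n z))\<^sup>2) \<le>
           2 * K\<^sup>2 * (\<epsilon> * (b t * exp (- (G t / \<epsilon>))))"
          by (intro corrector_bound[OF t(1) \<epsilon>]) (auto simp: mult.commute)
      qed (use F_nonneg in auto)
      finally show "weight_corr \<epsilon> t * (forcing_const \<kappa> \<mu> \<nu> \<Lambda> * ((norm (forcing n J v t))\<^sup>2 / b t + \<epsilon>\<^sup>2 * V\<^sup>2 / b t
         + (norm (B n z))\<^sup>2 / rate_corr \<epsilon> t + \<epsilon>\<^sup>2 * (norm (B n z))\<^sup>2)) \<le>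
         \<phi> t + \<epsilon>\<^sup>2 * \<psi> t + 2 * K\<^sup>2 * F * (\<epsilon> * (b t * exp (- (G t / \<epsilon>))))"
        by (simp add: X_def mult_ac)
    qed
  qed
  \<comment> \<open>Cz times the dissipation of Z is \<psi>, so adding
    \<open>\<epsilon>\<^sup>2 * Cz * Z s\<close> cancels the term with \<psi> in
    \<open>dY\<close>.\<close>
  define \<Psi> where "\<Psi> = (\<lambda>s. Y s + \<epsilon>\<^sup>2 * Cz * Z s)"
  \<comment> \<open>The exponential term is a primitive of the corrector contribution; exp (- G /
    \<epsilon>) changes by at most 1, whence the order \<epsilon>^2.\<close>
  define g where "g = (\<lambda>s. \<Phi> s - 2 * K\<^sup>2 * F * \<epsilon>\<^sup>2 * exp (- (G s / \<epsilon>)))"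
  have ycont: "continuous_on {0..} y" and wcont: "continuous_on {0..} w" and Bycont: "continuous_on {0..} (\<lambda>s. B n (y s))"
    unfolding y_def[abs_def] w_def[abs_def]
    by (intro J.continuous_on Bn.continuous_on rem_cont v e0 continuous_intros vf(5) u_cont)+
  have cccont: "continuous_on {0..} cc" unfolding cc_def by (rule coef_continuous[OF sol L_lip' R_nonneg])
  have ccne: "\<forall>x\<in>{0..}. cc x \<noteq> 0" using cc(1) pos by (metis less_le_trans less_irrefl)
  have "continuous_on {0..} Y" unfolding Y_def energy_def
    by (intro continuous_intros weight_corr_cont e0 b_cont ycont wcont Bycont cccont ccne)
  moreover have "continuous_on {0..} Z" unfolding Z_def by (rule W_cont_nonneg[OF J3])
  ultimately have \<Psi>cont: "continuous_on {0..} \<Psi>" unfolding \<Psi>_def by (intro continuous_intros)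
  have "\<Psi> T - \<Psi> 0 \<le> g T - g 0"
  proof (rule dini_le_integrate[OF \<Psi>cont T])
    fix t assume t: "0 \<le> t" "t < T"
    have "\<omega> / 2 \<le> \<omega>" "0 \<le> \<omega> / 2" using pos by auto
    from parabolic_dissipation[OF J3 t(1) this(2,1)]
    have dZ: "dini_le Z (- (\<omega> / (2 * \<nu>)) * (W t * (exp (\<omega> / 2 * t) * (x4 t)\<^sup>2))) t"
      by (simp add: Z_def x4_def)
    have "dini_le (\<lambda>s. \<epsilon>\<^sup>2 * Cz * Z s) (- (\<epsilon>\<^sup>2 * \<psi> t)) t"
      unfolding dini_le_def
    proof (intro allI impI)
      fix e :: real assume e: "e > 0"
      define k where "k = \<epsilon>\<^sup>2 * Cz"
      have k: "0 \<le> k" using Cz_nonneg by (simp add: k_def)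
      then have "e / (k + 1) > 0" using e by simp
      from dZ[unfolded dini_le_def, rule_format, OF this] eventually_at_right_near[OF zero_less_one, of t]
      show "\<forall>\<^sub>F s in at_right t. \<epsilon>\<^sup>2 * Cz * Z s - \<epsilon>\<^sup>2 * Cz * Z t \<le> (- (\<epsilon>\<^sup>2 * \<psi> t) + e) * (s - t)"
      proof eventually_elim
        case (elim s)
        define D where "D = - (\<omega> / (2 * \<nu>)) * (W t * (exp (\<omega> / 2 * t) * (x4 t)\<^sup>2))"
        have kD: "k * D = - (\<epsilon>\<^sup>2 * \<psi> t)" using \<nu>_pos pos by (simp add: k_def D_def \<psi>_def Cz_def)
        have "k * (Z s - Z t) \<le> k * ((D + e / (k + 1)) * (s - t))"
          using elim k by (intro mult_left_mono) (auto simp: D_def)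
        also have "\<dots> = (k * D + k * (e / (k + 1))) * (s - t)" by (simp add: algebra_simps)
        also have "\<dots> \<le> (- (\<epsilon>\<^sup>2 * \<psi> t) + e) * (s - t)"
          unfolding kD using elim k e by (intro mult_right_mono) (auto simp: field_simps)
        finally show ?case by (simp add: k_def algebra_simps)
      qed
    qed
    from dini_le_add[OF dY[OF t] this]
    show "dini_le \<Psi> (\<phi> t + 2 * K\<^sup>2 * F * (\<epsilon> * (b t * exp (- (G t / \<epsilon>))))) t"
      by (simp add: \<Psi>_def)
  next
    fix t :: real assume t: "0 \<le> t"
    show "(g has_real_derivative \<phi> t + 2 * K\<^sup>2 * F * (\<epsilon> * (b t * exp (- (G t / \<epsilon>))))) (at t within {0..})"
      unfolding g_def using e0 t
      by (auto intro!: derivative_eq_intros \<Phi> damping_int_deriv simp: field_simps power2_eq_square)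
  qed
  moreover have "g T - g 0 \<le> \<Phi> T - \<Phi> 0 + 2 * F * K\<^sup>2 * \<epsilon>\<^sup>2"
  proof -
    have "0 \<le> 2 * K\<^sup>2 * F * \<epsilon>\<^sup>2 * exp (- (G T / \<epsilon>))" using F_nonneg by auto
    then show ?thesis by (simp add: g_def mult_ac)
  qed
  moreover have "\<Psi> 0 \<le> Cz * K\<^sup>2 * \<epsilon>\<^sup>2"
  proof -
    \<comment> \<open>The difference and r' both vanish at time 0, so the initial energy is 0 and
      only Z contributes.\<close>
    have "y 0 = 0" by (simp add: y_def vf(1) u_0 J.zero)
    moreover have "w 0 = 0" by (simp add: w_def rem_0[OF v] J.zero)
    ultimately have "Y 0 = 0" by (simp add: Y_def energy_def Bn.zero)
    moreover have "Z 0 \<le> K\<^sup>2" unfolding Z_def using K(1) by (auto simp: W_0 u_0 intro!: power_mono)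
    then have "\<epsilon>\<^sup>2 * Cz * Z 0 \<le> \<epsilon>\<^sup>2 * Cz * K\<^sup>2" using Cz_nonneg by (intro mult_left_mono) auto
    ultimately show ?thesis by (simp add: \<Psi>_def mult_ac)
  qed
  moreover have "Y T \<le> \<Psi> T"
  proof -
    have "0 \<le> \<epsilon>\<^sup>2 * Cz * Z T" using Cz_nonneg W_pos[OF T] by (auto simp: Z_def)
    then show ?thesis by (simp add: \<Psi>_def)
  qed
  moreover have "W T * ((norm (B n (y T)))\<^sup>2 + \<epsilon> * (norm (w T))\<^sup>2 / (2 * \<Lambda>)) \<le> Y T"
  proof -
    have ccT: "0 < cc T" using cc(1)[of T] pos by simp
    have "(norm (B n (y T)))\<^sup>2 + \<epsilon> * (norm (w T))\<^sup>2 / (2 * \<Lambda>) \<le> (norm (B n (y T)))\<^sup>2 + \<epsilon> * (norm (w T))\<^sup>2 / (2 * cc T)"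
      using cc(2)[of T] ccT e0 by (intro add_left_mono divide_left_mono) auto
    also have "\<dots> \<le> energy \<kappa> \<epsilon> (b T) (cc T) (y T) (w T) (B n (y T))"
      using energy_smallness_parts(3)[OF pos(1) \<nu>_pos \<Lambda>_pos(1) \<kappa>_pos pos(3) e0(1) sm] b_pos[OF T]
      by (intro energy_coercive[OF \<kappa>_pos e0(1) ccT cc(2)]) auto
    finally have "W T * ((norm (B n (y T)))\<^sup>2 + \<epsilon> * (norm (w T))\<^sup>2 / (2 * \<Lambda>)) \<le>
       weight_corr \<epsilon> T * energy \<kappa> \<epsilon> (b T) (cc T) (y T) (w T) (B n (y T))"
      using weight_corr_bounds[OF T e0(1)] W_pos[OF T] e0 \<Lambda>_pos by (intro mult_mono) auto
    then show ?thesis by (simp add: Y_def)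
  qed
  ultimately have "W T * ((norm (B n (y T)))\<^sup>2 + \<epsilon> * (norm (w T))\<^sup>2 / (2 * \<Lambda>)) \<le>
     \<Phi> T - \<Phi> 0 + 2 * F * K\<^sup>2 * \<epsilon>\<^sup>2 + Cz * K\<^sup>2 * \<epsilon>\<^sup>2" by linarith
  then show ?thesis by (simp add: Ce_def y_def w_def algebra_simps)
qed

end

context kirchhoff_bounds
begin

text \<open>The Gronwall constant: 2 / \<omega> is the integral of exp (- \<omega> s / 2) over the
  half-line, and Ce + 1 instead of Ce leaves room for a strict inequality.\<close>

definition C0 :: real where "C0 = (Ce + 1) * exp (2 * Cf / \<omega>)"
definition C1 :: real where "C1 = Ce + 2 / \<omega> * (Cf * C0)"
text \<open>The factor 3 is that of (x + y + z)^2 \<le> 3 (x^2 + y^2 + z^2), with x, y, z the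
  contributions of A (v - u), of the nonlinear force and of \<epsilon> u''.\<close>

definition C2 :: real where "C2 = 3 * (\<Lambda>\<^sup>2 * C1 + 4 * L\<^sup>2 * R * M * C0 + Cv\<^sup>2 * C5 * K\<^sup>2)"

lemma C_nonneg: "0 \<le> C0" "0 \<le> C1" "0 \<le> C2"
proof -
  show C0: "0 \<le> C0" using Ce_nonneg by (simp add: C0_def)
  show C1: "0 \<le> C1" using Ce_nonneg Cf_nonneg C0 pos by (simp add: C1_def)
  show "0 \<le> C2" using C0 C1 R_nonneg M_nonneg C5_pos by (simp add: C2_def)
qed

lemma exp_decay_deriv:
  "((\<lambda>s. exp (- (\<omega> / 2 * s))) has_real_derivative - (\<omega> / 2) * exp (- (\<omega> / 2 * t))) (at t within S)"
  by (auto intro!: derivative_eq_intros)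

lemma difference_facts:
  assumes v: "controlled M \<epsilon> v"
  shows "t \<ge> 0 \<Longrightarrow> v t - u t \<in> D" "continuous_on {0..} (\<lambda>t. (norm (Q (v t - u t)))\<^sup>2)"
proof -
  note vf = hyperbolic_facts[OF v[unfolded controlled_def, THEN conjunct1]]
  show D: "t \<ge> 0 \<Longrightarrow> v t - u t \<in> D" for t using D_diff vf(6) u_D by blast
  have "continuous_on {0..} (\<lambda>t. A (v t) - A (u t))" by (intro continuous_intros vf(4) Au_cont)
  then have A: "continuous_on {0..} (\<lambda>t. A (v t - u t))"
    by (rule continuous_on_eq) (simp add: A_diff vf(6) u_D)
  show "continuous_on {0..} (\<lambda>t. (norm (Q (v t - u t)))\<^sup>2)"
    unfolding continuous_on_eq_continuous_within
  proof
    fix t :: real assume "t \<in> {0..}"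
    then have t: "t \<ge> 0" by simp
    have "((\<lambda>s. v s - u s) has_vector_derivative dt v t - dt u t) (at t within {0..})"
      by (intro has_vector_derivative_diff vf(8) u_deriv t)
    from Q_square_deriv[OF this t D A]
    show "continuous (at t within {0..}) (\<lambda>t. (norm (Q (v t - u t)))\<^sup>2)" by (rule DERIV_continuous)
  qed
qed

text \<open>The energy estimate concerns truncations, while its force contains the full norm of Q (v
  - u). The Gronwall argument is therefore closed by continuation after the limit in n, with a
  majorant \<Phi> that solves \<Phi>' = Cf exp (- \<omega> t / 2) \<Phi>.\<close>

lemma remainder_level_0:
  assumes \<epsilon>: "small \<epsilon>" and v: "controlled M \<epsilon> v" and t: "t \<ge> 0"
    and K: "\<And>n. norm (B n (B n (B n u0))) \<le> K" "\<And>n. norm (B n w0) \<le> K"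
  shows "W t * (norm (Q (v t - u t)))\<^sup>2 \<le> C0 * \<epsilon>\<^sup>2"
    and "\<epsilon> * (W t * (norm (rem \<epsilon> v t))\<^sup>2) \<le> 2 * \<Lambda> * C0 * \<epsilon>\<^sup>2"
proof -
  have e0: "0 < \<epsilon>" using \<epsilon> by (simp add: small_def)
  define \<Phi> where "\<Phi> s = (Ce + 1) * \<epsilon>\<^sup>2 * exp (2 * Cf / \<omega> * (1 - exp (- (\<omega> / 2 * s))))" for s
  have \<Phi>0: "\<Phi> 0 = (Ce + 1) * \<epsilon>\<^sup>2" by (simp add: \<Phi>_def)
  have d\<Phi>: "(\<Phi> has_real_derivative Cf * (exp (- (\<omega> / 2 * t)) * \<Phi> t)) (at t within {0..})" for t
    unfolding \<Phi>_def[abs_def] using pos by (auto intro!: derivative_eq_intros simp: field_simps)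
  have PK: "norm (B n (B n (B n (P n u0)))) \<le> K" "norm (B n (P n w0)) \<le> K" for n
    using K by (auto simp: BP)
  have en: "W T * ((norm (B n (v T - u T)))\<^sup>2 + \<epsilon> * (norm (P n (rem \<epsilon> v T)))\<^sup>2 / (2 * \<Lambda>)) \<le> \<Phi> T - \<epsilon>\<^sup>2"
    if T: "0 \<le> T" and le: "\<And>t. 0 \<le> t \<Longrightarrow> t < T \<Longrightarrow> W t * (norm (Q (v t - u t)))\<^sup>2 \<le> \<Phi> t" for n T
  proof -
    have "W T * ((norm (B n (P n (v T - u T))))\<^sup>2 + \<epsilon> * (norm (P n (rem \<epsilon> v T)))\<^sup>2 / (2 * \<Lambda>)) \<le> \<Phi> T - \<Phi> 0 + Ce * \<epsilon>\<^sup>2"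
      by (rule remainder_energy[OF admissible_P \<epsilon> v T PK d\<Phi>])
        (intro mult_left_mono le Cf_nonneg, auto)
    then show ?thesis by (simp add: BP \<Phi>0 algebra_simps)
  qed
  have X: "W T * (norm (Q (v T - u T)))\<^sup>2 < \<Phi> T" if T: "0 \<le> T" for T
  proof (rule continuation[OF _ _ _ T])
    show "continuous_on {0..} (\<lambda>T. W T * (norm (Q (v T - u T)))\<^sup>2)"
      by (intro continuous_intros W_cont difference_facts(2)[OF v])
    show "continuous_on {0..} \<Phi>"
      unfolding continuous_on_eq_continuous_within using d\<Phi> DERIV_continuous by blast
    fix T :: real assume T: "0 \<le> T" and le: "\<And>t. 0 \<le> t \<Longrightarrow> t < T \<Longrightarrow> W t * (norm (Q (v t - u t)))\<^sup>2 \<le> \<Phi> t"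
    have "W T * (norm (Q (v T - u T)))\<^sup>2 \<le> \<Phi> T - \<epsilon>\<^sup>2"
    proof (rule LIMSEQ_le_const2)
      show "(\<lambda>n. W T * (norm (B n (v T - u T)))\<^sup>2) \<longlonglongrightarrow> W T * (norm (Q (v T - u T)))\<^sup>2"
        by (intro tendsto_intros B_tendsto D_imp_Dh difference_facts(1)[OF v T])
      have "W T * (norm (B n (v T - u T)))\<^sup>2 \<le> \<Phi> T - \<epsilon>\<^sup>2" for n
      proof -
        have "0 \<le> W T * (\<epsilon> * (norm (P n (rem \<epsilon> v T)))\<^sup>2 / (2 * \<Lambda>))"
          using W_pos[OF T] e0 \<Lambda>_pos by auto
        then show ?thesis using en[OF T le, of n] by (simp add: distrib_left)
      qed
      then show "\<exists>N. \<forall>n\<ge>N. W T * (norm (B n (v T - u T)))\<^sup>2 \<le> \<Phi> T - \<epsilon>\<^sup>2" by blast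
    qed
    also have "\<dots> < \<Phi> T" using e0 by simp
    finally show "W T * (norm (Q (v T - u T)))\<^sup>2 < \<Phi> T" .
  qed
  have \<Phi>_le: "\<Phi> t \<le> C0 * \<epsilon>\<^sup>2" for t
  proof -
    have "2 * Cf / \<omega> * (1 - exp (- (\<omega> / 2 * t))) \<le> 2 * Cf / \<omega> * 1"
      using Cf_nonneg pos by (intro mult_left_mono) auto
    then have "(Ce + 1) * \<epsilon>\<^sup>2 * exp (2 * Cf / \<omega> * (1 - exp (- (\<omega> / 2 * t)))) \<le> (Ce + 1) * \<epsilon>\<^sup>2 * exp (2 * Cf / \<omega>)"
      using Ce_nonneg by (intro mult_left_mono) auto
    then show ?thesis by (simp add: \<Phi>_def C0_def mult_ac)
  qed
  show "W t * (norm (Q (v t - u t)))\<^sup>2 \<le> C0 * \<epsilon>\<^sup>2" using X[OF t] \<Phi>_le[of t] by linarith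
  show "\<epsilon> * (W t * (norm (rem \<epsilon> v t))\<^sup>2) \<le> 2 * \<Lambda> * C0 * \<epsilon>\<^sup>2"
  proof (rule LIMSEQ_le_const2)
    show "(\<lambda>n. \<epsilon> * (W t * (norm (P n (rem \<epsilon> v t)))\<^sup>2)) \<longlonglongrightarrow> \<epsilon> * (W t * (norm (rem \<epsilon> v t))\<^sup>2)"
      by (intro tendsto_intros P_tendsto)
    have "\<epsilon> * (W t * (norm (P n (rem \<epsilon> v t)))\<^sup>2) \<le> 2 * \<Lambda> * C0 * \<epsilon>\<^sup>2" for n
    proof -
      have "0 \<le> W t * (norm (B n (v t - u t)))\<^sup>2" using W_pos[OF t] by simp
      moreover have "W t * ((norm (B n (v t - u t)))\<^sup>2 + \<epsilon> * (norm (P n (rem \<epsilon> v t)))\<^sup>2 / (2 * \<Lambda>)) \<le> \<Phi> t - \<epsilon>\<^sup>2"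
        by (rule en[OF t less_imp_le[OF X]])
      ultimately have "W t * (\<epsilon> * (norm (P n (rem \<epsilon> v t)))\<^sup>2 / (2 * \<Lambda>)) \<le> \<Phi> t - \<epsilon>\<^sup>2"
        by (simp add: distrib_left)
      also have "\<dots> \<le> C0 * \<epsilon>\<^sup>2" using \<Phi>_le[of t] zero_le_power2[of \<epsilon>] by linarith
      finally show ?thesis using \<Lambda>_pos by (simp add: field_simps)
    qed
    then show "\<exists>N. \<forall>n\<ge>N. \<epsilon> * (W t * (norm (P n (rem \<epsilon> v t)))\<^sup>2) \<le> 2 * \<Lambda> * C0 * \<epsilon>\<^sup>2" by blast
  qed
qed

text \<open>The force is already bounded by the lower level, so \<Phi> is an explicit primitive and
  no Gronwall argument remains. The uniform bounds on \<open>B n (rem \<epsilon> v t)\<close> also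
  prove, through \<open>Dh_iff\<close>, that r' lies in Dh.\<close>

lemma remainder_level_1:
  assumes \<epsilon>: "small \<epsilon>" and v: "controlled M \<epsilon> v" and t: "t \<ge> 0"
    and K: "\<And>n. norm (B n (B n (B n (B n u0)))) \<le> K" "\<And>n. norm (B n (B n w0)) \<le> K"
    and lev0: "\<And>t. t \<ge> 0 \<Longrightarrow> W t * (norm (Q (v t - u t)))\<^sup>2 \<le> C0 * \<epsilon>\<^sup>2"
  shows "W t * (norm (A (v t - u t)))\<^sup>2 \<le> C1 * \<epsilon>\<^sup>2"
    and "rem \<epsilon> v t \<in> Dh" and "\<epsilon> * (W t * (norm (Q (rem \<epsilon> v t)))\<^sup>2) \<le> 2 * \<Lambda> * C1 * \<epsilon>\<^sup>2"
proof -
  have e0: "0 < \<epsilon>" using \<epsilon> by (simp add: small_def)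
  define \<Phi> where "\<Phi> s = - (2 / \<omega>) * (Cf * (C0 * \<epsilon>\<^sup>2)) * exp (- (\<omega> / 2 * s))" for s
  have d\<Phi>: "(\<Phi> has_real_derivative Cf * (exp (- (\<omega> / 2 * t)) * (C0 * \<epsilon>\<^sup>2))) (at t within {0..})" for t
    unfolding \<Phi>_def[abs_def] using pos
    by (auto intro!: derivative_eq_intros exp_decay_deriv simp: field_simps)
  have en: "W t * ((norm (B n (B n (v t - u t))))\<^sup>2 + \<epsilon> * (norm (B n (rem \<epsilon> v t)))\<^sup>2 / (2 * \<Lambda>)) \<le> C1 * \<epsilon>\<^sup>2" for n
  proof -
    have "W t * ((norm (B n (B n (v t - u t))))\<^sup>2 + \<epsilon> * (norm (B n (rem \<epsilon> v t)))\<^sup>2 / (2 * \<Lambda>)) \<le> \<Phi> t - \<Phi> 0 + Ce * \<epsilon>\<^sup>2"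
      by (rule remainder_energy[OF admissible_B \<epsilon> v t K d\<Phi>])
        (intro mult_left_mono lev0 Cf_nonneg, auto)
    also have "\<Phi> t - \<Phi> 0 \<le> 2 / \<omega> * (Cf * (C0 * \<epsilon>\<^sup>2))"
    proof -
      have "\<Phi> t \<le> 0" unfolding \<Phi>_def using Cf_nonneg C_nonneg pos by (auto intro!: mult_nonneg_nonneg divide_nonneg_nonneg)
      then show ?thesis by (simp add: \<Phi>_def)
    qed
    finally show ?thesis by (simp add: C1_def algebra_simps)
  qed
  have 1: "W t * (norm (B n (B n (v t - u t))))\<^sup>2 \<le> C1 * \<epsilon>\<^sup>2" for n
  proof -
    have "0 \<le> W t * (\<epsilon> * (norm (B n (rem \<epsilon> v t)))\<^sup>2 / (2 * \<Lambda>))" using W_pos[OF t] e0 \<Lambda>_pos by auto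
    then show ?thesis using en[of n] by (simp add: distrib_left)
  qed
  have 2: "\<epsilon> * (W t * (norm (B n (rem \<epsilon> v t)))\<^sup>2) \<le> 2 * \<Lambda> * C1 * \<epsilon>\<^sup>2" for n
  proof -
    have "0 \<le> W t * (norm (B n (B n (v t - u t))))\<^sup>2" using W_pos[OF t] by simp
    then have "W t * (\<epsilon> * (norm (B n (rem \<epsilon> v t)))\<^sup>2 / (2 * \<Lambda>)) \<le> C1 * \<epsilon>\<^sup>2" using en[of n] by (simp add: distrib_left)
    then show ?thesis using \<Lambda>_pos by (simp add: field_simps)
  qed
  show "W t * (norm (A (v t - u t)))\<^sup>2 \<le> C1 * \<epsilon>\<^sup>2"
  proof (rule LIMSEQ_le_const2)
    show "(\<lambda>n. W t * (norm (B n (B n (v t - u t))))\<^sup>2) \<longlonglongrightarrow> W t * (norm (A (v t - u t)))\<^sup>2"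
      by (intro tendsto_intros BB_tendsto difference_facts(1)[OF v t])
  qed (use 1 in blast)
  show Dh: "rem \<epsilon> v t \<in> Dh"
    unfolding Dh_iff
  proof (rule exI[of _ "sqrt (2 * \<Lambda> * C1 * \<epsilon>)"], intro allI real_le_rsqrt)
    fix n
    have "\<epsilon> * (1 * (norm (B n (rem \<epsilon> v t)))\<^sup>2) \<le> \<epsilon> * (W t * (norm (B n (rem \<epsilon> v t)))\<^sup>2)"
      using W_ge_1[OF t] e0 by (intro mult_left_mono mult_right_mono) auto
    also note 2[of n]
    finally show "(norm (B n (rem \<epsilon> v t)))\<^sup>2 \<le> 2 * \<Lambda> * C1 * \<epsilon>"
      using e0 by (simp add: power2_eq_square[of \<epsilon>])
  qed
  show "\<epsilon> * (W t * (norm (Q (rem \<epsilon> v t)))\<^sup>2) \<le> 2 * \<Lambda> * C1 * \<epsilon>\<^sup>2"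
  proof (rule LIMSEQ_le_const2)
    show "(\<lambda>n. \<epsilon> * (W t * (norm (B n (rem \<epsilon> v t)))\<^sup>2)) \<longlonglongrightarrow> \<epsilon> * (W t * (norm (Q (rem \<epsilon> v t)))\<^sup>2)"
      by (intro tendsto_intros B_tendsto Dh)
  qed (use 2 in blast)
qed

text \<open>The energy controls only \<epsilon> |r'|^2. Here r' is regarded as the solution of a
  first order equation with damping b / \<epsilon> and a force which, with the weight, is of order
  \<epsilon> before division by \<epsilon>. The stationary size of r' is that force divided by b,
  which explains the factor b^2.\<close>

lemma remainder_derivative:
  assumes \<epsilon>: "small \<epsilon>" and v: "controlled M \<epsilon> v" and T: "T \<ge> 0"
    and K: "\<And>n. norm (B n (B n (B n (B n u0)))) \<le> K"
    and lev0: "\<And>t. t \<ge> 0 \<Longrightarrow> W t * (norm (Q (v t - u t)))\<^sup>2 \<le> C0 * \<epsilon>\<^sup>2"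
    and lev1: "\<And>t. t \<ge> 0 \<Longrightarrow> W t * (norm (A (v t - u t)))\<^sup>2 \<le> C1 * \<epsilon>\<^sup>2"
  shows "W T * (b T)\<^sup>2 * (norm (rem \<epsilon> v T))\<^sup>2 \<le> 2 * C2 * \<epsilon>\<^sup>2"
proof -
  have e0: "0 < \<epsilon>" "\<epsilon> \<le> 1" and sm: "\<epsilon> * energy_smallness \<kappa> \<mu> \<nu> \<Lambda> \<beta> \<le> 1" using \<epsilon> by (auto simp: small_def)
  have eb: "\<epsilon> * \<beta> \<le> 1 / 2"
    using energy_smallness_parts(4)[OF pos(1) \<nu>_pos \<Lambda>_pos(1) \<kappa>_pos pos(3) e0(1) sm] e0 by (simp add: algebra_simps)
  note vf = hyperbolic_facts[OF v[unfolded controlled_def, THEN conjunct1]]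
  have trunc: "W T * (b T)\<^sup>2 * (norm (P n (rem \<epsilon> v T)))\<^sup>2 \<le> 2 * C2 * \<epsilon>\<^sup>2" for n
  proof -
    interpret Pn: bounded_linear "P n" by (rule P_bl)
    define w where "w s = P n (rem \<epsilon> v s)" for s
    define g where "g s = W s * (b s)\<^sup>2 * (norm (w s))\<^sup>2" for s
    \<comment> \<open>Young's inequality leaves the damping b g / \<epsilon>: half of it is the rate
      of the integrating factor, and the other half pays for the growth of W. The level 2 C2
      \<epsilon>^2 is where this balances the force.\<close>
    define h where "h s = exp (G s / (2 * \<epsilon>)) * (g s - 2 * C2 * \<epsilon>\<^sup>2)" for s
    have "h T \<le> h 0"
    proof (rule dini_le_nonincreasing[OF _ T])
      show "continuous_on {0..} h"
        unfolding h_def[abs_def] g_def w_def using e0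
        by (intro continuous_intros damping_int_cont W_cont b_cont Pn.continuous_on rem_cont[OF v]) auto
      fix t assume t: "0 \<le> t" "t < T"
      define V where "V = Cv * (1 + t)\<^sup>2 * norm (B n (B n (B n (B n (P n (u t))))))"
      define w1 where "w1 = rem_dt \<epsilon> (P n) v t"
      define X where "X = \<Lambda> * norm (A (v t - u t)) + norm (forcing n (P n) v t) + \<epsilon> * V"
      have bt: "0 < b t" "b t \<le> 1" using b_pos b_le_1 t by auto
      have Wt: "1 \<le> W t" using W_ge_1 t by simp
      have V0: "0 \<le> V" using Cv_nonneg by (simp add: V_def)
      have X0: "0 \<le> X" using \<Lambda>_pos V0 e0 by (simp add: X_def)
      have dw: "approx_deriv w w1 V t"
        using rem_approx_deriv[OF admissible_P t(1) e0(1) v] by (simp add: w_def[abs_def] w1_def V_def)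
      have ew1: "\<epsilon> *\<^sub>R w1 = - b t *\<^sub>R w t - coef R v t *\<^sub>R B n (B n (P n (v t - u t))) + forcing n (P n) v t"
        using rem_equation[OF admissible_P t(1) e0(1) v] by (simp add: w_def w1_def)
      define S where "S = 2 * inner (w t) w1 + 2 * norm (w t) * V"
      have dn: "approx_deriv (\<lambda>s. (norm (w s))\<^sup>2) (2 * inner (w t) w1) (2 * norm (w t) * V) t"
        using approx_deriv_inner[OF dw dw] by (simp add: dot_square_norm inner_commute algebra_simps)
      have eS: "\<epsilon> * S \<le> - b t * (norm (w t))\<^sup>2 + X\<^sup>2 / b t"
      proof -
        have "\<epsilon> * S = 2 * inner (w t) (\<epsilon> *\<^sub>R w1) + 2 * norm (w t) * (\<epsilon> * V)" by (simp add: S_def algebra_simps)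
        also have "inner (w t) (\<epsilon> *\<^sub>R w1) = - b t * (norm (w t))\<^sup>2 +
            inner (w t) (forcing n (P n) v t - coef R v t *\<^sub>R B n (B n (P n (v t - u t))))"
          unfolding ew1 by (simp add: inner_add_right inner_diff_right dot_square_norm)
        also have "inner (w t) (forcing n (P n) v t - coef R v t *\<^sub>R B n (B n (P n (v t - u t)))) \<le>
            norm (w t) * (\<Lambda> * norm (A (v t - u t)) + norm (forcing n (P n) v t))"
        proof (rule order_trans[OF norm_cauchy_schwarz mult_left_mono])
          have "norm (coef R v t *\<^sub>R B n (B n (P n (v t - u t)))) \<le> \<Lambda> * norm (A (v t - u t))"
            using cv[of v t] pos norm_BB_le[OF difference_facts(1)[OF v t(1)], of n]
            by (auto simp: BP intro!: mult_mono)
          then show "norm (forcing n (P n) v t - coef R v t *\<^sub>R B n (B n (P n (v t - u t)))) \<le>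
              \<Lambda> * norm (A (v t - u t)) + norm (forcing n (P n) v t)"
            using norm_triangle_ineq4[of "forcing n (P n) v t" "coef R v t *\<^sub>R B n (B n (P n (v t - u t)))"] by linarith
        qed simp
        finally have "\<epsilon> * S \<le> - 2 * b t * (norm (w t))\<^sup>2 + 2 * norm (w t) * X" by (simp add: X_def algebra_simps)
        also have "2 * norm (w t) * X \<le> b t * (norm (w t))\<^sup>2 + X\<^sup>2 / b t" by (rule two_mult_le_weighted[OF bt(1)])
        finally show ?thesis by simp
      qed
      have WX: "W t * X\<^sup>2 \<le> C2 * \<epsilon>\<^sup>2"
      proof -
        define x y z where "x = \<Lambda> * norm (A (v t - u t))" and "y = norm (forcing n (P n) v t)" and "z = \<epsilon> * V"
        have "X\<^sup>2 \<le> 3 * (x\<^sup>2 + y\<^sup>2 + z\<^sup>2)"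
        proof -
          have "2 * (x * y) \<le> x\<^sup>2 + y\<^sup>2" "2 * (x * z) \<le> x\<^sup>2 + z\<^sup>2" "2 * (y * z) \<le> y\<^sup>2 + z\<^sup>2"
            using two_mult_le_weighted[of 1 x y] two_mult_le_weighted[of 1 x z] two_mult_le_weighted[of 1 y z] by auto
          moreover have "X\<^sup>2 = x\<^sup>2 + y\<^sup>2 + z\<^sup>2 + 2 * (x * y) + 2 * (x * z) + 2 * (y * z)"
            by (simp add: X_def x_def y_def z_def power2_eq_square algebra_simps)
          ultimately show ?thesis by argo
        qed
        then have "W t * X\<^sup>2 \<le> W t * (3 * (x\<^sup>2 + y\<^sup>2 + z\<^sup>2))" using Wt by (intro mult_left_mono) auto
        also have "\<dots> = 3 * (W t * x\<^sup>2 + W t * y\<^sup>2 + W t * z\<^sup>2)" by (simp add: algebra_simps)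
        also have "\<dots> \<le> 3 * (\<Lambda>\<^sup>2 * (C1 * \<epsilon>\<^sup>2) + 4 * L\<^sup>2 * R * M * (C0 * \<epsilon>\<^sup>2) + \<epsilon>\<^sup>2 * (Cv\<^sup>2 * C5 * K\<^sup>2))"
        proof (intro mult_left_mono add_mono)
          have "W t * x\<^sup>2 = \<Lambda>\<^sup>2 * (W t * (norm (A (v t - u t)))\<^sup>2)" by (simp add: x_def power_mult_distrib)
          also have "\<dots> \<le> \<Lambda>\<^sup>2 * (C1 * \<epsilon>\<^sup>2)" by (intro mult_left_mono lev1 t) auto
          finally show "W t * x\<^sup>2 \<le> \<Lambda>\<^sup>2 * (C1 * \<epsilon>\<^sup>2)" .
          have BBu: "(norm (B n (B n (u t))))\<^sup>2 \<le> M"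
          proof -
            have "norm (B n (B n (u t))) \<le> norm (A u0)"
              using norm_BB_le[OF u_D[OF t(1)], of n] Au_bound[OF t(1)] by linarith
            then show ?thesis by (intro order_trans[OF power_mono M_ge]) auto
          qed
          have "y\<^sup>2 = (c t - coef R v t)\<^sup>2 * (norm (B n (B n (u t))))\<^sup>2"
            by (simp add: y_def forcing_def power_mult_distrib BP)
          also have "\<dots> \<le> (4 * L\<^sup>2 * R * (norm (Q (v t - u t)))\<^sup>2) * M"
            using coef_diff[OF t(1) v] BBu R_nonneg by (intro mult_mono) auto
          finally have "W t * y\<^sup>2 \<le> W t * ((4 * L\<^sup>2 * R * (norm (Q (v t - u t)))\<^sup>2) * M)" using Wt by (intro mult_left_mono) auto
          also have "\<dots> = 4 * L\<^sup>2 * R * M * (W t * (norm (Q (v t - u t)))\<^sup>2)" by simp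
          also have "\<dots> \<le> 4 * L\<^sup>2 * R * M * (C0 * \<epsilon>\<^sup>2)"
            using R_nonneg M_nonneg by (intro mult_left_mono lev0 t) auto
          finally show "W t * y\<^sup>2 \<le> 4 * L\<^sup>2 * R * M * (C0 * \<epsilon>\<^sup>2)" .
          define x4 where "x4 = (norm (B n (B n (B n (B n (P n (u t)))))))\<^sup>2"
          have x4: "W t * (exp (\<omega> * t) * x4) \<le> K\<^sup>2"
          proof -
            have "W t * (exp (\<omega> * t) * x4) \<le> (norm (B n (B n (B n (B n (P n u0))))))\<^sup>2"
              unfolding x4_def
              by (rule parabolic_decay[OF admissible_B_comp[OF admissible_B_comp[OF admissible_B_comp[OF
                      admissible_B_comp[OF admissible_P]]]] t(1)])
            also have "\<dots> \<le> K\<^sup>2" using K[of n] by (intro power_mono) (auto simp: BP)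
            finally show ?thesis .
          qed
          have "(1 + t) ^ 4 \<le> C5 * exp (\<omega> * t)"
          proof -
            have "(1 + t) ^ 4 \<le> (1 + t) ^ 5" using t by (intro power_increasing) auto
            also have "\<dots> \<le> C5 * exp (\<omega> / 2 * t)" by (rule C5[OF t(1)])
            also have "\<dots> \<le> C5 * exp (\<omega> * t)" using C5_pos pos t by (intro mult_left_mono) auto
            finally show ?thesis .
          qed
          then have "W t * V\<^sup>2 \<le> Cv\<^sup>2 * (C5 * exp (\<omega> * t)) * (W t * x4)"
          proof -
            assume *: "(1 + t) ^ 4 \<le> C5 * exp (\<omega> * t)"
            have "W t * V\<^sup>2 = Cv\<^sup>2 * (1 + t) ^ 4 * (W t * x4)"
              by (simp add: V_def x4_def power_mult_distrib flip: power_mult)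
            also have "\<dots> \<le> Cv\<^sup>2 * (C5 * exp (\<omega> * t)) * (W t * x4)"
              using * Wt by (intro mult_right_mono mult_left_mono) (auto simp: x4_def)
            finally show ?thesis .
          qed
          also have "\<dots> = Cv\<^sup>2 * C5 * (W t * (exp (\<omega> * t) * x4))" by simp
          also have "\<dots> \<le> Cv\<^sup>2 * C5 * K\<^sup>2" using x4 C5_pos by (intro mult_left_mono) auto
          finally have "\<epsilon>\<^sup>2 * (W t * V\<^sup>2) \<le> \<epsilon>\<^sup>2 * (Cv\<^sup>2 * C5 * K\<^sup>2)" by (intro mult_left_mono) auto
          then show "W t * z\<^sup>2 \<le> \<epsilon>\<^sup>2 * (Cv\<^sup>2 * C5 * K\<^sup>2)" by (simp add: z_def power_mult_distrib mult_ac)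
        qed simp
        also have "\<dots> = C2 * \<epsilon>\<^sup>2" by (simp add: C2_def algebra_simps)
        finally show ?thesis .
      qed
      define b' where "b' = - (p / (1 + t)) * b t"
      have b'0: "b' \<le> 0" using p t bt by (simp add: b'_def)
      have db: "approx_deriv b b' 0 t"
        using damping_deriv[OF t(1), of p "{t<..}"]
        by (intro approx_deriv_vector) (simp add: has_real_derivative_iff_has_vector_derivative b'_def)
      have db2: "approx_deriv (\<lambda>s. (b s)\<^sup>2) (2 * b t * b') 0 t"
        using approx_deriv_mult[OF db db] by (simp add: power2_eq_square mult_ac)
      have dW: "approx_deriv W (a t * W t) 0 t"
        using W_deriv[OF t(1)] by (intro approx_deriv_vector) (simp add: has_real_derivative_iff_has_vector_derivative)
      define nw where "nw = (norm (w t))\<^sup>2"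
      have dg: "approx_deriv g (W t * (b t)\<^sup>2 * (2 * inner (w t) w1) + (W t * (2 * b t * b') + a t * W t * (b t)\<^sup>2) * nw)
          (W t * (b t)\<^sup>2 * (2 * norm (w t) * V)) t"
        using approx_deriv_mult[OF approx_deriv_mult[OF dW db2] dn] Wt
        by (simp add: g_def[abs_def] nw_def abs_mult)
      have dg': "approx_deriv (\<lambda>s. g s - 2 * C2 * \<epsilon>\<^sup>2) (W t * (b t)\<^sup>2 * (2 * inner (w t) w1) + (W t * (2 * b t * b') + a t * W t * (b t)\<^sup>2) * nw)
          (W t * (b t)\<^sup>2 * (2 * norm (w t) * V)) t"
        using approx_deriv_add[OF dg approx_deriv_const[of "- (2 * C2 * \<epsilon>\<^sup>2)"]] by simp
      define e where "e = exp (G t / (2 * \<epsilon>))"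
      have epos: "0 < e" by (simp add: e_def)
      have de: "approx_deriv (\<lambda>s. exp (G s / (2 * \<epsilon>))) (b t / (2 * \<epsilon>) * e) 0 t"
        by (rule approx_deriv_vector)
          (use t e0 in \<open>auto simp: e_def simp flip: has_real_derivative_iff_has_vector_derivative
            intro!: derivative_eq_intros damping_int_deriv\<close>)
      have dh: "approx_deriv h (e * (W t * (b t)\<^sup>2 * (2 * inner (w t) w1) + (W t * (2 * b t * b') + a t * W t * (b t)\<^sup>2) * nw)
          + b t / (2 * \<epsilon>) * e * (g t - 2 * C2 * \<epsilon>\<^sup>2)) (e * (W t * (b t)\<^sup>2 * (2 * norm (w t) * V))) t"
        using approx_deriv_mult[OF de dg'] epos by (simp add: h_def[abs_def] e_def)
      have "W t * (b t)\<^sup>2 * S + (W t * (2 * b t * b') + a t * W t * (b t)\<^sup>2) * nw + b t / (2 * \<epsilon>) * (g t - 2 * C2 * \<epsilon>\<^sup>2) \<le> 0"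
      proof -
        have gt: "g t = W t * (b t)\<^sup>2 * nw" by (simp add: g_def nw_def)
        have g0: "0 \<le> g t" using Wt by (simp add: g_def)
        have i1: "\<epsilon> * (W t * (b t)\<^sup>2 * S) \<le> - b t * g t + b t * (C2 * \<epsilon>\<^sup>2)"
        proof -
          have "(W t * (b t)\<^sup>2) * (\<epsilon> * S) \<le> (W t * (b t)\<^sup>2) * (- b t * nw + X\<^sup>2 / b t)"
            unfolding nw_def using eS Wt by (intro mult_left_mono) auto
          also have "\<dots> = - b t * g t + b t * (W t * X\<^sup>2)" using bt by (simp add: gt field_simps power2_eq_square)
          also have "\<dots> \<le> - b t * g t + b t * (C2 * \<epsilon>\<^sup>2)" using WX bt by (intro add_left_mono mult_left_mono) auto
          finally show ?thesis by (simp add: mult_ac)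
        qed
        have i2: "(W t * (2 * b t * b')) * nw \<le> 0"
          using Wt bt b'0 by (intro mult_nonpos_nonneg mult_nonneg_nonpos) (auto simp: nw_def)
        have i3: "\<epsilon> * (a t * W t * (b t)\<^sup>2 * nw) \<le> b t / 2 * g t"
        proof -
          have "\<epsilon> * a t \<le> \<epsilon> * (\<beta> * b t)" using a(2)[OF t(1)] e0 by (intro mult_left_mono) auto
          also have "\<dots> \<le> 1 / 2 * b t" using mult_right_mono[OF eb, of "b t"] bt by simp
          finally have "(\<epsilon> * a t) * g t \<le> (1 / 2 * b t) * g t" using g0 by (rule mult_right_mono)
          then show ?thesis by (simp add: gt mult_ac)
        qed
        have i4: "\<epsilon> * (b t / (2 * \<epsilon>) * (g t - 2 * C2 * \<epsilon>\<^sup>2)) = b t / 2 * g t - b t * (C2 * \<epsilon>\<^sup>2)"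
          using e0 by (simp add: field_simps)
        have i2': "\<epsilon> * ((W t * (2 * b t * b')) * nw) \<le> 0" using i2 e0 by (simp add: mult_nonneg_nonpos)
        have "\<epsilon> * (W t * (b t)\<^sup>2 * S + (W t * (2 * b t * b') + a t * W t * (b t)\<^sup>2) * nw + b t / (2 * \<epsilon>) * (g t - 2 * C2 * \<epsilon>\<^sup>2))
          = \<epsilon> * (W t * (b t)\<^sup>2 * S) + \<epsilon> * ((W t * (2 * b t * b')) * nw) + \<epsilon> * (a t * W t * (b t)\<^sup>2 * nw)
            + \<epsilon> * (b t / (2 * \<epsilon>) * (g t - 2 * C2 * \<epsilon>\<^sup>2))"
          by (simp only: distrib_left distrib_right add.assoc)
        also have "\<dots> \<le> 0" using i1 i2' i3 unfolding i4 by linarith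
        finally show ?thesis using e0 by (simp add: mult_le_0_iff)
      qed
      then have "e * (W t * (b t)\<^sup>2 * S + (W t * (2 * b t * b') + a t * W t * (b t)\<^sup>2) * nw + b t / (2 * \<epsilon>) * (g t - 2 * C2 * \<epsilon>\<^sup>2)) \<le> 0"
        using epos by (simp add: mult_nonneg_nonpos)
      moreover have "e * (W t * (b t)\<^sup>2 * S + (W t * (2 * b t * b') + a t * W t * (b t)\<^sup>2) * nw + b t / (2 * \<epsilon>) * (g t - 2 * C2 * \<epsilon>\<^sup>2))
        = (e * (W t * (b t)\<^sup>2 * (2 * inner (w t) w1) + (W t * (2 * b t * b') + a t * W t * (b t)\<^sup>2) * nw)
          + b t / (2 * \<epsilon>) * e * (g t - 2 * C2 * \<epsilon>\<^sup>2)) + e * (W t * (b t)\<^sup>2 * (2 * norm (w t) * V))"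
        by (simp add: S_def algebra_simps)
      ultimately show "dini_le h 0 t" by (intro dini_le_approx[OF dh]) linarith
    qed
    moreover have "h 0 \<le> 0"
    proof -
      have "g 0 = 0" by (simp add: g_def w_def rem_0[OF v] Pn.zero)
      then show ?thesis using C_nonneg by (simp add: h_def)
    qed
    ultimately have "exp (G T / (2 * \<epsilon>)) * (g T - 2 * C2 * \<epsilon>\<^sup>2) \<le> 0" by (simp add: h_def)
    then have "g T \<le> 2 * C2 * \<epsilon>\<^sup>2" by (simp add: mult_le_0_iff)
    then show ?thesis by (simp add: g_def w_def)
  qed
  show ?thesis
  proof (rule LIMSEQ_le_const2)
    show "(\<lambda>n. W T * (b T)\<^sup>2 * (norm (P n (rem \<epsilon> v T)))\<^sup>2) \<longlonglongrightarrow> W T * (b T)\<^sup>2 * (norm (rem \<epsilon> v T))\<^sup>2"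
      by (intro tendsto_intros P_tendsto)
  qed (use trunc in blast)
qed

end

section \<open>Choice of the constants and the weighted error estimates\<close>

lemma (in kirchhoff_bounds) small_ex: "\<exists>\<epsilon>2>0. \<forall>\<epsilon>. 0 < \<epsilon> \<longrightarrow> \<epsilon> < \<epsilon>2 \<longrightarrow> small \<epsilon>"
proof -
  define x y where "x = energy_smallness \<kappa> \<mu> \<nu> \<Lambda> \<beta>" and "y = L * (2 * (sqrt (c0 * M) * sqrt M)) * (4 / \<mu>)"
  define N where "N = 1 + \<bar>x\<bar> + \<bar>y\<bar>"
  have N: "1 \<le> N" "x \<le> N" "y \<le> N" by (auto simp: N_def)
  have "small \<epsilon>" if \<epsilon>: "0 < \<epsilon>" "\<epsilon> < 1 / N" for \<epsilon>
  proof -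
    have \<epsilon>N: "\<epsilon> * z \<le> 1" if "z \<le> N" for z
    proof -
      have "\<epsilon> * z \<le> \<epsilon> * N" using that \<epsilon> by (intro mult_left_mono) auto
      also have "\<dots> \<le> 1" using \<epsilon> N(1) by (simp add: field_simps)
      finally show ?thesis .
    qed
    have "\<epsilon> * (L * (2 * (sqrt (c0 * M) * sqrt M)) * (4 / \<mu>)) \<le> 1"
      using \<epsilon>N[OF N(3)] by (simp only: y_def)
    then have "\<epsilon> * (L * (2 * (sqrt (c0 * M) * sqrt M))) \<le> \<mu> / 4" using pos by (simp add: field_simps)
    moreover have "\<epsilon> * energy_smallness \<kappa> \<mu> \<nu> \<Lambda> \<beta> \<le> 1" using \<epsilon>N[OF N(2)] by (simp only: x_def)
    ultimately show ?thesis using \<epsilon>N[OF N(1)] \<epsilon> by (simp add: small_def)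
  qed
  moreover have "0 < 1 / N" using N(1) by simp
  ultimately show ?thesis by blast
qed

context kirchhoff
begin

lemma bounds_ex:
  obtains M L C5 \<epsilon>1 where
    "kirchhoff_bounds D A \<nu> P B p \<mu> \<beta> \<omega> W a m u0 u1 u c0 M L C5" "0 < \<epsilon>1"
    "\<And>\<epsilon> v. 0 < \<epsilon> \<Longrightarrow> \<epsilon> < \<epsilon>1 \<Longrightarrow> hyperbolic_solution D A m p u0 u1 \<epsilon> v \<Longrightarrow> controlled M \<epsilon> v"
proof -
  obtain M1 \<epsilon>1 where \<epsilon>1: "0 < \<epsilon>1"
    and ctrl: "\<And>\<epsilon> v. 0 < \<epsilon> \<Longrightarrow> \<epsilon> < \<epsilon>1 \<Longrightarrow> hyperbolic_solution D A m p u0 u1 \<epsilon> v \<Longrightarrow> controlled M1 \<epsilon> v"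
    using hyperbolic_apriori by blast
  define M where "M = max M1 ((norm (A u0))\<^sup>2)"
  obtain L where L: "L-lipschitz_on {0..M / \<nu>} m" using locally_lipschitz_imp_lipschitz[OF m_lip] by blast
  obtain C5 where C5: "\<And>t. t \<ge> 0 \<Longrightarrow> (1 + t) ^ 5 \<le> C5 * exp (\<omega> / 2 * t)"
    using power_le_exp[of "\<omega> / 2" 5] pos by auto
  show ?thesis
  proof (rule that[OF _ \<epsilon>1])
    show "kirchhoff_bounds D A \<nu> P B p \<mu> \<beta> \<omega> W a m u0 u1 u c0 M L C5"
      by unfold_locales (use L C5 in \<open>auto simp: M_def\<close>)
    show "controlled M \<epsilon> v" if "0 < \<epsilon>" "\<epsilon> < \<epsilon>1" "hyperbolic_solution D A m p u0 u1 \<epsilon> v" for \<epsilon> v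
      using ctrl[OF that] unfolding controlled_def M_def by (meson max.coboundedI1)
  qed
qed

lemma weighted_le:
  assumes "t \<ge> 0" "W t * (b t)\<^sup>2 * x \<le> C * \<epsilon>\<^sup>2"
  shows "x \<le> C * \<epsilon>\<^sup>2 / (W t * (b t)\<^sup>2)"
  using assms W_pos[of t] b_pos[of t] by (simp add: field_simps)

text \<open>Weakens a bound to the factor W b^2, the one with which r' itself is estimated.\<close>

lemma weight_b_le:
  assumes "t \<ge> 0" "W t * x \<le> y" "0 \<le> x"
  shows "W t * (b t)\<^sup>2 * x \<le> y"
proof -
  have "(b t)\<^sup>2 \<le> 1" using b_pos[OF assms(1)] b_le_1[OF assms(1)] by (simp add: power_le_one)
  then have "(W t * x) * (b t)\<^sup>2 \<le> (W t * x) * 1" using W_pos[OF assms(1)] assms by (intro mult_left_mono) auto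
  then show ?thesis using assms(2) by (simp add: mult_ac)
qed

lemma norm_square_le: "x \<in> D \<Longrightarrow> (norm x)\<^sup>2 \<le> (norm (Q x))\<^sup>2 / \<nu>"
  using Q_coercive[OF D_imp_Dh, of x] \<nu>_pos by (simp add: field_simps)

lemma decay_error_r:
  assumes K: "\<exists>K. \<forall>n. norm (B n (B n (B n u0))) \<le> K"
  shows "\<exists>\<epsilon>1>0. \<exists>C. \<forall>\<epsilon> v t. 0 < \<epsilon> \<longrightarrow> \<epsilon> < \<epsilon>1 \<longrightarrow> hyperbolic_solution D A m p u0 u1 \<epsilon> v \<longrightarrow> 0 \<le> t \<longrightarrow>
    (norm (v t - u t))\<^sup>2 + (norm (Q (v t - u t)))\<^sup>2 + \<epsilon> * (norm (rem \<epsilon> v t))\<^sup>2 \<le> C * \<epsilon>\<^sup>2 / (W t * (b t)\<^sup>2)"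
proof -
  obtain K0 where K0: "\<And>n. norm (B n (B n (B n u0))) \<le> K0" using K by blast
  \<comment> \<open>Since w0 = u1 + c(0) A u0, one factor \<open>B n\<close> on w0 requires u1 in Dh
    and a bound on three factors on u0.\<close>
  define K1 where "K1 = max K0 (norm (Q u1) + c 0 * K0)"
  have c0: "0 \<le> c 0" using c_lower[of 0] pos by simp
  have KB: "norm (B n w0) \<le> K1" for n
  proof -
    have "norm (B n w0) \<le> norm (B n u1) + norm (c 0 *\<^sub>R B n (A u0))"
      unfolding w0_def by (simp add: linear_simps[OF B_bl] norm_triangle_ineq del: norm_scaleR)
    also have "\<dots> = norm (B n u1) + c 0 * norm (B n (B n (B n u0)))"
      using c0 by (simp add: admissible_A[OF admissible_B u0_D])
    also have "\<dots> \<le> norm (Q u1) + c 0 * K0" using c0 by (intro add_mono mult_left_mono norm_B_le u1_Dh K0)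
    finally show ?thesis by (simp add: K1_def)
  qed
  have K1: "\<And>n. norm (B n (B n (B n u0))) \<le> K1"
    using K0 by (auto simp: K1_def intro: max.coboundedI1)
  obtain M L C5 \<epsilon>1 where kb: "kirchhoff_bounds D A \<nu> P B p \<mu> \<beta> \<omega> W a m u0 u1 u c0 M L C5" and \<epsilon>1: "0 < \<epsilon>1"
    and ctrl: "\<And>\<epsilon> v. 0 < \<epsilon> \<Longrightarrow> \<epsilon> < \<epsilon>1 \<Longrightarrow> hyperbolic_solution D A m p u0 u1 \<epsilon> v \<Longrightarrow> controlled M \<epsilon> v"
    using bounds_ex by blast
  interpret kirchhoff_bounds D A \<nu> P B p \<mu> \<beta> \<omega> W a m u0 u1 u c0 M L C5 K1 by (rule kb)
  obtain \<epsilon>2 where \<epsilon>2: "0 < \<epsilon>2" "\<And>\<epsilon>. 0 < \<epsilon> \<Longrightarrow> \<epsilon> < \<epsilon>2 \<Longrightarrow> small \<epsilon>" using small_ex by blast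
  define C where "C = C0 / \<nu> + C0 + 2 * \<Lambda> * C0"
  have "(norm (v t - u t))\<^sup>2 + (norm (Q (v t - u t)))\<^sup>2 + \<epsilon> * (norm (rem \<epsilon> v t))\<^sup>2 \<le> C * \<epsilon>\<^sup>2 / (W t * (b t)\<^sup>2)"
    if \<epsilon>: "0 < \<epsilon>" "\<epsilon> < min \<epsilon>1 \<epsilon>2" and sol: "hyperbolic_solution D A m p u0 u1 \<epsilon> v" and t: "0 \<le> t" for \<epsilon> v t
  proof -
    have sm: "small \<epsilon>" using \<epsilon> \<epsilon>2 by simp
    have co: "controlled M \<epsilon> v" using \<epsilon> sol ctrl by simp
    note lev = remainder_level_0[OF sm co t K1 KB]
    define x where "x = (norm (Q (v t - u t)))\<^sup>2"
    have "W t * (norm (v t - u t))\<^sup>2 \<le> W t * (x / \<nu>)"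
      unfolding x_def using W_pos[OF t] by (intro mult_left_mono norm_square_le difference_facts(1)[OF co t]) auto
    also have "\<dots> = W t * x / \<nu>" by simp
    also have "\<dots> \<le> C0 * \<epsilon>\<^sup>2 / \<nu>" using lev(1) \<nu>_pos unfolding x_def by (intro divide_right_mono) auto
    finally have "W t * ((norm (v t - u t))\<^sup>2 + (norm (Q (v t - u t)))\<^sup>2 + \<epsilon> * (norm (rem \<epsilon> v t))\<^sup>2) \<le> C * \<epsilon>\<^sup>2"
      using lev by (simp add: C_def algebra_simps)
    from weighted_le[OF t weight_b_le[OF t this]] show ?thesis using \<epsilon> by simp
  qed
  moreover have "0 < min \<epsilon>1 \<epsilon>2" using \<epsilon>1 \<epsilon>2 by simp
  ultimately show ?thesis by blast
qed

lemma decay_error_c: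
  assumes K: "\<exists>K. \<forall>n. norm (B n (B n (B n (B n u0)))) \<le> K" and u1: "u1 \<in> D"
  shows "\<exists>\<epsilon>1>0. \<exists>C. \<forall>\<epsilon> v t. 0 < \<epsilon> \<longrightarrow> \<epsilon> < \<epsilon>1 \<longrightarrow> hyperbolic_solution D A m p u0 u1 \<epsilon> v \<longrightarrow> 0 \<le> t \<longrightarrow>
    (norm (v t - u t))\<^sup>2 + (norm (Q (v t - u t)))\<^sup>2 + (norm (A (v t - u t)))\<^sup>2 + (norm (rem \<epsilon> v t))\<^sup>2
      + \<epsilon> * (norm (Q (rem \<epsilon> v t)))\<^sup>2 \<le> C * \<epsilon>\<^sup>2 / (W t * (b t)\<^sup>2)"
proof -
  obtain K0 where K0: "\<And>n. norm (B n (B n (B n (B n u0)))) \<le> K0" using K by blast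
  define K1 where "K1 = norm (A u1) + c 0 * K0"
  \<comment> \<open>By coercivity, division by sqrt \<nu> passes to the level below, so K2 serves
    both level estimates.\<close>
  define K2 where "K2 = max K0 (max K1 (max (K0 / sqrt \<nu>) (K1 / sqrt \<nu>)))"
  have c0: "0 \<le> c 0" using c_lower[of 0] pos by simp
  have coer: "norm (B n x) \<le> norm (B n (B n x)) / sqrt \<nu>" for n x
  proof -
    have "(sqrt \<nu> * norm (B n x))\<^sup>2 \<le> (norm (B n (B n x)))\<^sup>2"
      using admissible_coercive[OF admissible_B, of n x] \<nu>_pos by (simp add: power_mult_distrib)
    then have "sqrt \<nu> * norm (B n x) \<le> norm (B n (B n x))" by (rule power2_le_imp_le) simp
    then show ?thesis using \<nu>_pos by (simp add: field_simps)
  qed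
  have KBB: "norm (B n (B n w0)) \<le> K1" for n
  proof -
    have "norm (B n (B n w0)) \<le> norm (B n (B n u1)) + norm (c 0 *\<^sub>R B n (B n (A u0)))"
      unfolding w0_def by (simp add: linear_simps[OF B_bl] norm_triangle_ineq del: norm_scaleR)
    also have "\<dots> = norm (B n (B n u1)) + c 0 * norm (B n (B n (B n (B n u0))))"
      using c0 by (simp add: admissible_A[OF admissible_B u0_D])
    also have "\<dots> \<le> norm (A u1) + c 0 * K0" using c0 by (intro add_mono mult_left_mono norm_BB_le u1 K0)
    finally show ?thesis by (simp add: K1_def)
  qed
  have le: "x / sqrt \<nu> \<le> y / sqrt \<nu>" if "x \<le> y" for x y using that \<nu>_pos by (simp add: divide_right_mono)
  have K2: "\<And>n. norm (B n (B n (B n (B n u0)))) \<le> K2" "\<And>n. norm (B n (B n w0)) \<le> K2"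
    "\<And>n. norm (B n (B n (B n u0))) \<le> K2" "\<And>n. norm (B n w0) \<le> K2"
    using K0 KBB order_trans[OF coer le[OF K0]] order_trans[OF coer le[OF KBB]]
    unfolding K2_def by (auto simp: le_max_iff_disj simp del: div_by_0)
  obtain M L C5 \<epsilon>1 where kb: "kirchhoff_bounds D A \<nu> P B p \<mu> \<beta> \<omega> W a m u0 u1 u c0 M L C5" and \<epsilon>1: "0 < \<epsilon>1"
    and ctrl: "\<And>\<epsilon> v. 0 < \<epsilon> \<Longrightarrow> \<epsilon> < \<epsilon>1 \<Longrightarrow> hyperbolic_solution D A m p u0 u1 \<epsilon> v \<Longrightarrow> controlled M \<epsilon> v"
    using bounds_ex by blast
  interpret kirchhoff_bounds D A \<nu> P B p \<mu> \<beta> \<omega> W a m u0 u1 u c0 M L C5 K2 by (rule kb)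
  obtain \<epsilon>2 where \<epsilon>2: "0 < \<epsilon>2" "\<And>\<epsilon>. 0 < \<epsilon> \<Longrightarrow> \<epsilon> < \<epsilon>2 \<Longrightarrow> small \<epsilon>" using small_ex by blast
  define C where "C = C0 / \<nu> + C0 + C1 + 2 * \<Lambda> * C1 + 2 * C2"
  have "(norm (v t - u t))\<^sup>2 + (norm (Q (v t - u t)))\<^sup>2 + (norm (A (v t - u t)))\<^sup>2 + (norm (rem \<epsilon> v t))\<^sup>2
      + \<epsilon> * (norm (Q (rem \<epsilon> v t)))\<^sup>2 \<le> C * \<epsilon>\<^sup>2 / (W t * (b t)\<^sup>2)"
    if \<epsilon>: "0 < \<epsilon>" "\<epsilon> < min \<epsilon>1 \<epsilon>2" and sol: "hyperbolic_solution D A m p u0 u1 \<epsilon> v" and t: "0 \<le> t" for \<epsilon> v t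
  proof -
    have sm: "small \<epsilon>" using \<epsilon> \<epsilon>2 by simp
    have co: "controlled M \<epsilon> v" using \<epsilon> sol ctrl by simp
    note lev0 = remainder_level_0[OF sm co _ K2(3,4)]
    note lev1 = remainder_level_1[OF sm co _ K2(1,2) lev0(1)]
    define x where "x = (norm (Q (v t - u t)))\<^sup>2"
    have "W t * (norm (v t - u t))\<^sup>2 \<le> W t * (x / \<nu>)"
      unfolding x_def using W_pos[OF t] by (intro mult_left_mono norm_square_le difference_facts(1)[OF co t]) auto
    also have "\<dots> = W t * x / \<nu>" by simp
    also have "\<dots> \<le> C0 * \<epsilon>\<^sup>2 / \<nu>" using lev0(1)[OF t] \<nu>_pos unfolding x_def by (intro divide_right_mono) auto
    finally have "W t * ((norm (v t - u t))\<^sup>2 + (norm (Q (v t - u t)))\<^sup>2 + (norm (A (v t - u t)))\<^sup>2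
        + \<epsilon> * (norm (Q (rem \<epsilon> v t)))\<^sup>2) \<le> (C0 / \<nu> + C0 + C1 + 2 * \<Lambda> * C1) * \<epsilon>\<^sup>2"
      using lev0(1)[OF t] lev1(1,3)[OF t] by (simp add: algebra_simps)
    from weight_b_le[OF t this]
    have "W t * (b t)\<^sup>2 * ((norm (v t - u t))\<^sup>2 + (norm (Q (v t - u t)))\<^sup>2 + (norm (A (v t - u t)))\<^sup>2
        + \<epsilon> * (norm (Q (rem \<epsilon> v t)))\<^sup>2) \<le> (C0 / \<nu> + C0 + C1 + 2 * \<Lambda> * C1) * \<epsilon>\<^sup>2"
      using \<epsilon> by simp
    moreover have "W t * (b t)\<^sup>2 * (norm (rem \<epsilon> v t))\<^sup>2 \<le> 2 * C2 * \<epsilon>\<^sup>2"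
      by (rule remainder_derivative[OF sm co t K2(1) lev0(1) lev1(1)])
    ultimately have "W t * (b t)\<^sup>2 * ((norm (v t - u t))\<^sup>2 + (norm (Q (v t - u t)))\<^sup>2 + (norm (A (v t - u t)))\<^sup>2
        + (norm (rem \<epsilon> v t))\<^sup>2 + \<epsilon> * (norm (Q (rem \<epsilon> v t)))\<^sup>2) \<le> C * \<epsilon>\<^sup>2"
      by (simp add: C_def algebra_simps)
    from weighted_le[OF t this] show ?thesis .
  qed
  moreover have "0 < min \<epsilon>1 \<epsilon>2" using \<epsilon>1 \<epsilon>2 by simp
  ultimately show ?thesis by blast
qed

end

section \<open>Decay rates\<close>

lemma exp_damping_int_square:
  assumes p: "0 \<le> p" "p \<le> 1" and t: "0 \<le> t"
  shows "exp (- (2 * damping_int p t)) \<le> (damping p t)\<^sup>2"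
proof -
  have "1 / damping p t \<le> exp (damping_int p t)"
    using damping_bounds(4)[OF p t] exp_damping_int[OF p t] by simp
  then have "exp (- damping_int p t) \<le> damping p t"
    using damping_bounds(1)[OF p t] by (simp add: exp_minus field_simps)
  then have "(exp (- damping_int p t))\<^sup>2 \<le> (damping p t)\<^sup>2" by (intro power_mono) auto
  then show ?thesis by (simp add: power2_eq_square flip: exp_add)
qed

text \<open>W stays constant up to a time T and then grows like exp (\<beta> G). For p > 0 the time
  T is so late that \<beta> b^2 \<le> \<mu> \<nu> from then on; holding W back until T costs only
  the constant factor k.\<close>

lemma weight_ex:
  assumes p: "0 \<le> p" "p \<le> 1" and pos: "\<mu> > 0" "\<nu> > 0" "\<beta> > 0"
    and \<beta>: "p = 0 \<Longrightarrow> \<beta> < 2 * \<mu> * \<nu>" "p > 0 \<Longrightarrow> \<beta> \<ge> 2"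
  obtains \<omega> W a c0 k where "weight p \<mu> \<nu> \<beta> \<omega> W a" "k > 0"
    "\<And>t. t \<ge> 0 \<Longrightarrow> 1 \<le> c0 * W t * (damping p t)\<^sup>2"
    "\<And>t. t \<ge> 0 \<Longrightarrow> k * exp (\<beta> * damping_int p t) \<le> W t"
proof -
  \<comment> \<open>For p = 0 the damping is 1 and the gap is the one between \<beta> and 2 \<mu>
    \<nu>; for p > 0 half of the critical value is kept.\<close>
  define \<omega> where "\<omega> = (if p = 0 then 2 * \<mu> * \<nu> - \<beta> else \<mu> * \<nu>)"
  have \<omega>: "\<omega> > 0" using pos \<beta>(1) by (simp add: \<omega>_def)
  have "\<exists>T\<ge>0. \<forall>t\<ge>T. \<beta> * (damping p t)\<^sup>2 \<le> 2 * \<mu> * \<nu> - \<omega>"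
  proof (cases "p = 0")
    case True
    then show ?thesis by (intro exI[of _ 0]) (simp add: \<omega>_def damping_def)
  next
    case False
    then have p0: "p > 0" using p by simp
    define s where "s = \<mu> * \<nu> / \<beta>"
    have s: "s > 0" using pos by (simp add: s_def)
    \<comment> \<open>The solution of T^(- 2 p) = s.\<close>
    define T where "T = s powr (- 1 / (2 * p))"
    have T: "T > 0" using s by (simp add: T_def)
    have "\<beta> * (damping p t)\<^sup>2 \<le> 2 * \<mu> * \<nu> - \<omega>" if t: "t \<ge> T" for t
    proof -
      have "(damping p t)\<^sup>2 = (1 + t) powr (- (2 * p))"
        using t T by (simp add: damping_powr power2_eq_square flip: powr_add)
      also have "\<dots> \<le> T powr (- (2 * p))"
        using t T p0 by (intro powr_mono2') auto
      also have "\<dots> = s" using p0 s by (simp add: T_def powr_powr)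
      finally have "\<beta> * (damping p t)\<^sup>2 \<le> \<beta> * s" using pos by (intro mult_left_mono) auto
      then show ?thesis using False pos by (simp add: s_def \<omega>_def)
    qed
    then show ?thesis using T by (intro exI[of _ T]) auto
  qed
  then obtain T where T: "T \<ge> 0" "\<And>t. t \<ge> T \<Longrightarrow> \<beta> * (damping p t)\<^sup>2 \<le> 2 * \<mu> * \<nu> - \<omega>" by blast
  define G where "G = damping_int p"
  have G_mono: "G x \<le> G y" if "0 \<le> x" "x \<le> y" for x y
  proof (rule DERIV_nonneg_imp_nondecreasing[OF that(2)])
    fix z assume "x \<le> z" "z \<le> y"
    then have z: "0 \<le> z" using that by simp
    show "\<exists>d. DERIV G z :> d \<and> 0 \<le> d"
      using damping_int_deriv[OF z, of p UNIV] damping_bounds(1)[OF p z] by (auto simp: G_def intro: less_imp_le)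
  qed
  define W where "W t = exp (\<beta> * max 0 (G t - G T))" for t
  define a where "a t = (if t < T then 0 else \<beta> * damping p t)" for t
  have wt: "weight p \<mu> \<nu> \<beta> \<omega> W a"
  proof
    show "0 \<le> p" "p \<le> 1" "\<mu> > 0" "\<nu> > 0" "\<beta> \<ge> 0" "\<omega> > 0" using p pos \<omega> by auto
    have "continuous_on {0..} G" unfolding G_def by (rule damping_int_cont)
    then show "continuous_on {0..} W" unfolding W_def by (intro continuous_intros)
    show "W 0 = 1" using G_mono[of 0 T] T by (simp add: W_def max_absorb1)
    fix t :: real assume t: "t \<ge> 0"
    show "1 \<le> W t" using pos by (simp add: W_def)
    show "(W has_real_derivative a t * W t) (at_right t)"
    proof (cases "t < T")
      case True
      have "((\<lambda>_. 1) has_real_derivative 0) (at_right t)" by simp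
      moreover have "\<forall>\<^sub>F s in at_right t. W s = 1"
      proof -
        have "0 < T - t" using True by simp
        from eventually_at_right_near[OF this, of t] show ?thesis
          by eventually_elim (use G_mono t in \<open>auto simp: W_def max_absorb1\<close>)
      qed
      moreover have "W t = 1" using G_mono[of t T] True t by (simp add: W_def max_absorb1)
      ultimately have "(W has_real_derivative 0) (at_right t)"
        using has_field_derivative_cong_eventually[of W "\<lambda>_. 1" t "{t<..}" 0] by simp
      then show ?thesis using True by (simp add: a_def)
    next
      case False
      have "((\<lambda>t. exp (\<beta> * (G t - G T))) has_real_derivative a t * exp (\<beta> * (G t - G T))) (at_right t)"
        unfolding G_def using False t by (auto intro!: derivative_eq_intros damping_int_deriv simp: a_def)
      moreover have We: "W s = exp (\<beta> * (G s - G T))" if "s \<ge> t" for s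
        using G_mono[of T s] False T that by (simp add: W_def max_absorb2)
      moreover have "\<forall>\<^sub>F s in at_right t. W s = exp (\<beta> * (G s - G T))"
        using eventually_at_right_near[OF zero_less_one, of t] by eventually_elim (use We in auto)
      ultimately show ?thesis
        using has_field_derivative_cong_eventually[of W "\<lambda>t. exp (\<beta> * (G t - G T))" t "{t<..}"] by simp
    qed
    note bt = damping_bounds[OF p t]
    show "0 \<le> a t" "a t \<le> \<beta> * damping p t" using pos bt by (auto simp: a_def)
    have "0 \<le> 2 * \<mu> * \<nu> - \<omega>" using pos by (auto simp: \<omega>_def)
    then show "a t * damping p t \<le> 2 * \<mu> * \<nu> - \<omega>"
      using T(2)[of t] by (auto simp: a_def power2_eq_square mult_ac)
    have "0 \<le> G t" "0 \<le> G T" using damping_int_nonneg[OF p] t T by (auto simp: G_def)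
    then show "W t \<le> exp (\<beta> * damping_int p t)"
      using pos by (auto simp: W_def G_def intro!: mult_left_mono)
  qed
  define k where "k = exp (- (\<beta> * G T))"
  have k: "k > 0" by (simp add: k_def)
  have Wk: "k * exp (\<beta> * damping_int p t) \<le> W t" for t
  proof -
    have "k * exp (\<beta> * damping_int p t) = exp (\<beta> * (G t - G T))"
      by (simp add: k_def G_def right_diff_distrib flip: exp_add)
    also have "\<dots> \<le> W t" unfolding W_def using pos by (auto intro!: mult_left_mono)
    finally show ?thesis .
  qed
  \<comment> \<open>For p > 0 this is where \<beta> \<ge> 2 is used: exp (2 G) compensates for
    b^2.\<close>
  have Wb: "1 \<le> (1 / k) * W t * (damping p t)\<^sup>2" if t: "t \<ge> 0" for t
  proof -
    note bt = damping_bounds[OF p t]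
    have G0: "0 \<le> G t" using damping_int_nonneg[OF p t] by (simp add: G_def)
    have "1 \<le> exp (\<beta> * G t) * (damping p t)\<^sup>2"
    proof (cases "p = 0")
      case True
      then show ?thesis using pos G0 t by (simp add: damping_def)
    next
      case False
      then have "2 * G t \<le> \<beta> * G t" using \<beta>(2) p G0 by (intro mult_right_mono) auto
      then have "exp (2 * G t) \<le> exp (\<beta> * G t)" by simp
      moreover have "1 \<le> exp (2 * G t) * (damping p t)\<^sup>2"
        using exp_damping_int_square[OF p t] by (simp add: G_def exp_minus field_simps)
      ultimately show ?thesis by (meson mult_right_mono order_trans zero_le_power2)
    qed
    also have "\<dots> \<le> ((1 / k) * W t) * (damping p t)\<^sup>2"
      using Wk[of t] k by (intro mult_right_mono) (auto simp: G_def field_simps)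
    finally show ?thesis .
  qed
  show ?thesis using that[OF wt k Wb Wk] by blast
qed

lemma error_bound_mono:
  assumes eb: "error_bound \<epsilon>0 \<Gamma> g" and g: "\<And>t. t \<ge> 0 \<Longrightarrow> 0 \<le> g t \<and> g t \<le> k * h t"
  shows "error_bound \<epsilon>0 \<Gamma> h"
proof -
  obtain \<epsilon>1 C where C: "0 < \<epsilon>1" "\<epsilon>1 \<le> \<epsilon>0" "\<And>t \<epsilon>. t \<ge> 0 \<Longrightarrow> \<epsilon> \<in> {0<..<\<epsilon>1} \<Longrightarrow> \<Gamma> \<epsilon> t \<le> C * \<epsilon>\<^sup>2 * g t"
    using eb unfolding error_bound_def by blast
  have "\<Gamma> \<epsilon> t \<le> (\<bar>C\<bar> * k) * \<epsilon>\<^sup>2 * h t" if "t \<ge> 0" "\<epsilon> \<in> {0<..<\<epsilon>1}" for t \<epsilon>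
  proof -
    have "\<Gamma> \<epsilon> t \<le> C * \<epsilon>\<^sup>2 * g t" by (rule C(3)[OF that])
    also have "\<dots> \<le> \<bar>C\<bar> * \<epsilon>\<^sup>2 * g t" using g[OF that(1)] by (intro mult_right_mono) auto
    also have "\<dots> \<le> \<bar>C\<bar> * \<epsilon>\<^sup>2 * (k * h t)" using g[OF that(1)] by (intro mult_left_mono) auto
    finally show ?thesis by (simp add: mult_ac)
  qed
  then show ?thesis unfolding error_bound_def using C(1,2) by blast
qed

lemma dt_eqI:
  assumes "(f has_vector_derivative d) (at t within {0..})" "t \<ge> 0"
  shows "dt f t = d"
  unfolding dt_def
proof (rule vector_derivative_within[OF _ assms(1)])
  have "at_right t \<le> at t within {0..}" using assms(2) by (intro at_le) auto
  then show "at t within {0..} \<noteq> bot" using trivial_limit_at_right_real[of t] by (metis bot.extremum_uniqueI)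
qed

text \<open>The integrating factor exp (G / \<epsilon>) makes its product with the derivative of the
  corrector constant.\<close>

lemma corrector_derivative:
  fixes D :: "'h::real_inner set"
  assumes \<theta>: "corrector_solution D A m p u0 u1 \<epsilon> \<theta>" and \<epsilon>: "\<epsilon> > 0" and t: "t \<ge> 0"
  shows "dt \<theta> t = exp (- (damping_int p t / \<epsilon>)) *\<^sub>R (u1 + kirchhoff_term D A m u0)"
proof -
  define f where "f s = exp (damping_int p s / \<epsilon>) *\<^sub>R dt \<theta> s" for s
  have "(f has_derivative (\<lambda>h. 0)) (at s within {0..})" if s: "s \<in> {0..}" for s
  proof -
    have s0: "s \<ge> 0" using s by simp
    have d: "(dt \<theta> has_vector_derivative dt (dt \<theta>) s) (at s within {0..})"
      using \<theta> s0 by (simp add: corrector_solution_def C2_half_line_def C1_half_line_def)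
    have e: "((\<lambda>s. exp (damping_int p s / \<epsilon>)) has_real_derivative damping p s / \<epsilon> * exp (damping_int p s / \<epsilon>)) (at s within {0..})"
      using \<epsilon> s0 by (auto intro!: derivative_eq_intros damping_int_deriv)
    have "\<epsilon> *\<^sub>R dt (dt \<theta>) s + damping p s *\<^sub>R dt \<theta> s = 0"
      using \<theta> s0 by (simp add: corrector_solution_def damping_def)
    then have "(1 / \<epsilon>) *\<^sub>R (\<epsilon> *\<^sub>R dt (dt \<theta>) s + damping p s *\<^sub>R dt \<theta> s) = 0" by simp
    then have "dt (dt \<theta>) s + (damping p s / \<epsilon>) *\<^sub>R dt \<theta> s = 0" using \<epsilon> by (simp add: scaleR_add_right)
    then have "exp (damping_int p s / \<epsilon>) *\<^sub>R (dt (dt \<theta>) s + (damping p s / \<epsilon>) *\<^sub>R dt \<theta> s) = 0" by simp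
    then have "exp (damping_int p s / \<epsilon>) *\<^sub>R dt (dt \<theta>) s + (damping p s / \<epsilon> * exp (damping_int p s / \<epsilon>)) *\<^sub>R dt \<theta> s = 0"
      by (simp add: scaleR_add_right mult.commute)
    with has_vector_derivative_scaleR[OF e d]
    have "(f has_vector_derivative 0) (at s within {0..})" by (simp add: f_def[abs_def])
    then show ?thesis by (simp add: has_vector_derivative_def)
  qed
  then obtain k where k: "\<And>s. s \<in> {0..} \<Longrightarrow> f s = k"
    using has_derivative_zero_constant[of "{0::real..}" f] by auto
  have "f t = f 0" using k t by simp
  also have "f 0 = u1 + kirchhoff_term D A m u0" using \<theta> by (simp add: f_def corrector_solution_def)
  finally have "exp (- (damping_int p t / \<epsilon>)) *\<^sub>R f t = exp (- (damping_int p t / \<epsilon>)) *\<^sub>R (u1 + kirchhoff_term D A m u0)"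
    by simp
  then show ?thesis by (simp add: f_def flip: exp_add)
qed

section \<open>Assembly of the estimates and extraction of the three rates\<close>

theorem theorem2p3:
  fixes D :: "'h::{real_inner, complete_space} set"
    and A :: "'h \<Rightarrow> 'h"
    and m :: "real \<Rightarrow> real"
    and p \<epsilon>0 :: real
    and \<mu> \<nu> :: ereal
    and u0 u1 :: 'h
    and u :: "real \<Rightarrow> 'h"
    and u\<epsilon> \<theta> r \<rho> :: "real \<Rightarrow> real \<Rightarrow> 'h"
  assumes self_adjoint: "self_adjoint D A"
    and data: "u0 \<in> D" "u1 \<in> power_dom D A (1/2)"
    and p: "0 \<le> p" "p \<le> 1"
    and m_pos: "\<And>s. 0 \<le> s \<Longrightarrow> 0 < m s"
    and m_loc_lipschitz: "\<And>s. 0 \<le> s \<Longrightarrow> \<exists>d>0. \<exists>L. L-lipschitz_on (cball s d \<inter> {0..}) m"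
    and mu: "\<mu> = (INF s\<in>{0..}. ereal (m s))" "0 < \<mu>"
    and nu: "\<nu> = (INF x\<in>{x \<in> D. norm x = 1}. ereal (inner (A x) x))" "0 < \<nu>"
    and parabolic: "unique_solution (parabolic_solution D A m p u0) u"
    and eps0: "0 < \<epsilon>0"
    and hyperbolic:
      "\<And>\<epsilon>. \<epsilon> \<in> {0<..<\<epsilon>0} \<Longrightarrow> unique_solution (hyperbolic_solution D A m p u0 u1 \<epsilon>) (u\<epsilon> \<epsilon>)"
    and corrector:
      "\<And>\<epsilon>. \<epsilon> \<in> {0<..<\<epsilon>0} \<Longrightarrow> unique_solution (corrector_solution D A m p u0 u1 \<epsilon>) (\<theta> \<epsilon>)"
    and remainder_r: "\<And>\<epsilon> t. \<epsilon> \<in> {0<..<\<epsilon>0} \<Longrightarrow> 0 \<le> t \<Longrightarrow> u\<epsilon> \<epsilon> t = u t + \<theta> \<epsilon> t + r \<epsilon> t"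
    and remainder_rho: "\<And>\<epsilon> t. \<epsilon> \<in> {0<..<\<epsilon>0} \<Longrightarrow> 0 \<le> t \<Longrightarrow> u\<epsilon> \<epsilon> t = u t + \<rho> \<epsilon> t"
  shows "(u0 \<in> power_dom D A (3/2) \<and> u1 \<in> power_dom D A (1/2) \<longrightarrow>
            decay_error_estimates p \<mu> \<nu> \<epsilon>0 (\<lambda>\<epsilon>. Gamma_r D A \<epsilon> (\<rho> \<epsilon>) (r \<epsilon>))) \<and>
         (u0 \<in> power_dom D A 2 \<and> u1 \<in> D \<longrightarrow>
            decay_error_estimates p \<mu> \<nu> \<epsilon>0 (\<lambda>\<epsilon>. Gamma_c D A \<epsilon> (\<rho> \<epsilon>) (r \<epsilon>)))"
proof -
  let ?E = "spectral_measure D A"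
  have sm: "is_spectral_measure D A ?E" using data(2) by (simp add: power_dom_def)
  have lin: "linear_operator D A" using self_adjoint by (simp add: self_adjoint_def)
  have dom: "power_dom D A \<alpha> = spectral_integral_dom ?E (\<lambda>l. l powr \<alpha>)" for \<alpha>
    using sm by (auto simp: power_dom_def)
  have mu_le: "\<mu> \<le> ereal (m s)" if "0 \<le> s" for s
    unfolding mu(1) using that by (intro INF_lower) auto
  obtain \<mu>0 where \<mu>0: "\<mu> = ereal \<mu>0"
    using mu_le[of 0] mu(2) by (cases \<mu>) auto
  have \<mu>0_pos: "0 < \<mu>0" and m_ge: "\<And>s. 0 \<le> s \<Longrightarrow> \<mu>0 \<le> m s"
    using mu(2) mu_le unfolding \<mu>0 by auto
  \<comment> \<open>A real lower bound of \<nu> is used in place of \<nu>, which is infinite when D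
    contains no unit vector.\<close>
  have coer: "\<nu>0 * (norm x)\<^sup>2 \<le> inner (A x) x" if \<nu>0: "ereal \<nu>0 \<le> \<nu>" and x: "x \<in> D" for \<nu>0 x
  proof (cases "x = 0")
    case False
    define y where "y = (1 / norm x) *\<^sub>R x"
    have yD: "y \<in> D" and Ay: "A y = (1 / norm x) *\<^sub>R A x"
      using lin x by (auto simp: y_def linear_operator_def subspace_scale)
    have "ereal \<nu>0 \<le> ereal (inner (A y) y)"
      using \<nu>0 unfolding nu(1) by (rule order_trans) (intro INF_lower, use yD False in \<open>simp add: y_def\<close>)
    moreover have "inner (A y) y = inner (A x) x / (norm x)\<^sup>2"
      unfolding Ay by (simp add: y_def power2_eq_square)
    ultimately have "\<nu>0 \<le> inner (A x) x / (norm x)\<^sup>2" by simp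
    then show ?thesis using False by (simp add: field_simps)
  qed simp
  have hyp: "hyperbolic_solution D A m p u0 u1 \<epsilon> (u\<epsilon> \<epsilon>)" if "\<epsilon> \<in> {0<..<\<epsilon>0}" for \<epsilon>
    using hyperbolic[OF that] by (simp add: unique_solution_def)
  have par: "parabolic_solution D A m p u0 u" using parabolic by (simp add: unique_solution_def)
  have \<rho>: "\<rho> \<epsilon> t = u\<epsilon> \<epsilon> t - u t" if "\<epsilon> \<in> {0<..<\<epsilon>0}" "0 \<le> t" for \<epsilon> t
    using remainder_rho[OF that] by simp
  \<comment> \<open>Both estimates with the common decay function exp (- \<beta> G) / b^2; the three
    cases for p only differ in the choice of \<beta>.\<close>
  have key: "(u0 \<in> power_dom D A (3/2) \<longrightarrow>
        error_bound \<epsilon>0 (\<lambda>\<epsilon>. Gamma_r D A \<epsilon> (\<rho> \<epsilon>) (r \<epsilon>)) (\<lambda>t. exp (- (\<beta> * damping_int p t)) / (damping p t)\<^sup>2)) \<and>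
      (u0 \<in> power_dom D A 2 \<and> u1 \<in> D \<longrightarrow>
        error_bound \<epsilon>0 (\<lambda>\<epsilon>. Gamma_c D A \<epsilon> (\<rho> \<epsilon>) (r \<epsilon>)) (\<lambda>t. exp (- (\<beta> * damping_int p t)) / (damping p t)\<^sup>2))"
    if \<nu>0: "0 < \<nu>0" "ereal \<nu>0 \<le> \<nu>" and \<beta>: "0 < \<beta>" "p = 0 \<Longrightarrow> \<beta> < 2 * \<mu>0 * \<nu>0" "p > 0 \<Longrightarrow> \<beta> \<ge> 2" for \<nu>0 \<beta>
  proof -
    obtain P B where tr: "truncated_operator D (power_dom D A (1/2)) A (power_op D A (1/2)) \<nu>0 P B"
      and B3: "\<And>x. x \<in> power_dom D A (3/2) \<Longrightarrow> \<exists>K. \<forall>n. norm (B n (B n (B n x))) \<le> K"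
      and B4: "\<And>x. x \<in> power_dom D A 2 \<Longrightarrow> \<exists>K. \<forall>n. norm (B n (B n (B n (B n x)))) \<le> K"
    proof (rule spectral_truncation[OF sm lin \<nu>0(1) coer[OF \<nu>0(2)], folded dom power_op_def])
      fix P B
      assume "truncated_operator D (power_dom D A (1/2)) A (power_op D A (1/2)) \<nu>0 P B"
        and "\<And>x. x \<in> power_dom D A (3/2) \<Longrightarrow> \<exists>K. \<forall>n. norm (B n (B n (B n x))) \<le> K"
        and "\<And>x. x \<in> power_dom D A 2 \<Longrightarrow> \<exists>K. \<forall>n. norm (B n (B n (B n (B n x)))) \<le> K"
      then show thesis by (rule that[of P B])
    qed
    obtain \<omega> W a c0 k where wt: "weight p \<mu>0 \<nu>0 \<beta> \<omega> W a" and k: "k > 0"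
      and Wb: "\<And>t. t \<ge> 0 \<Longrightarrow> 1 \<le> c0 * W t * (damping p t)\<^sup>2"
      and Wk: "\<And>t. t \<ge> 0 \<Longrightarrow> k * exp (\<beta> * damping_int p t) \<le> W t"
    proof (rule weight_ex[OF p \<mu>0_pos \<nu>0(1) \<beta>])
      fix \<omega> W a c0 k
      assume "weight p \<mu>0 \<nu>0 \<beta> \<omega> W a" "k > 0" "\<And>t. t \<ge> 0 \<Longrightarrow> 1 \<le> c0 * W t * (damping p t)\<^sup>2"
        "\<And>t. t \<ge> 0 \<Longrightarrow> k * exp (\<beta> * damping_int p t) \<le> W t"
      then show thesis by (rule that[of \<omega> W a k c0])
    qed
    interpret truncated_operator D "power_dom D A (1/2)" A "power_op D A (1/2)" \<nu>0 P B by (rule tr)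
    interpret weight p \<mu>0 \<nu>0 \<beta> \<omega> W a by (rule wt)
    interpret kirchhoff D A \<nu>0 P B p \<mu>0 \<beta> \<omega> W a m u0 u1 u c0
      by unfold_locales (use Wb m_ge m_loc_lipschitz data par in auto)
    have dt_r: "dt (r \<epsilon>) t = rem \<epsilon> (u\<epsilon> \<epsilon>) t" if \<epsilon>: "\<epsilon> \<in> {0<..<\<epsilon>0}" and t: "0 \<le> t" for \<epsilon> t
    proof (rule dt_eqI[OF _ t])
      have \<theta>: "corrector_solution D A m p u0 u1 \<epsilon> (\<theta> \<epsilon>)"
        using corrector[OF \<epsilon>] by (simp add: unique_solution_def)
      have d\<theta>: "(\<theta> \<epsilon> has_vector_derivative exp (- (G t / \<epsilon>)) *\<^sub>R w0) (at t within {0..})"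
      proof -
        have "(\<theta> \<epsilon> has_vector_derivative dt (\<theta> \<epsilon>) t) (at t within {0..})"
          using \<theta> t by (simp add: corrector_solution_def C2_half_line_def C1_half_line_def)
        also have "dt (\<theta> \<epsilon>) t = exp (- (G t / \<epsilon>)) *\<^sub>R w0"
          using corrector_derivative[OF \<theta> _ t] \<epsilon> by (simp add: w0_def kirchhoff_term_def c_def u_0)
        finally show ?thesis .
      qed
      have "((\<lambda>s. u\<epsilon> \<epsilon> s - u s - \<theta> \<epsilon> s) has_vector_derivative rem \<epsilon> (u\<epsilon> \<epsilon>) t) (at t within {0..})"
        unfolding rem_def
        by (intro has_vector_derivative_diff d\<theta> hyperbolic_facts(8)[OF hyp[OF \<epsilon>] t] u_deriv[OF t])
      then show "(r \<epsilon> has_vector_derivative rem \<epsilon> (u\<epsilon> \<epsilon>) t) (at t within {0..})"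
        by (rule has_vector_derivative_transform[rotated 2]) (use t remainder_r[OF \<epsilon>] in auto)
    qed
    have quot: "\<bar>C\<bar> * \<epsilon>\<^sup>2 / (W t * (b t)\<^sup>2) \<le> (\<bar>C\<bar> / k) * \<epsilon>\<^sup>2 * (exp (- (\<beta> * G t)) / (b t)\<^sup>2)"
      if t: "0 \<le> t" for C \<epsilon> t
    proof -
      have "\<bar>C\<bar> * \<epsilon>\<^sup>2 / (W t * (b t)\<^sup>2) \<le> \<bar>C\<bar> * \<epsilon>\<^sup>2 / ((k * exp (\<beta> * G t)) * (b t)\<^sup>2)"
        using Wk[OF t] k b_pos[OF t] W_pos[OF t]
        by (intro divide_left_mono mult_right_mono mult_nonneg_nonneg mult_pos_pos) auto
      also have "\<dots> = (\<bar>C\<bar> / k) * \<epsilon>\<^sup>2 * (exp (- (\<beta> * G t)) / (b t)\<^sup>2)"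
        by (simp add: exp_minus divide_inverse mult_ac)
      finally show ?thesis .
    qed
    have eb: "error_bound \<epsilon>0 \<Gamma> (\<lambda>t. exp (- (\<beta> * G t)) / (b t)\<^sup>2)"
      if *: "0 < \<epsilon>1" "\<And>\<epsilon> t. \<epsilon> \<in> {0<..<\<epsilon>0} \<Longrightarrow> \<epsilon> < \<epsilon>1 \<Longrightarrow> 0 \<le> t \<Longrightarrow> \<Gamma> \<epsilon> t \<le> C * \<epsilon>\<^sup>2 / (W t * (b t)\<^sup>2)" for \<Gamma> \<epsilon>1 C
      unfolding error_bound_def
    proof (intro exI conjI allI impI ballI)
      show "0 < min \<epsilon>0 \<epsilon>1" using eps0 *(1) by simp
      fix t \<epsilon> :: real assume t: "0 \<le> t" and \<epsilon>: "\<epsilon> \<in> {0<..<min \<epsilon>0 \<epsilon>1}"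
      have "\<Gamma> \<epsilon> t \<le> C * \<epsilon>\<^sup>2 / (W t * (b t)\<^sup>2)" using *(2)[of \<epsilon> t] \<epsilon> t by simp
      also have "\<dots> \<le> \<bar>C\<bar> * \<epsilon>\<^sup>2 / (W t * (b t)\<^sup>2)"
        using W_pos[OF t] b_pos[OF t] by (intro divide_right_mono mult_right_mono) auto
      also note quot[OF t]
      finally show "\<Gamma> \<epsilon> t \<le> (\<bar>C\<bar> / k) * \<epsilon>\<^sup>2 * (exp (- (\<beta> * G t)) / (b t)\<^sup>2)" .
    qed simp
    show ?thesis
    proof (intro conjI impI)
      assume "u0 \<in> power_dom D A (3/2)"
      from decay_error_r[OF B3[OF this]] obtain \<epsilon>1 C where "0 < \<epsilon>1" and
        C: "\<And>\<epsilon> v t. 0 < \<epsilon> \<Longrightarrow> \<epsilon> < \<epsilon>1 \<Longrightarrow> hyperbolic_solution D A m p u0 u1 \<epsilon> v \<Longrightarrow> 0 \<le> t \<Longrightarrow>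
          (norm (v t - u t))\<^sup>2 + (norm (Q (v t - u t)))\<^sup>2 + \<epsilon> * (norm (rem \<epsilon> v t))\<^sup>2 \<le> C * \<epsilon>\<^sup>2 / (W t * (b t)\<^sup>2)"
        by blast
      show "error_bound \<epsilon>0 (\<lambda>\<epsilon>. Gamma_r D A \<epsilon> (\<rho> \<epsilon>) (r \<epsilon>)) (\<lambda>t. exp (- (\<beta> * G t)) / (b t)\<^sup>2)"
      proof (rule eb[OF \<open>0 < \<epsilon>1\<close>])
        fix \<epsilon> t :: real assume \<epsilon>: "\<epsilon> \<in> {0<..<\<epsilon>0}" "\<epsilon> < \<epsilon>1" and t: "0 \<le> t"
        show "Gamma_r D A \<epsilon> (\<rho> \<epsilon>) (r \<epsilon>) t \<le> C * \<epsilon>\<^sup>2 / (W t * (b t)\<^sup>2)"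
          using C[OF _ \<epsilon>(2) hyp[OF \<epsilon>(1)] t] \<epsilon> by (simp add: Gamma_r_def \<rho>[OF \<epsilon>(1) t] dt_r[OF \<epsilon>(1) t])
      qed
    next
      assume *: "u0 \<in> power_dom D A 2 \<and> u1 \<in> D"
      from * decay_error_c[OF B4] obtain \<epsilon>1 C where "0 < \<epsilon>1" and
        C: "\<And>\<epsilon> v t. 0 < \<epsilon> \<Longrightarrow> \<epsilon> < \<epsilon>1 \<Longrightarrow> hyperbolic_solution D A m p u0 u1 \<epsilon> v \<Longrightarrow> 0 \<le> t \<Longrightarrow>
          (norm (v t - u t))\<^sup>2 + (norm (Q (v t - u t)))\<^sup>2 + (norm (A (v t - u t)))\<^sup>2 + (norm (rem \<epsilon> v t))\<^sup>2
          + \<epsilon> * (norm (Q (rem \<epsilon> v t)))\<^sup>2 \<le> C * \<epsilon>\<^sup>2 / (W t * (b t)\<^sup>2)"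
        by blast
      show "error_bound \<epsilon>0 (\<lambda>\<epsilon>. Gamma_c D A \<epsilon> (\<rho> \<epsilon>) (r \<epsilon>)) (\<lambda>t. exp (- (\<beta> * G t)) / (b t)\<^sup>2)"
      proof (rule eb[OF \<open>0 < \<epsilon>1\<close>])
        fix \<epsilon> t :: real assume \<epsilon>: "\<epsilon> \<in> {0<..<\<epsilon>0}" "\<epsilon> < \<epsilon>1" and t: "0 \<le> t"
        show "Gamma_c D A \<epsilon> (\<rho> \<epsilon>) (r \<epsilon>) t \<le> C * \<epsilon>\<^sup>2 / (W t * (b t)\<^sup>2)"
          using C[OF _ \<epsilon>(2) hyp[OF \<epsilon>(1)] t] \<epsilon> by (simp add: Gamma_c_def \<rho>[OF \<epsilon>(1) t] dt_r[OF \<epsilon>(1) t])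
      qed
    qed
  qed
  \<comment> \<open>For p > 0 the value of \<nu> does not enter the rate, so any positive real lower
    bound serves.\<close>
  obtain \<nu>1 where \<nu>1: "0 < \<nu>1" "ereal \<nu>1 \<le> \<nu>"
    using ereal_dense2[OF nu(2)] by (auto intro: less_imp_le)
  have rates: "decay_error_estimates p \<mu> \<nu> \<epsilon>0 \<Gamma>"
    if \<Gamma>: "\<And>\<nu>0 \<beta>. 0 < \<nu>0 \<Longrightarrow> ereal \<nu>0 \<le> \<nu> \<Longrightarrow> 0 < \<beta> \<Longrightarrow> (p = 0 \<Longrightarrow> \<beta> < 2 * \<mu>0 * \<nu>0) \<Longrightarrow> (p > 0 \<Longrightarrow> \<beta> \<ge> 2) \<Longrightarrow>
      error_bound \<epsilon>0 \<Gamma> (\<lambda>t. exp (- (\<beta> * damping_int p t)) / (damping p t)\<^sup>2)" for \<Gamma>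
    unfolding decay_error_estimates_def
  proof (intro conjI impI allI)
    fix \<beta> assume p0: "p = 0" and \<beta>: "ereal \<beta> < 2 * \<mu> * \<nu>"
    obtain \<nu>0 where \<nu>0: "0 < \<nu>0" "ereal \<nu>0 \<le> \<nu>" "\<beta> < 2 * \<mu>0 * \<nu>0"
    proof (cases \<nu>)
      case (real x)
      then show ?thesis using that[of x] nu(2) \<beta> unfolding \<mu>0 by simp
    next
      \<comment> \<open>Here the infimum runs over the empty set and every real number is a lower
        bound; \<nu>0 is taken large enough for the given \<beta>.\<close>
      case PInf
      have "2 * \<mu>0 * (\<bar>\<beta>\<bar> / \<mu>0 + 1) = 2 * \<bar>\<beta>\<bar> + 2 * \<mu>0" using \<mu>0_pos by (simp add: field_simps)
      then have "\<beta> < 2 * \<mu>0 * (\<bar>\<beta>\<bar> / \<mu>0 + 1)" using \<mu>0_pos abs_ge_self[of \<beta>] abs_ge_zero[of \<beta>] by linarith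
      then show ?thesis using that[of "\<bar>\<beta>\<bar> / \<mu>0 + 1"] PInf \<mu>0_pos by (simp add: add_nonneg_pos)
    next
      case MInf
      then show ?thesis using nu(2) by simp
    qed
    \<comment> \<open>\<beta> may be negative or zero here, whereas the weight needs a positive
      rate; half of the critical rate is admissible.\<close>
    define \<beta>' where "\<beta>' = max \<beta> (\<mu>0 * \<nu>0)"
    have \<beta>': "0 < \<beta>'" "\<beta>' < 2 * \<mu>0 * \<nu>0" "\<beta> \<le> \<beta>'"
      using \<nu>0 \<mu>0_pos by (auto simp: \<beta>'_def max_def)
    show "error_bound \<epsilon>0 \<Gamma> (\<lambda>t. exp (- \<beta> * t))"
    proof (rule error_bound_mono[OF \<Gamma>[OF \<nu>0(1,2) \<beta>'(1)]])
      fix t :: real assume "0 \<le> t"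
      then show "0 \<le> exp (- (\<beta>' * damping_int p t)) / (damping p t)\<^sup>2 \<and>
          exp (- (\<beta>' * damping_int p t)) / (damping p t)\<^sup>2 \<le> 1 * exp (- \<beta> * t)"
        using \<beta>'(3) by (simp add: p0 damping_def damping_int_def mult_right_mono)
    qed (use \<beta>' p0 in auto)
  next
    fix \<beta> :: real assume p1: "0 < p \<and> p < 1" and \<beta>: "0 < \<beta>"
    \<comment> \<open>(1 - p) G is (1 + t)^(1 - p) minus 1, which yields the constant exp \<beta>;
      the added 2 pays for the denominator b^2, since exp (- 2 G) \<le> b^2.\<close>
    define \<beta>' where "\<beta>' = \<beta> * (1 - p) + 2"
    have \<beta>': "0 < \<beta>'" "2 \<le> \<beta>'" using \<beta> p1 by (auto simp: \<beta>'_def intro: add_nonneg_pos)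
    show "error_bound \<epsilon>0 \<Gamma> (\<lambda>t. exp (- \<beta> * (1 + t) powr (1 - p)))"
    proof (rule error_bound_mono[OF \<Gamma>[OF \<nu>1 \<beta>'(1)]])
      fix t :: real assume t: "0 \<le> t"
      define g where "g = damping_int p t"
      have g: "(1 - p) * g = (1 + t) powr (1 - p) - 1" using p1 by (simp add: g_def damping_int_def)
      have "exp (- (\<beta>' * g)) = exp \<beta> * exp (- \<beta> * (1 + t) powr (1 - p)) * exp (- (2 * g))"
      proof -
        have "\<beta>' * g = \<beta> * ((1 - p) * g) + 2 * g" by (simp add: \<beta>'_def algebra_simps)
        then have "- (\<beta>' * g) = \<beta> + - \<beta> * (1 + t) powr (1 - p) + - (2 * g)" unfolding g by (simp add: algebra_simps)
        then show ?thesis by (simp only: exp_add)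
      qed
      moreover have "exp (- (2 * g)) / (damping p t)\<^sup>2 \<le> 1"
        using exp_damping_int_square[OF p t] damping_bounds(1)[OF p t] by (simp add: g_def divide_le_eq)
      ultimately have "exp (- (\<beta>' * g)) / (damping p t)\<^sup>2 \<le> exp \<beta> * exp (- \<beta> * (1 + t) powr (1 - p)) * 1"
        by (simp only: times_divide_eq_right[symmetric]) (intro mult_left_mono, auto)
      then show "0 \<le> exp (- (\<beta>' * damping_int p t)) / (damping p t)\<^sup>2 \<and>
          exp (- (\<beta>' * damping_int p t)) / (damping p t)\<^sup>2 \<le> exp \<beta> * exp (- \<beta> * (1 + t) powr (1 - p))"
        by (simp add: g_def)
    qed (use \<beta>' p1 in auto)
  next
    fix \<beta> :: real assume p1: "p = 1" and \<beta>: "0 < \<beta>"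
    show "error_bound \<epsilon>0 \<Gamma> (\<lambda>t. 1 / (1 + t) powr \<beta>)"
    \<comment> \<open>For p = 1 one has exp (- G) = 1 / (1 + t); the 2 again pays for the
      denominator b^2.\<close>
    proof (rule error_bound_mono[OF \<Gamma>[OF \<nu>1, of "\<beta> + 2"]])
      fix t :: real assume t: "0 \<le> t"
      define g where "g = damping_int p t"
      have "exp (- ((\<beta> + 2) * g)) = exp (- (\<beta> * g)) * exp (- (2 * g))"
        by (simp add: distrib_right flip: exp_add)
      moreover have "exp (- (\<beta> * g)) = 1 / (1 + t) powr \<beta>"
        using t p1 by (simp add: g_def damping_int_def powr_def exp_minus divide_inverse)
      moreover have "exp (- (2 * g)) / (damping p t)\<^sup>2 \<le> 1"
        using exp_damping_int_square[OF p t] damping_bounds(1)[OF p t] by (simp add: g_def divide_le_eq)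
      ultimately have "exp (- ((\<beta> + 2) * g)) / (damping p t)\<^sup>2 \<le> 1 / (1 + t) powr \<beta> * 1"
        by (simp only: times_divide_eq_right[symmetric]) (intro mult_left_mono, auto)
      then show "0 \<le> exp (- ((\<beta> + 2) * damping_int p t)) / (damping p t)\<^sup>2 \<and>
          exp (- ((\<beta> + 2) * damping_int p t)) / (damping p t)\<^sup>2 \<le> 1 * (1 / (1 + t) powr \<beta>)"
        by (simp add: g_def)
    qed (use \<beta> p1 in auto)
  qed
  show ?thesis
    using key by (intro conjI impI rates) auto
qed

end
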